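(* Let $T$ be a complete first-order theory (working in its monster model), let $p(y)$ be a type over a set $A$ and let $k\ge 1$ be a natural number. The following are equivalent: (i) $\mathrm{rk}_{dp}(p)\ge k$. (ii) There is a randomness pattern of depth $k$ for $p$ over $A$. (iii) There are a formula $\varphi(x,y)$ and an $A$-indiscernible sequence $I$ in the sort of $x$ such that the $VC^*_\varphi$-density of $p$ over $I$ is at least $k$. (iv) There are a formula $\varphi(x,y)$ and an $A$-indiscernible sequence $I$ in the sort of $x$ such that the $VC^*_\varphi$-density of $p$ over $I$ is bigger than $k-1$. (v) There are a formula $\varphi(x,y)$ and an $A$-indiscernible sequence $I$ in the sort of $x$ such that for every $I'\subseteq I$ of size $k$ there is $c\models p$ with $\{b\in I:\models\varphi(b,c)\}=I'$. (vi) There is a formula $\varphi(x,y)$ with $\mathrm{alt}^{p(y)}_A(\varphi)\ge 2k$.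
   Context: A sequence (infinite, indexed by a linear order) is indiscernible over $C$ if any two increasing finite subsequences of the same length have the same type over $C$; a family is mutually $C$-indiscernible if each member is indiscernible over $C$ together with the union of the others. $\mathrm{rk}_{dp}(p)\ge k$ means: there are a realization $c$ of $p$ and $k$ mutually $A$-indiscernible sequences none of which is indiscernible over $A\cup\{c\}$ (equivalently, it is not the case that for every realization $c$ and every $k$ mutually $A$-indiscernible sequences one of them is indiscernible over $A\cup\{c\}$). A randomness pattern of depth $k$ for $p$ over $A$ consists of sequences $\langle b^\alpha_i: i<\omega\rangle$ ($\alpha<k$) and formulas $\varphi_\alpha(y,z_\alpha)$ such that the sequences are mutually $A$-indiscernible, $b^\alpha_i$ has the length of $z_\alpha$, and for every $\eta\in{}^k\omega$ the set $\{\varphi_\alpha(y,b^\alpha_{\eta(\alpha)})\}_{\alpha<k}\cup\{\neg\varphi_\alpha(y,b^\alpha_i)\}_{\alpha<k,\,i\neq\eta(\alpha)}$ is consistent with $p$. For a set $C$ in the sort of $x$, $S^{p(y)}_\varphi(C)$ is the set of complete $\varphi$-types over $C$ (built from $\varphi(c,y),\neg\varphi(c,y)$, $c\in C$) consistent with $p(y)$; the $VC^*_\varphi$-density of $p$ over $C$ is the infimum of reals $r\ge0$ such that some $f:\mathbb N\to\mathbb R_+$ with $f(n)=O(n^r)$ satisfies $|S^{p(y)}_\varphi(C')|\le f(|C'|)$ for all finite $C'\subseteq C$. $\mathrm{alt}^{p(y)}_A(\varphi)\ge m$ means there are an $A$-indiscernible sequence $I$ in the sort of $x$ and $c\models p$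 such that the truth value of $\varphi(x,c)$ alternates at least $m$ times along $I$. *)

theory Defs
  imports Complex_Main "HOL-Library.Landau_Symbols" "HOL-Library.Extended_Real"
begin

unbundle cardinal_syntax

section \<open>First-order languages and structures\<close>

text \<open>A language is given by its function and relation symbols, each paired with its arity.\<close>

record ('f, 'r) lang =
  Funs :: "('f \<times> nat) set"
  Rels :: "('r \<times> nat) set"

datatype 'f tm = Var nat | Fun 'f "'f tm list"

datatype ('f, 'r) fm =
    FEq "'f tm" "'f tm"
  | FRel 'r "'f tm list"
  | Neg "('f, 'r) fm"
  | Conj "('f, 'r) fm" "('f, 'r) fm"
  | Exi nat "('f, 'r) fm"

fun wf_tm :: "('f, 'r) lang \<Rightarrow> 'f tm \<Rightarrow> bool" where
  "wf_tm L (Var i) \<longleftrightarrow> True"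
| "wf_tm L (Fun f ts) \<longleftrightarrow> (f, length ts) \<in> Funs L \<and> (\<forall>t\<in>set ts. wf_tm L t)"

fun wf_fm :: "('f, 'r) lang \<Rightarrow> ('f, 'r) fm \<Rightarrow> bool" where
  "wf_fm L (FEq s t) \<longleftrightarrow> wf_tm L s \<and> wf_tm L t"
| "wf_fm L (FRel R ts) \<longleftrightarrow> (R, length ts) \<in> Rels L \<and> (\<forall>t\<in>set ts. wf_tm L t)"
| "wf_fm L (Neg \<phi>) \<longleftrightarrow> wf_fm L \<phi>"
| "wf_fm L (Conj \<phi> \<psi>) \<longleftrightarrow> wf_fm L \<phi> \<and> wf_fm L \<psi>"
| "wf_fm L (Exi i \<phi>) \<longleftrightarrow> wf_fm L \<phi>"

fun fv_tm :: "'f tm \<Rightarrow> nat set" where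
  "fv_tm (Var i) = {i}"
| "fv_tm (Fun f ts) = (\<Union>t\<in>set ts. fv_tm t)"

fun fv_fm :: "('f, 'r) fm \<Rightarrow> nat set" where
  "fv_fm (FEq s t) = fv_tm s \<union> fv_tm t"
| "fv_fm (FRel R ts) = (\<Union>t\<in>set ts. fv_tm t)"
| "fv_fm (Neg \<phi>) = fv_fm \<phi>"
| "fv_fm (Conj \<phi> \<psi>) = fv_fm \<phi> \<union> fv_fm \<psi>"
| "fv_fm (Exi i \<phi>) = fv_fm \<phi> - {i}"

definition is_fm :: "('f, 'r) lang \<Rightarrow> nat \<Rightarrow> ('f, 'r) fm \<Rightarrow> bool" where
  "is_fm L n \<phi> \<longleftrightarrow> wf_fm L \<phi> \<and> fv_fm \<phi> \<subseteq> {..<n}"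

text \<open>The universe of a structure is the whole type \<open>'a\<close>. The values of the interpretations on
  argument lists whose length is not an arity declared in the language are irrelevant.\<close>

record ('f, 'r, 'a) struct =
  Fint :: "'f \<Rightarrow> 'a list \<Rightarrow> 'a"
  Rint :: "'r \<Rightarrow> 'a list \<Rightarrow> bool"

fun eval_tm :: "('f, 'r, 'a) struct \<Rightarrow> (nat \<Rightarrow> 'a) \<Rightarrow> 'f tm \<Rightarrow> 'a" where
  "eval_tm M e (Var i) = e i"
| "eval_tm M e (Fun f ts) = Fint M f (map (eval_tm M e) ts)"

fun sat :: "('f, 'r, 'a) struct \<Rightarrow> (nat \<Rightarrow> 'a) \<Rightarrow> ('f, 'r) fm \<Rightarrow> bool" where
  "sat M e (FEq s t) \<longleftrightarrow> eval_tm M e s = eval_tm M e t"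
| "sat M e (FRel R ts) \<longleftrightarrow> Rint M R (map (eval_tm M e) ts)"
| "sat M e (Neg \<phi>) \<longleftrightarrow> \<not> sat M e \<phi>"
| "sat M e (Conj \<phi> \<psi>) \<longleftrightarrow> sat M e \<phi> \<and> sat M e \<psi>"
| "sat M e (Exi i \<phi>) \<longleftrightarrow> (\<exists>a. sat M (e(i := a)) \<phi>)"

text \<open>\<open>holds M \<phi> us\<close> is only used when the free variables of \<open>\<phi>\<close> are among the first
  \<open>length us\<close> variables. A formula \<open>\<phi>(x, y)\<close> with \<open>x\<close> of length \<open>n\<close> and \<open>y\<close> of length \<open>m\<close> is a
  formula in the first \<open>n + m\<close> variables, and \<open>\<phi>(b, c)\<close> is \<open>holds M \<phi> (b @ c)\<close>.\<close>

definition holds :: "('f, 'r, 'a) struct \<Rightarrow> ('f, 'r) fm \<Rightarrow> 'a list \<Rightarrow> bool" where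
  "holds M \<phi> us \<longleftrightarrow> sat M (\<lambda>i. if i < length us then us ! i else undefined) \<phi>"

section \<open>Types over parameter sets\<close>

text \<open>A pair \<open>(\<phi>, a)\<close> stands for the formula \<open>\<phi>(a, y)\<close> with parameters \<open>a\<close>: the parameters
  replace the first \<open>length a\<close> variables and the tuple \<open>y\<close> consists of the following ones.\<close>

type_synonym ('f, 'r, 'a) pfm = "('f, 'r) fm \<times> 'a list"

definition realizes :: "('f, 'r, 'a) struct \<Rightarrow> nat \<Rightarrow> 'a list \<Rightarrow> ('f, 'r, 'a) pfm set \<Rightarrow> bool" where
  "realizes M m c q \<longleftrightarrow> length c = m \<and> (\<forall>(\<phi>, a)\<in>q. holds M \<phi> (a @ c))"

definition consistent :: "('f, 'r, 'a) struct \<Rightarrow> nat \<Rightarrow> ('f, 'r, 'a) pfm set \<Rightarrow> bool" where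
  "consistent M m q \<longleftrightarrow> (\<forall>q'. finite q' \<and> q' \<subseteq> q \<longrightarrow> (\<exists>c. realizes M m c q'))"

text \<open>Types are not required to be complete.\<close>

definition type_over ::
  "('f, 'r) lang \<Rightarrow> ('f, 'r, 'a) struct \<Rightarrow> 'a set \<Rightarrow> nat \<Rightarrow> ('f, 'r, 'a) pfm set \<Rightarrow> bool" where
  "type_over L M A m p \<longleftrightarrow>
     (\<forall>(\<phi>, a)\<in>p. set a \<subseteq> A \<and> is_fm L (length a + m) \<phi>) \<and> consistent M m p"

definition same_type ::
  "('f, 'r) lang \<Rightarrow> ('f, 'r, 'a) struct \<Rightarrow> 'a set \<Rightarrow> 'a list \<Rightarrow> 'a list \<Rightarrow> bool" where
  "same_type L M C u v \<longleftrightarrow> length u = length v \<and>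
     (\<forall>\<phi> a. set a \<subseteq> C \<and> is_fm L (length a + length u) \<phi> \<longrightarrow>
        (holds M \<phi> (a @ u) \<longleftrightarrow> holds M \<phi> (a @ v)))"

section \<open>Complete theories and monster models\<close>

text \<open>Theories are identified with their deductive closure, so that completeness is expressed by
  membership. Consistency is not part of this definition: a monster model of \<open>T\<close> is in
  particular a model of \<open>T\<close>.\<close>

definition complete_theory :: "('f, 'r) lang \<Rightarrow> ('f, 'r) fm set \<Rightarrow> bool" where
  "complete_theory L T \<longleftrightarrow>
     (\<forall>\<sigma>\<in>T. is_fm L 0 \<sigma>) \<and> (\<forall>\<sigma>. is_fm L 0 \<sigma> \<longrightarrow> \<sigma> \<in> T \<or> Neg \<sigma> \<in> T)"

definition saturated :: "('f, 'r) lang \<Rightarrow> 'k rel \<Rightarrow> ('f, 'r, 'a) struct \<Rightarrow> bool" where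
  "saturated L \<kappa> M \<longleftrightarrow>
     (\<forall>A m q. |A| <o \<kappa> \<and> type_over L M A m q \<longrightarrow> (\<exists>c. realizes M m c q))"

definition elementary_map ::
  "('f, 'r) lang \<Rightarrow> ('f, 'r, 'a) struct \<Rightarrow> 'a set \<Rightarrow> ('a \<Rightarrow> 'a) \<Rightarrow> bool" where
  "elementary_map L M A h \<longleftrightarrow>
     (\<forall>\<phi> a. set a \<subseteq> A \<and> is_fm L (length a) \<phi> \<longrightarrow> (holds M \<phi> a \<longleftrightarrow> holds M \<phi> (map h a)))"

definition automorphism :: "('f, 'r) lang \<Rightarrow> ('f, 'r, 'a) struct \<Rightarrow> ('a \<Rightarrow> 'a) \<Rightarrow> bool" where
  "automorphism L M s \<longleftrightarrow> bij s \<and>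
     (\<forall>f us. (f, length us) \<in> Funs L \<longrightarrow> s (Fint M f us) = Fint M f (map s us)) \<and>
     (\<forall>R us. (R, length us) \<in> Rels L \<longrightarrow> (Rint M R us \<longleftrightarrow> Rint M R (map s us)))"

definition strongly_homogeneous ::
  "('f, 'r) lang \<Rightarrow> 'k rel \<Rightarrow> ('f, 'r, 'a) struct \<Rightarrow> bool" where
  "strongly_homogeneous L \<kappa> M \<longleftrightarrow>
     (\<forall>A h. |A| <o \<kappa> \<and> elementary_map L M A h \<longrightarrow>
        (\<exists>s. automorphism L M s \<and> (\<forall>a\<in>A. s a = h a)))"

definition monster_model ::
  "('f, 'r) lang \<Rightarrow> ('f, 'r) fm set \<Rightarrow> 'k rel \<Rightarrow> ('f, 'r, 'a) struct \<Rightarrow> bool" where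
  "monster_model L T \<kappa> M \<longleftrightarrow>
     Card_order \<kappa> \<and> natLeq <o \<kappa> \<and> |Funs L| <o \<kappa> \<and> |Rels L| <o \<kappa> \<and>
     (\<forall>\<sigma>\<in>T. holds M \<sigma> []) \<and> saturated L \<kappa> M \<and> strongly_homogeneous L \<kappa> M"

section \<open>Indiscernible sequences\<close>

text \<open>A sequence is a function \<open>b\<close> on the field of a reflexive linear order \<open>r\<close>.\<close>

definition increasing :: "'i rel \<Rightarrow> 'i list \<Rightarrow> bool" where
  "increasing r js \<longleftrightarrow> set js \<subseteq> Field r \<and> sorted_wrt (\<lambda>i j. (i, j) \<in> r \<and> i \<noteq> j) js"

definition tuple_seq :: "nat \<Rightarrow> 'i rel \<Rightarrow> ('i \<Rightarrow> 'a list) \<Rightarrow> bool" where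
  "tuple_seq n r b \<longleftrightarrow>
     Linear_order r \<and> infinite (Field r) \<and> (\<forall>i\<in>Field r. length (b i) = n)"

definition indiscernible ::
  "('f, 'r) lang \<Rightarrow> ('f, 'r, 'a) struct \<Rightarrow> 'a set \<Rightarrow> nat \<Rightarrow> 'i rel \<Rightarrow> ('i \<Rightarrow> 'a list) \<Rightarrow> bool" where
  "indiscernible L M C n r b \<longleftrightarrow> tuple_seq n r b \<and>
     (\<forall>is js. increasing r is \<and> increasing r js \<and> length is = length js \<longrightarrow>
        same_type L M C (concat (map b is)) (concat (map b js)))"

definition mutually_indiscernible ::
  "('f, 'r) lang \<Rightarrow> ('f, 'r, 'a) struct \<Rightarrow> 'a set \<Rightarrow> nat \<Rightarrow> (nat \<Rightarrow> nat) \<Rightarrow> (nat \<Rightarrow> 'i rel)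
     \<Rightarrow> (nat \<Rightarrow> 'i \<Rightarrow> 'a list) \<Rightarrow> bool" where
  "mutually_indiscernible L M C k n r b \<longleftrightarrow>
     (\<forall>\<alpha><k. indiscernible L M
        (C \<union> (\<Union>\<beta>\<in>{..<k} - {\<alpha>}. \<Union>i\<in>Field (r \<beta>). set (b \<beta> i))) (n \<alpha>) (r \<alpha>) (b \<alpha>))"

section \<open>dp-rank, randomness patterns, density and alternation\<close>

text \<open>HOL cannot quantify over types inside a formula, so the type \<open>'i\<close> from which the index
  orders are drawn is an explicit parameter where it would otherwise be hidden. Any linear order on
  any infinite subset of \<open>'i\<close> may be used.\<close>

definition dp_rank_ge ::
  "'i itself \<Rightarrow> ('f, 'r) lang \<Rightarrow> ('f, 'r, 'a) struct \<Rightarrow> 'a set \<Rightarrow> nat \<Rightarrow> ('f, 'r, 'a) pfm set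
     \<Rightarrow> nat \<Rightarrow> bool" where
  "dp_rank_ge I L M A m p k \<longleftrightarrow>
     (\<exists>c n (r :: nat \<Rightarrow> 'i rel) b. realizes M m c p \<and> mutually_indiscernible L M A k n r b \<and>
        (\<forall>\<alpha><k. \<not> indiscernible L M (A \<union> set c) (n \<alpha>) (r \<alpha>) (b \<alpha>)))"

text \<open>In \<open>\<phi> \<alpha>\<close> the variables \<open>z\<^sub>\<alpha>\<close> (of length \<open>n \<alpha>\<close>) precede \<open>y\<close>.\<close>

definition randomness_pattern ::
  "('f, 'r) lang \<Rightarrow> ('f, 'r, 'a) struct \<Rightarrow> 'a set \<Rightarrow> nat \<Rightarrow> ('f, 'r, 'a) pfm set \<Rightarrow> nat
     \<Rightarrow> (nat \<Rightarrow> nat) \<Rightarrow> (nat \<Rightarrow> nat \<Rightarrow> 'a list) \<Rightarrow> (nat \<Rightarrow> ('f, 'r) fm) \<Rightarrow> bool" where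
  "randomness_pattern L M A m p k n b \<phi> \<longleftrightarrow>
     (\<forall>\<alpha><k. is_fm L (n \<alpha> + m) (\<phi> \<alpha>)) \<and>
     mutually_indiscernible L M A k n (\<lambda>\<alpha>. natLeq) b \<and>
     (\<forall>\<eta> :: nat \<Rightarrow> nat.
        consistent M m
          (p \<union> {(\<phi> \<alpha>, b \<alpha> (\<eta> \<alpha>)) |\<alpha>. \<alpha> < k}
             \<union> {(Neg (\<phi> \<alpha>), b \<alpha> i) |\<alpha> i. \<alpha> < k \<and> i \<noteq> \<eta> \<alpha>}))"

definition phi_types ::
  "('f, 'r, 'a) struct \<Rightarrow> nat \<Rightarrow> ('f, 'r, 'a) pfm set \<Rightarrow> ('f, 'r) fm \<Rightarrow> 'a list set
     \<Rightarrow> ('f, 'r, 'a) pfm set set" where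
  "phi_types M m p \<phi> C =
     {q. q \<subseteq> {\<phi>, Neg \<phi>} \<times> C \<and> (\<forall>b\<in>C. ((\<phi>, b) \<in> q) \<noteq> ((Neg \<phi>, b) \<in> q)) \<and>
         consistent M m (p \<union> q)}"

text \<open>The infimum is taken in the extended reals, so that it is \<open>\<infinity>\<close> if no exponent works.\<close>

definition vc_density ::
  "('f, 'r, 'a) struct \<Rightarrow> nat \<Rightarrow> ('f, 'r, 'a) pfm set \<Rightarrow> ('f, 'r) fm \<Rightarrow> 'a list set \<Rightarrow> ereal" where
  "vc_density M m p \<phi> C =
     Inf {ereal r |r. r \<ge> 0 \<and>
       (\<exists>f :: nat \<Rightarrow> real. (\<forall>n. f n \<ge> 0) \<and> f \<in> O(\<lambda>n. real n powr r) \<and>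
          (\<forall>C'. finite C' \<and> C' \<subseteq> C \<longrightarrow> real (card (phi_types M m p \<phi> C')) \<le> f (card C')))}"

definition alt_ge ::
  "'i itself \<Rightarrow> ('f, 'r) lang \<Rightarrow> ('f, 'r, 'a) struct \<Rightarrow> 'a set \<Rightarrow> nat \<Rightarrow> ('f, 'r, 'a) pfm set
     \<Rightarrow> nat \<Rightarrow> ('f, 'r) fm \<Rightarrow> nat \<Rightarrow> bool" where
  "alt_ge I L M A m p n \<phi> l \<longleftrightarrow>
     (\<exists>(r :: 'i rel) b c is. indiscernible L M A n r b \<and> realizes M m c p \<and>
        increasing r is \<and> length is = Suc l \<and>
        (\<forall>j<l. holds M \<phi> (b (is ! j) @ c) \<noteq> holds M \<phi> (b (is ! Suc j) @ c)))"

end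

theory Submission
  imports Defs "HOL-Library.Countable_Set_Type"
begin

text \<open>
  The implications form the cycle (i) \<open>\<Rightarrow>\<close> (ii) \<open>\<Rightarrow>\<close> (v) \<open>\<Rightarrow>\<close> (iii) \<open>\<Rightarrow>\<close> (iv) \<open>\<Rightarrow>\<close> (vi) \<open>\<Rightarrow>\<close> (i).

  (i) \<open>\<Rightarrow>\<close> (ii): by saturation, mutually indiscernible sequences extend to ones indexed by the
  rationals that keep finitely many prescribed entries. If \<open>c\<close> breaks the indiscernibility of one of
  them, a formula \<open>\<theta>(x, c)\<close> takes both truth values on increasing blocks of its entries, and by the
  pigeonhole principle it is constant on long stretches of blocks far to the left and far to the
  right. Hence the exclusive disjunction of \<open>\<theta>\<close> on two consecutive blocks can be made true at exactly
  one prescribed pair of blocks, in all sequences simultaneously.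

  (ii) \<open>\<Rightarrow>\<close> (v) takes the disjunction of the formulas of the pattern, and (v) \<open>\<Rightarrow>\<close> (iii) counts the
  \<open>k\<close>-element subsets of an \<open>n\<close>-element set.

  (iv) \<open>\<Rightarrow>\<close> (vi): suppose that neither \<open>\<phi>(x, y)\<close> nor the exclusive disjunction of \<open>\<phi>(x, y)\<close> and
  \<open>\<phi>(x', y)\<close> alternates \<open>2k\<close> times. Then the truth value of \<open>\<phi>(x, c)\<close> along \<open>n\<close> entries changes fewer
  than \<open>2k\<close> times, and all changes lie near the two ends or in at most \<open>k - 1\<close> intervals of bounded
  length; there are only \<open>O(n\<^sup>k\<^sup>-\<^sup>1)\<close> such patterns.

  (vi) \<open>\<Rightarrow>\<close> (i): extend the sequence to the rationals and cut it into \<open>k\<close> convex pieces, each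
  containing two entries at which \<open>\<phi>(x, c)\<close> has different truth values.
\<close>

section \<open>Renaming variables\<close>

text \<open>The rationals serve as index order because they are countable, so that an extension can
  be built one tuple at a time with only finitely many new parameters present, and because they
  leave room both beyond and between the prescribed indices. The prescribed entries are kept since
  all that is known about the realization \<open>c\<close> is its behaviour on them, and this must
  survive the extension. All transfers are made by elementary relations, which can be composed,
  inverted and, by saturation, extended pair by pair. In (iv) \<Rightarrow> (vi) the obstacle is
  that fewer than \<open>2 * k\<close> alternations of \<open>\<phi>\<close> alone only give the
  exponent \<open>2 * k - 1\<close>. The exclusive disjunction lowers it: \<open>k\<close> changes
  far from each other and from the ends can be interleaved with \<open>k + 1\<close> unchanged
  pairs, and along these \<open>2 * k + 1\<close> pairs it alternates \<open>2 * k\<close> times. So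
  the changes away from the ends form at most \<open>k - 1\<close> clusters. Sequences built over
  \<open>nat\<close> are moved into the infinite index type \<open>'i\<close> along an
  injection.\<close>

lemma eval_tm_cong: "(\<And>i. i \<in> fv_tm t \<Longrightarrow> e i = e' i) \<Longrightarrow> eval_tm M e t = eval_tm M e' t"
proof (induction t)
  case (Fun f ts)
  then have "map (eval_tm M e) ts = map (eval_tm M e') ts"
    by (auto intro!: map_cong)
  then show ?case by (simp only: eval_tm.simps sat.simps)
qed auto

lemma sat_cong: "(\<And>i. i \<in> fv_fm \<phi> \<Longrightarrow> e i = e' i) \<Longrightarrow> sat M e \<phi> \<longleftrightarrow> sat M e' \<phi>"
proof (induction \<phi> arbitrary: e e')
  case (FEq s t)
  then show ?case using eval_tm_cong[of s e e' M] eval_tm_cong[of t e e' M] by simp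
next
  case (FRel R ts)
  then have "map (eval_tm M e) ts = map (eval_tm M e') ts"
    by (intro map_cong refl eval_tm_cong) auto
  then show ?case by (simp only: eval_tm.simps sat.simps)
next
  case (Neg \<phi>)
  from Neg.IH[of e e'] Neg.prems show ?case by simp
next
  case (Conj \<phi> \<psi>)
  from Conj.IH(1)[of e e'] Conj.IH(2)[of e e'] Conj.prems show ?case by simp
next
  case (Exi i \<phi>)
  have "sat M (e(i := a)) \<phi> \<longleftrightarrow> sat M (e'(i := a)) \<phi>" for a
    using Exi.prems by (intro Exi.IH) auto
  then show ?case by simp
qed

lemma finite_fv_tm: "finite (fv_tm t)"
  by (induction t) auto

lemma finite_fv_fm: "finite (fv_fm \<phi>)"
  by (induction \<phi>) (auto simp: finite_fv_tm)

fun rename_tm :: "(nat \<Rightarrow> nat) \<Rightarrow> 'f tm \<Rightarrow> 'f tm" where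
  "rename_tm g (Var i) = Var (g i)"
| "rename_tm g (Fun f ts) = Fun f (map (rename_tm g) ts)"

definition fresh :: "nat set \<Rightarrow> nat" where
  "fresh X = (LEAST j. j \<notin> X)"

lemma fresh_notin: "finite X \<Longrightarrow> fresh X \<notin> X"
  unfolding fresh_def by (rule LeastI_ex) (rule ex_new_if_finite[OF infinite_UNIV_nat])

text \<open>Capture-avoiding renaming along an arbitrary \<open>g\<close>, which need not be
  injective. The bound variable moves outside the image of the free variables of the body. The
  result is a function of \<open>g\<close>, so that primitive recursion may change \<open>g\<close>
  below the quantifier.\<close>

primrec rename :: "('f, 'r) fm \<Rightarrow> (nat \<Rightarrow> nat) \<Rightarrow> ('f, 'r) fm" where
  "rename (FEq s t) = (\<lambda>g. FEq (rename_tm g s) (rename_tm g t))"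
| "rename (FRel R ts) = (\<lambda>g. FRel R (map (rename_tm g) ts))"
| "rename (Neg \<phi>) = (\<lambda>g. Neg (rename \<phi> g))"
| "rename (Conj \<phi> \<psi>) = (\<lambda>g. Conj (rename \<phi> g) (rename \<psi> g))"
| "rename (Exi i \<phi>) = (\<lambda>g. Exi (fresh (g ` fv_fm \<phi>)) (rename \<phi> (g(i := fresh (g ` fv_fm \<phi>)))))"

lemma wf_rename_tm: "wf_tm L t \<Longrightarrow> wf_tm L (rename_tm g t)"
  by (induction t) auto

lemma fv_rename_tm: "fv_tm (rename_tm g t) = g ` fv_tm t"
  by (induction t) auto

lemma eval_rename_tm: "eval_tm M e (rename_tm g t) = eval_tm M (e \<circ> g) t"
  by (induction t) (auto simp: comp_def cong: map_cong)

lemma wf_rename: "wf_fm L \<phi> \<Longrightarrow> wf_fm L (rename \<phi> g)"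
  by (induction \<phi> arbitrary: g) (auto simp: wf_rename_tm)

lemma fv_rename: "fv_fm (rename \<phi> g) \<subseteq> g ` fv_fm \<phi>"
proof (induction \<phi> arbitrary: g)
  case (Conj \<phi> \<psi>)
  then show ?case by (simp add: image_Un) blast
next
  case (Exi i \<phi>)
  show ?case
    unfolding rename.simps fv_fm.simps
    using Exi.IH[of "g(i := fresh (g ` fv_fm \<phi>))"] by fastforce
qed (auto simp: fv_rename_tm)

lemma sat_rename: "sat M e (rename \<phi> g) \<longleftrightarrow> sat M (e \<circ> g) \<phi>"
proof (induction \<phi> arbitrary: e g)
  case (FRel R ts)
  then show ?case by (simp add: eval_rename_tm comp_def)
next
  case (Exi i \<phi>)
  let ?j = "fresh (g ` fv_fm \<phi>)"
  have j: "?j \<notin> g ` fv_fm \<phi>"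
    by (simp add: fresh_notin finite_fv_fm)
  \<comment> \<open>Free variables other than \<open>i\<close> are not sent to \<open>?j\<close>, so
    the update at \<open>?j\<close> is seen only through \<open>i\<close>.\<close>
  have "sat M (e(?j := a) \<circ> g(i := ?j)) \<phi> \<longleftrightarrow> sat M ((e \<circ> g)(i := a)) \<phi>" for a
    using j by (intro sat_cong) (auto, metis image_eqI)
  then show ?case unfolding rename.simps sat.simps Exi.IH by blast
qed (auto simp: eval_rename_tm)

lemma holds_eq_sat:
  assumes "is_fm L (length us) \<phi>" "\<And>i. i < length us \<Longrightarrow> e i = us ! i"
  shows "holds M \<phi> us \<longleftrightarrow> sat M e \<phi>"
  unfolding holds_def using assms by (intro sat_cong) (auto simp: is_fm_def)

lemma is_fm_rename:
  assumes "is_fm L n \<phi>" "\<And>i. i < n \<Longrightarrow> g i < n'"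
  shows "is_fm L n' (rename \<phi> g)"
  using assms fv_rename[of \<phi> g] by (fastforce simp: is_fm_def wf_rename)

text \<open>\<open>g\<close> may identify, reorder or skip entries of \<open>vs\<close>, so this
  covers every change of variables below: dummy entries, merged variables and rearranged
  tuples.\<close>

lemma holds_rename:
  assumes "is_fm L (length us) \<phi>" "\<And>i. i < length us \<Longrightarrow> g i < length vs \<and> vs ! g i = us ! i"
  shows "holds M (rename \<phi> g) vs \<longleftrightarrow> holds M \<phi> us"
  using assms(2) by (subst holds_eq_sat[OF assms(1),
        of "(\<lambda>i. if i < length vs then vs ! i else undefined) \<circ> g"]) (auto simp: holds_def sat_rename)

lemma holds_Neg [simp]: "holds M (Neg \<phi>) us \<longleftrightarrow> \<not> holds M \<phi> us"
  by (simp add: holds_def)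

lemma holds_Conj [simp]: "holds M (Conj \<phi> \<psi>) us \<longleftrightarrow> holds M \<phi> us \<and> holds M \<psi> us"
  by (simp add: holds_def)

lemma is_fm_Neg [simp]: "is_fm L n (Neg \<phi>) \<longleftrightarrow> is_fm L n \<phi>"
  by (simp add: is_fm_def)

lemma is_fm_Conj [simp]: "is_fm L n (Conj \<phi> \<psi>) \<longleftrightarrow> is_fm L n \<phi> \<and> is_fm L n \<psi>"
  by (auto simp: is_fm_def)

lemma is_fm_Exi: "is_fm L (Suc n) \<phi> \<Longrightarrow> is_fm L n (Exi n \<phi>)"
  by (auto simp: is_fm_def less_Suc_eq)

lemma holds_Exi: "holds M (Exi (length us) \<phi>) us \<longleftrightarrow> (\<exists>a. holds M \<phi> (us @ [a]))"
proof -
  have "(\<lambda>i. if i < length us then us ! i else undefined)(length us := a) =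
        (\<lambda>i. if i < length (us @ [a]) then (us @ [a]) ! i else undefined)" for a
    by (auto simp: nth_append fun_eq_iff)
  then show ?thesis by (simp add: holds_def)
qed

section \<open>Elementary relations\<close>

text \<open>Comparing assignments instead of tuples makes equality of types insensitive to the order
  and to repetitions of the entries: two tuples \<open>u\<close>, \<open>v\<close> have the same type over \<open>C\<close> iff
  \<open>Id_on C \<union> set (zip u v)\<close> is elementary.\<close>

definition elementary_rel ::
  "('f, 'r) lang \<Rightarrow> ('f, 'r, 'a) struct \<Rightarrow> ('a \<times> 'a) set \<Rightarrow> bool" where
  "elementary_rel L M R \<longleftrightarrow>
     (\<forall>\<phi> e e'. wf_fm L \<phi> \<and> (\<forall>i. (e i, e' i) \<in> R) \<longrightarrow> (sat M e \<phi> \<longleftrightarrow> sat M e' \<phi>))"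

lemma elementary_rel_mono: "elementary_rel L M R \<Longrightarrow> S \<subseteq> R \<Longrightarrow> elementary_rel L M S"
  unfolding elementary_rel_def by blast

lemma elementary_rel_Id_on: "elementary_rel L M (Id_on C)"
proof -
  have "e = e'" if "\<forall>i. (e i, e' i) \<in> Id_on C" for e e' :: "nat \<Rightarrow> _"
    using that by (auto simp: Id_on_def fun_eq_iff)
  then show ?thesis unfolding elementary_rel_def by metis
qed

lemma elementary_rel_converse: "elementary_rel L M R \<Longrightarrow> elementary_rel L M (R\<inverse>)"
  unfolding elementary_rel_def by auto

lemma elementary_rel_comp:
  assumes "elementary_rel L M R" "elementary_rel L M S"
  shows "elementary_rel L M (R O S)"
  unfolding elementary_rel_def
proof (intro allI impI)
  fix \<phi> and e e'' :: "nat \<Rightarrow> _"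
  assume *: "wf_fm L \<phi> \<and> (\<forall>i. (e i, e'' i) \<in> R O S)"
  then have "\<forall>i. \<exists>x. (e i, x) \<in> R \<and> (x, e'' i) \<in> S" by blast
  then obtain e' where "\<And>i. (e i, e' i) \<in> R \<and> (e' i, e'' i) \<in> S" by metis
  then show "sat M e \<phi> \<longleftrightarrow> sat M e'' \<phi>"
    using assms * unfolding elementary_rel_def by metis
qed

text \<open>A formula sees only finitely many variables, so both assignments may be replaced by ones
  with finite range.\<close>

lemma elementary_rel_finite:
  assumes "\<And>F. finite F \<Longrightarrow> F \<subseteq> R \<Longrightarrow> elementary_rel L M F"
  shows "elementary_rel L M R"
  unfolding elementary_rel_def
proof (intro allI impI)
  fix \<phi> and e e' :: "nat \<Rightarrow> _"
  assume *: "wf_fm L \<phi> \<and> (\<forall>i. (e i, e' i) \<in> R)"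
  \<comment> \<open>\<open>0\<close> is added so that the default pair \<open>(e 0, e' 0)\<close>,
    used off the free variables, belongs to the finite relation.\<close>
  define X where "X = insert 0 (fv_fm \<phi>)"
  define d where "d i = (if i \<in> X then e i else e 0)" for i
  define d' where "d' i = (if i \<in> X then e' i else e' 0)" for i
  have X: "finite X" "0 \<in> X" by (auto simp: X_def finite_fv_fm)
  let ?F = "(\<lambda>i. (e i, e' i)) ` X"
  have "elementary_rel L M ?F"
    using * X by (intro assms) auto
  moreover have "\<forall>i. (d i, d' i) \<in> ?F"
    using X by (auto simp: d_def d'_def)
  ultimately have "sat M d \<phi> \<longleftrightarrow> sat M d' \<phi>"
    using * unfolding elementary_rel_def by blast
  moreover have "sat M d \<phi> \<longleftrightarrow> sat M e \<phi>" "sat M d' \<phi> \<longleftrightarrow> sat M e' \<phi>"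
    by (auto intro!: sat_cong simp: d_def d'_def X_def)
  ultimately show "sat M e \<phi> \<longleftrightarrow> sat M e' \<phi>" by simp
qed

lemma elementary_rel_holds:
  fixes u v :: "'a list"
  assumes "elementary_rel L M R" "list_all2 (\<lambda>x y. (x, y) \<in> R) u v" "is_fm L (length u) \<phi>"
  shows "holds M \<phi> u \<longleftrightarrow> holds M \<phi> v"
proof (cases "u = []")
  case True
  then show ?thesis using assms by simp
next
  case False
  define e where "e w i = (if i < length u then w ! i else w ! 0)" for w :: "'a list" and i
  have len: "length u = length v" using assms(2) by (rule list_all2_lengthD)
  have "(e u i, e v i) \<in> R" for i
    using assms(2) False len by (cases u; cases v) (auto simp: e_def list_all2_conv_all_nth)
  then have "sat M (e u) \<phi> \<longleftrightarrow> sat M (e v) \<phi>"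
    using assms(1,3) by (auto simp: elementary_rel_def is_fm_def)
  then show ?thesis
    using holds_eq_sat[OF assms(3), of "e u"] holds_eq_sat[of L v \<phi> "e v"] assms(3) len
    by (auto simp: e_def)
qed

text \<open>Used to collect into one parameter tuple the variables of a formula whose values satisfy
  a condition.\<close>

lemma indices_of_subset:
  fixes X :: "nat set"
  assumes "finite X"
  obtains js g where "set js = {i \<in> X. P i}" "\<And>i. i \<in> X \<Longrightarrow> P i \<Longrightarrow> g i < length js \<and> js ! g i = i"
proof -
  obtain js where js: "set js = {i \<in> X. P i}"
    using finite_list[of "{i \<in> X. P i}"] assms by auto
  have "\<forall>i. \<exists>s. i \<in> X \<and> P i \<longrightarrow> s < length js \<and> js ! s = i"
    using js by (metis (mono_tags, lifting) in_set_conv_nth mem_Collect_eq)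
  then obtain g where "\<forall>i. i \<in> X \<and> P i \<longrightarrow> g i < length js \<and> js ! g i = i" by metis
  then show ?thesis using that js by blast
qed

lemma elementary_rel_if_same_type:
  assumes "same_type L M C u v"
  shows "elementary_rel L M (Id_on C \<union> set (zip u v))"
  unfolding elementary_rel_def
proof (intro allI impI)
  fix \<phi> and e e' :: "nat \<Rightarrow> _"
  assume *: "wf_fm L \<phi> \<and> (\<forall>i. (e i, e' i) \<in> Id_on C \<union> set (zip u v))"
  have len: "length u = length v" using assms by (simp add: same_type_def)
  define P where "P i \<longleftrightarrow> (e i, e' i) \<in> Id_on C" for i
  obtain js g where js: "set js = {i \<in> fv_fm \<phi>. P i}"
    and g: "\<And>i. i \<in> fv_fm \<phi> \<Longrightarrow> P i \<Longrightarrow> g i < length js \<and> js ! g i = i"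
    by (rule indices_of_subset[OF finite_fv_fm, where P = P]) blast
  have "\<forall>i. \<exists>t. \<not> P i \<longrightarrow> t < length u \<and> e i = u ! t \<and> e' i = v ! t"
  proof (intro allI)
    fix i
    have "(e i, e' i) \<in> Id_on C \<union> set (zip u v)" using * by blast
    then show "\<exists>t. \<not> P i \<longrightarrow> t < length u \<and> e i = u ! t \<and> e' i = v ! t"
      by (auto simp: P_def set_zip)
  qed
  then obtain h where h: "\<And>i. \<not> P i \<Longrightarrow> h i < length u \<and> e i = u ! h i \<and> e' i = v ! h i"
    by metis
  \<comment> \<open>Variables with values in \<open>C\<close> become parameters at the front; the
    others point to an entry of \<open>u\<close>, and to the same place in \<open>v\<close>.\<close>
  define f where "f i = (if P i then g i else length js + h i)" for i
  let ?a = "map e js" and ?\<psi> = "rename \<phi> f"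
  have a': "?a = map e' js" using js by (auto simp: P_def)
  have f: "f i < length js + length u \<and> (map e js @ u) ! f i = e i \<and> (map e' js @ v) ! f i = e' i"
    if "i \<in> fv_fm \<phi>" for i
    using g[OF that] h[of i] by (auto simp: f_def nth_append trans_less_add1)
  have fm: "is_fm L (length ?a + length u) ?\<psi>"
    using * f fv_rename[of \<phi> f] by (fastforce simp: is_fm_def wf_rename)
  moreover have "set ?a \<subseteq> C" using js by (auto simp: P_def)
  ultimately have "holds M ?\<psi> (?a @ u) \<longleftrightarrow> holds M ?\<psi> (?a @ v)"
    using assms unfolding same_type_def by blast
  moreover have "holds M ?\<psi> (?a @ u) \<longleftrightarrow> sat M e \<phi>"
    unfolding holds_def sat_rename using f by (intro sat_cong) auto
  moreover have "holds M ?\<psi> (?a @ v) \<longleftrightarrow> sat M e' \<phi>"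
    unfolding a' holds_def sat_rename using f len by (intro sat_cong) auto
  ultimately show "sat M e \<phi> \<longleftrightarrow> sat M e' \<phi>" by simp
qed

lemma same_type_if_elementary_rel:
  assumes "elementary_rel L M (Id_on C \<union> set (zip u v))" "length u = length v"
  shows "same_type L M C u v"
  unfolding same_type_def
proof (intro conjI allI impI)
  fix \<phi> a
  assume *: "set a \<subseteq> C \<and> is_fm L (length a + length u) \<phi>"
  have "list_all2 (\<lambda>x y. (x, y) \<in> Id_on C \<union> set (zip u v)) (a @ u) (a @ v)"
    using * assms(2) by (intro list_all2_appendI) (auto simp: list_all2_conv_all_nth set_zip)
  from elementary_rel_holds[OF assms(1) this] * show "holds M \<phi> (a @ u) \<longleftrightarrow> holds M \<phi> (a @ v)"
    by simp
qed (use assms in simp)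

text \<open>The back-and-forth step: the type of \<open>y\<close> over the range of
  \<open>R\<close>, pulled back along \<open>R\<close>, is finitely satisfiable because
  \<open>R\<close> preserves existential formulas, and saturation realizes it. The parameters after
  pulling back lie in \<open>Domain R\<close>, which is therefore the side whose size is
  bounded.\<close>

lemma elementary_rel_extend:
  assumes sat: "saturated L \<kappa> M" and R: "elementary_rel L M R" and small: "|Domain R| <o \<kappa>"
  shows "\<exists>x. elementary_rel L M (insert (x, y) R)"
proof -
  define q where "q = {(\<phi>, a). is_fm L (length a + 1) \<phi> \<and>
    (\<exists>a'. list_all2 (\<lambda>x y. (x, y) \<in> R) a a' \<and> holds M \<phi> (a' @ [y]))}"
  \<comment> \<open>By conjunction, every finite part of \<open>q\<close> follows from a single
    member of \<open>q\<close>.\<close>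
  have conj: "\<exists>(\<phi>, a)\<in>q. \<forall>x. holds M \<phi> (a @ [x]) \<longrightarrow> (\<forall>(\<psi>, d)\<in>q'. holds M \<psi> (d @ [x]))"
    if "finite q'" "q' \<subseteq> q" for q'
    using that
  proof (induction q' rule: finite_induct)
    case empty
    have "(FEq (Var 0) (Var 0), []) \<in> q"
      by (auto simp: q_def is_fm_def holds_def)
    then show ?case by auto
  next
    case (insert z q')
    obtain \<phi> a a' where \<phi>: "is_fm L (length a + 1) \<phi>" "list_all2 (\<lambda>x y. (x, y) \<in> R) a a'"
      "holds M \<phi> (a' @ [y])" "\<And>x. holds M \<phi> (a @ [x]) \<Longrightarrow> \<forall>(\<psi>, d)\<in>q'. holds M \<psi> (d @ [x])"
      using insert by (auto simp: q_def)
    obtain \<psi> d d' where z: "z = (\<psi>, d)" and \<psi>: "is_fm L (length d + 1) \<psi>"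
      "list_all2 (\<lambda>x y. (x, y) \<in> R) d d'" "holds M \<psi> (d' @ [y])"
      using insert.prems by (auto simp: q_def)
    have len: "length a' = length a" "length d' = length d"
      using \<phi>(2) \<psi>(2) by (simp_all add: list_all2_lengthD)
    \<comment> \<open>Both renamings send the variable of \<open>x\<close> to the common last place,
      behind the two parameter tuples.\<close>
    define f where "f i = (if i < length a then i else length a + length d)" for i
    define g where "g i = length a + i" for i
    let ?\<chi> = "Conj (rename \<phi> f) (rename \<psi> g)"
    have "holds M ?\<chi> ((b @ c) @ [x]) \<longleftrightarrow> holds M \<phi> (b @ [x]) \<and> holds M \<psi> (c @ [x])"
      if "length b = length a" "length c = length d" for b c x
    proof -
      have "holds M (rename \<phi> f) ((b @ c) @ [x]) \<longleftrightarrow> holds M \<phi> (b @ [x])"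
        using that \<phi>(1) by (intro holds_rename[where L = L]) (auto simp: f_def nth_append)
      moreover have "holds M (rename \<psi> g) ((b @ c) @ [x]) \<longleftrightarrow> holds M \<psi> (c @ [x])"
        using that \<psi>(1) by (intro holds_rename[where L = L]) (auto simp: g_def nth_append)
      ultimately show ?thesis by simp
    qed
    note \<chi> = this
    have "is_fm L (length (a @ d) + 1) ?\<chi>"
      using \<phi>(1) \<psi>(1) by (auto intro!: is_fm_rename simp: f_def g_def)
    moreover have "list_all2 (\<lambda>x y. (x, y) \<in> R) (a @ d) (a' @ d')"
      using \<phi>(2) \<psi>(2) by (rule list_all2_appendI)
    ultimately have "(?\<chi>, a @ d) \<in> q"
      using \<phi>(3) \<psi>(3) \<chi>[of a' d' y] len unfolding q_def by blast
    moreover have "\<forall>(\<psi>, d)\<in>insert z q'. holds M \<psi> (d @ [x])" if "holds M ?\<chi> ((a @ d) @ [x])" for x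
      using that \<chi>[of a d x] \<phi>(4)[of x] by (auto simp: z)
    ultimately show ?case by blast
  qed
  have "consistent M 1 q"
    unfolding consistent_def
  proof (intro allI impI)
    fix q' assume "finite q' \<and> q' \<subseteq> q"
    then obtain \<phi> a a' where \<phi>: "is_fm L (length a + 1) \<phi>" "list_all2 (\<lambda>x y. (x, y) \<in> R) a a'"
      "holds M \<phi> (a' @ [y])" "\<And>x. holds M \<phi> (a @ [x]) \<Longrightarrow> \<forall>(\<psi>, d)\<in>q'. holds M \<psi> (d @ [x])"
      using conj[of q'] by (auto simp: q_def)
    have len: "length a' = length a" using \<phi>(2) by (simp add: list_all2_lengthD)
    have "holds M (Exi (length a') \<phi>) a'"
      using \<phi>(3) by (auto simp: holds_Exi)
    then have "holds M (Exi (length a) \<phi>) a"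
      using elementary_rel_holds[OF R \<phi>(2)] \<phi>(1) len by (simp add: is_fm_Exi)
    then obtain x where "holds M \<phi> (a @ [x])" by (auto simp: holds_Exi)
    then have "realizes M 1 [x] q'"
      using \<phi>(4) by (auto simp: realizes_def)
    then show "\<exists>c. realizes M 1 c q'" ..
  qed
  moreover have "set a \<subseteq> Domain R" if "list_all2 (\<lambda>x y. (x, y) \<in> R) a a'" for a a'
    using that by (induction rule: list_all2_induct) auto
  then have "\<forall>(\<phi>, a)\<in>q. set a \<subseteq> Domain R \<and> is_fm L (length a + 1) \<phi>"
    unfolding q_def by blast
  ultimately have "type_over L M (Domain R) 1 q"
    by (simp add: type_over_def)
  then obtain c where "realizes M 1 c q"
    using sat small unfolding saturated_def by blast
  then obtain x where x: "\<And>\<phi> a. (\<phi>, a) \<in> q \<Longrightarrow> holds M \<phi> (a @ [x])"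
    by (auto simp: realizes_def length_Suc_conv)
  \<comment> \<open>One implication is enough, since it also applies to
    \<open>Neg \<phi>\<close>.\<close>
  have imp: "sat M e \<phi>"
    if "wf_fm L \<phi>" "\<forall>i. (e i, e' i) \<in> insert (x, y) R" "sat M e' \<phi>" for \<phi> e e'
  proof -
    define P where "P i \<longleftrightarrow> (e i, e' i) \<in> R" for i
    obtain js g where js: "set js = {i \<in> fv_fm \<phi>. P i}"
      and g: "\<And>i. i \<in> fv_fm \<phi> \<Longrightarrow> P i \<Longrightarrow> g i < length js \<and> js ! g i = i"
      by (rule indices_of_subset[OF finite_fv_fm, where P = P]) blast
    \<comment> \<open>A variable whose pair is not in \<open>R\<close> has the values
      \<open>x\<close> and \<open>y\<close>, hence is sent to the last place.\<close>
    define f where "f i = (if P i then g i else length js)" for i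
    let ?\<psi> = "rename \<phi> f"
    have f: "f i < length js + 1 \<and> (map e js @ [x]) ! f i = e i \<and> (map e' js @ [y]) ! f i = e' i"
      if "i \<in> fv_fm \<phi>" for i
      using g[OF that] \<open>\<forall>i. (e i, e' i) \<in> insert (x, y) R\<close>
      by (auto simp: f_def P_def nth_append trans_less_add1)
    have "is_fm L (length (map e js) + 1) ?\<psi>"
      using that f fv_rename[of \<phi> f] by (fastforce simp: is_fm_def wf_rename)
    moreover have "holds M ?\<psi> (map e' js @ [y]) \<longleftrightarrow> sat M e' \<phi>"
      unfolding holds_def sat_rename using f by (intro sat_cong) auto
    moreover have "list_all2 (\<lambda>x y. (x, y) \<in> R) (map e js) (map e' js)"
      using js by (auto simp: P_def list_all2_map1 list_all2_map2 intro!: list.rel_refl_strong)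
    ultimately have "(?\<psi>, map e js) \<in> q"
      using \<open>sat M e' \<phi>\<close> unfolding q_def by blast
    then have "holds M ?\<psi> (map e js @ [x])" by (rule x)
    moreover have "holds M ?\<psi> (map e js @ [x]) \<longleftrightarrow> sat M e \<phi>"
      unfolding holds_def sat_rename using f by (intro sat_cong) auto
    ultimately show ?thesis by simp
  qed
  have "elementary_rel L M (insert (x, y) R)"
    unfolding elementary_rel_def
  proof (intro allI impI)
    fix \<phi> and e e' :: "nat \<Rightarrow> _" assume *: "wf_fm L \<phi> \<and> (\<forall>i. (e i, e' i) \<in> insert (x, y) R)"
    show "sat M e \<phi> \<longleftrightarrow> sat M e' \<phi>"
      using * imp[of \<phi> e e'] imp[of "Neg \<phi>" e e'] by auto
  qed
  then show ?thesis ..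
qed

section \<open>Families of sequences\<close>

lemma Linear_orderD:
  assumes "Linear_order r"
  shows "x \<in> Field r \<Longrightarrow> (x, x) \<in> r"
    and "(x, y) \<in> r \<Longrightarrow> (y, x) \<in> r \<Longrightarrow> x = y"
    and "(x, y) \<in> r \<Longrightarrow> (y, z) \<in> r \<Longrightarrow> (x, z) \<in> r"
    and "x \<in> Field r \<Longrightarrow> y \<in> Field r \<Longrightarrow> (x, y) \<notin> r \<Longrightarrow> (y, x) \<in> r"
  using assms unfolding order_on_defs
  by (auto dest: refl_onD antisymD transD simp: total_on_def) (metis refl_onD)

lemma increasing_nth_le_iff:
  assumes r: "Linear_order r" and xs: "increasing r xs" and "s < length xs" "t < length xs"
  shows "(xs ! s, xs ! t) \<in> r \<longleftrightarrow> s \<le> t"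
proof -
  have less: "(xs ! s, xs ! t) \<in> r \<and> xs ! s \<noteq> xs ! t" if "s < t" "t < length xs" for s t
    using xs that by (auto simp: increasing_def sorted_wrt_iff_nth_less)
  have "(xs ! s, xs ! s) \<in> r"
    using xs assms(3) by (intro Linear_orderD(1)[OF r]) (auto simp: increasing_def)
  then show ?thesis
    using less[of s t] less[of t s] assms(3,4) Linear_orderD(2)[OF r]
    by (cases s t rule: linorder_cases) auto
qed

lemma increasing_distinct:
  assumes "increasing r xs"
  shows "distinct xs"
  using assms by (auto simp: increasing_def distinct_conv_nth sorted_wrt_iff_nth_less)
    (metis nat_neq_iff)

lemma increasing_list_of_finite:
  assumes r: "Linear_order r" and "finite S" "S \<subseteq> Field r"
  shows "\<exists>xs. set xs = S \<and> increasing r xs"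
  using assms(2,3)
proof (induction S rule: finite_induct)
  case empty
  then show ?case by (auto simp: increasing_def)
next
  case (insert x S)
  then obtain xs where xs: "set xs = S" "increasing r xs" by auto
  let ?ys = "filter (\<lambda>y. (y, x) \<in> r) xs @ [x] @ filter (\<lambda>y. (y, x) \<notin> r) xs"
  have "set ?ys = insert x S" using xs by auto
  moreover have "sorted_wrt (\<lambda>i j. (i, j) \<in> r \<and> i \<noteq> j) ?ys"
    using xs insert.hyps insert.prems
    by (auto simp: increasing_def sorted_wrt_append intro!: sorted_wrt_filter
        dest: Linear_orderD(3)[OF r] Linear_orderD(4)[OF r])
  ultimately show ?case
    using insert.prems xs unfolding increasing_def by blast
qed

definition ord_rel :: "'a::linorder rel" where
  "ord_rel = {(x, y). x \<le> y}"

lemma Field_ord_rel [simp]: "Field ord_rel = UNIV"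
  by (auto simp: ord_rel_def Field_def)

lemma linear_order_ord_rel [simp]: "linear_order_on UNIV ord_rel"
  unfolding order_on_defs
  by (auto simp: ord_rel_def refl_on_def trans_def antisym_def total_on_def)

lemma in_ord_rel [simp]: "(x, y) \<in> ord_rel \<longleftrightarrow> x \<le> y"
  by (simp add: ord_rel_def)

lemma natLeq_eq_ord_rel: "natLeq = ord_rel"
  by (simp add: natLeq_def ord_rel_def)

text \<open>\<open>seq_sim k r s \<rho>\<close>: for each sort \<open>\<alpha> < k\<close>, the relation \<open>\<rho> \<alpha>\<close> is a partial isomorphism
  between the orders \<open>r \<alpha>\<close> and \<open>s \<alpha>\<close>.\<close>

definition seq_sim ::
  "nat \<Rightarrow> (nat \<Rightarrow> 'i rel) \<Rightarrow> (nat \<Rightarrow> 'j rel) \<Rightarrow> (nat \<Rightarrow> ('i \<times> 'j) set) \<Rightarrow> bool" where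
  "seq_sim k r s \<rho> \<longleftrightarrow> (\<forall>\<alpha><k. \<rho> \<alpha> \<subseteq> Field (r \<alpha>) \<times> Field (s \<alpha>) \<and>
     (\<forall>i j i' j'. (i, j) \<in> \<rho> \<alpha> \<longrightarrow> (i', j') \<in> \<rho> \<alpha> \<longrightarrow> ((i, i') \<in> r \<alpha> \<longleftrightarrow> (j, j') \<in> s \<alpha>)))"

text \<open>Matched tuples are taken apart into pairs of entries, so that a matching of indices
  becomes one relation on the universe, to which \<open>elementary_rel\<close> applies.\<close>

definition lift_rel ::
  "nat \<Rightarrow> (nat \<Rightarrow> 'i \<Rightarrow> 'a list) \<Rightarrow> (nat \<Rightarrow> 'j \<Rightarrow> 'a list) \<Rightarrow> (nat \<Rightarrow> ('i \<times> 'j) set) \<Rightarrow> 'a rel" where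
  "lift_rel k b d \<rho> = (\<Union>\<alpha><k. \<Union>(i, j)\<in>\<rho> \<alpha>. set (zip (b \<alpha> i) (d \<alpha> j)))"

text \<open>Equality of Ehrenfeucht-Mostowski types over \<open>A\<close>, for two families that may
  live on different index orders.\<close>

definition same_em ::
  "('f, 'r) lang \<Rightarrow> ('f, 'r, 'a) struct \<Rightarrow> 'a set \<Rightarrow> nat \<Rightarrow> (nat \<Rightarrow> 'i rel) \<Rightarrow> (nat \<Rightarrow> 'i \<Rightarrow> 'a list)
     \<Rightarrow> (nat \<Rightarrow> 'j rel) \<Rightarrow> (nat \<Rightarrow> 'j \<Rightarrow> 'a list) \<Rightarrow> bool" where
  "same_em L M A k r b s d \<longleftrightarrow>
     (\<forall>\<rho>. seq_sim k r s \<rho> \<longrightarrow> elementary_rel L M (Id_on A \<union> lift_rel k b d \<rho>))"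

text \<open>Indiscernibility under simultaneous moves in all sequences. It is equivalent to mutual
  indiscernibility, but can be used by composing matchings, without singling out a sequence.\<close>

definition multi_indiscernible ::
  "('f, 'r) lang \<Rightarrow> ('f, 'r, 'a) struct \<Rightarrow> 'a set \<Rightarrow> nat \<Rightarrow> (nat \<Rightarrow> nat) \<Rightarrow> (nat \<Rightarrow> 'i rel)
     \<Rightarrow> (nat \<Rightarrow> 'i \<Rightarrow> 'a list) \<Rightarrow> bool" where
  "multi_indiscernible L M A k n r b \<longleftrightarrow>
     (\<forall>\<alpha><k. tuple_seq (n \<alpha>) (r \<alpha>) (b \<alpha>)) \<and> same_em L M A k r b r b"

lemma lift_relI:
  "\<alpha> < k \<Longrightarrow> (i, j) \<in> \<rho> \<alpha> \<Longrightarrow> t < length (b \<alpha> i) \<Longrightarrow> t < length (d \<alpha> j) \<Longrightarrow>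
    (b \<alpha> i ! t, d \<alpha> j ! t) \<in> lift_rel k b d \<rho>"
  unfolding lift_rel_def by (fastforce simp: set_zip)

lemma lift_relE:
  assumes "(x, y) \<in> lift_rel k b d \<rho>"
  obtains \<alpha> i j t where "\<alpha> < k" "(i, j) \<in> \<rho> \<alpha>" "t < length (b \<alpha> i)" "t < length (d \<alpha> j)"
    "x = b \<alpha> i ! t" "y = d \<alpha> j ! t"
  using assms unfolding lift_rel_def by (fastforce simp: set_zip)

lemma lift_rel_converse: "lift_rel k b d (\<lambda>\<alpha>. (\<rho> \<alpha>)\<inverse>) = (lift_rel k d b \<rho>)\<inverse>"
  by (auto elim!: lift_relE intro!: lift_relI)

text \<open>The condition on lengths is there because \<open>zip\<close> truncates: the middle tuple
  needs an entry at each place that is used.\<close>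

lemma Id_lift_rel_comp:
  assumes "\<And>\<alpha> i j. \<alpha> < k \<Longrightarrow> (i, j) \<in> \<tau> \<alpha> \<Longrightarrow>
    \<exists>l. (i, l) \<in> \<rho> \<alpha> \<and> (l, j) \<in> \<sigma> \<alpha> \<and> length (c \<alpha> l) = length (b \<alpha> i)"
  shows "Id_on A \<union> lift_rel k b d \<tau> \<subseteq>
    (Id_on A \<union> lift_rel k b c \<rho>) O (Id_on A \<union> lift_rel k c d \<sigma>)"
proof -
  have "(x, y) \<in> lift_rel k b c \<rho> O lift_rel k c d \<sigma>" if "(x, y) \<in> lift_rel k b d \<tau>" for x y
    using that
  proof (rule lift_relE)
    fix \<alpha> i j t
    assume *: "\<alpha> < k" "(i, j) \<in> \<tau> \<alpha>" "t < length (b \<alpha> i)" "t < length (d \<alpha> j)"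
      "x = b \<alpha> i ! t" "y = d \<alpha> j ! t"
    then obtain l where l: "(i, l) \<in> \<rho> \<alpha>" "(l, j) \<in> \<sigma> \<alpha>" "length (c \<alpha> l) = length (b \<alpha> i)"
      using assms by blast
    show ?thesis
      using * l by (auto intro!: relcompI[of _ "c \<alpha> l ! t"] lift_relI)
  qed
  then show ?thesis by auto
qed

lemma seq_sim_converse: "seq_sim k r s \<rho> \<Longrightarrow> seq_sim k s r (\<lambda>\<alpha>. (\<rho> \<alpha>)\<inverse>)"
  unfolding seq_sim_def by blast

lemma seq_sim_comp:
  assumes "seq_sim k r s \<rho>" "seq_sim k s t \<sigma>"
  shows "seq_sim k r t (\<lambda>\<alpha>. \<rho> \<alpha> O \<sigma> \<alpha>)"
  unfolding seq_sim_def
proof (intro allI impI conjI)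
  fix \<alpha> assume \<alpha>: "\<alpha> < k"
  show "\<rho> \<alpha> O \<sigma> \<alpha> \<subseteq> Field (r \<alpha>) \<times> Field (t \<alpha>)"
    using assms \<alpha> unfolding seq_sim_def by blast
  fix i j i' j' assume "(i, j) \<in> \<rho> \<alpha> O \<sigma> \<alpha>" "(i', j') \<in> \<rho> \<alpha> O \<sigma> \<alpha>"
  then obtain l l' where "(i, l) \<in> \<rho> \<alpha>" "(l, j) \<in> \<sigma> \<alpha>" "(i', l') \<in> \<rho> \<alpha>" "(l', j') \<in> \<sigma> \<alpha>"
    by auto
  then show "(i, i') \<in> r \<alpha> \<longleftrightarrow> (j, j') \<in> t \<alpha>"
    using assms \<alpha> unfolding seq_sim_def by metis
qed

lemma seq_sim_mono: "seq_sim k r s \<rho> \<Longrightarrow> (\<And>\<alpha>. \<alpha> < k \<Longrightarrow> \<sigma> \<alpha> \<subseteq> \<rho> \<alpha>) \<Longrightarrow> seq_sim k r s \<sigma>"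
  unfolding seq_sim_def by (meson subset_iff)

text \<open>A finite part of the lifted relation involves only finitely many pairs of indices;
  \<open>z\<close> selects one for each of its members.\<close>

lemma same_emI_finite:
  assumes fin: "\<And>\<rho>. seq_sim k r s \<rho> \<Longrightarrow> (\<And>\<alpha>. finite (\<rho> \<alpha>)) \<Longrightarrow>
    elementary_rel L M (Id_on A \<union> lift_rel k b d \<rho>)"
  shows "same_em L M A k r b s d"
  unfolding same_em_def
proof (intro allI impI, rule elementary_rel_finite)
  fix \<rho> F assume \<rho>: "seq_sim k r s \<rho>" and F: "finite F" "F \<subseteq> Id_on A \<union> lift_rel k b d \<rho>"
  let ?G = "F \<inter> lift_rel k b d \<rho>"
  have "\<forall>x\<in>?G. \<exists>z. fst z < k \<and> snd z \<in> \<rho> (fst z) \<and>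
      x \<in> set (zip (b (fst z) (fst (snd z))) (d (fst z) (snd (snd z))))"
    unfolding lift_rel_def by fastforce
  then obtain z where z: "\<forall>x\<in>?G. fst (z x) < k \<and> snd (z x) \<in> \<rho> (fst (z x)) \<and>
      x \<in> set (zip (b (fst (z x)) (fst (snd (z x)))) (d (fst (z x)) (snd (snd (z x)))))"
    by metis
  define \<sigma> where "\<sigma> \<alpha> = {y. (\<alpha>, y) \<in> z ` ?G}" for \<alpha>
  have "finite (\<sigma> \<alpha>)" for \<alpha>
  proof -
    have "\<sigma> \<alpha> = Pair \<alpha> -` (z ` ?G)" by (simp only: \<sigma>_def vimage_def)
    then show ?thesis using F(1) by (simp add: finite_vimageI inj_on_def)
  qed
  moreover have "seq_sim k r s \<sigma>"
  proof (rule seq_sim_mono[OF \<rho>], rule subsetI)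
    fix \<alpha> y assume "y \<in> \<sigma> \<alpha>"
    then obtain x where "x \<in> ?G" "z x = (\<alpha>, y)" unfolding \<sigma>_def by (metis imageE mem_Collect_eq)
    then show "y \<in> \<rho> \<alpha>" using z by (metis fst_conv snd_conv)
  qed
  ultimately have "elementary_rel L M (Id_on A \<union> lift_rel k b d \<sigma>)"
    by (rule fin[rotated])
  moreover have "?G \<subseteq> lift_rel k b d \<sigma>"
  proof
    fix x assume x: "x \<in> ?G"
    obtain \<alpha> i j where zx: "z x = (\<alpha>, i, j)" by (cases "z x") auto
    have "(i, j) \<in> \<sigma> \<alpha>" using x zx by (force simp: \<sigma>_def)
    then show "x \<in> lift_rel k b d \<sigma>"
      using z x zx unfolding lift_rel_def by fastforce
  qed
  ultimately show "elementary_rel L M F"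
    using F(2) by (elim elementary_rel_mono) blast
qed

lemma finite_order_embedding:
  assumes s: "Linear_order s" and r: "Linear_order r" "infinite (Field r)"
    and X: "finite X" "X \<subseteq> Field s"
  shows "\<exists>f. f ` X \<subseteq> Field r \<and> (\<forall>x\<in>X. \<forall>y\<in>X. (x, y) \<in> s \<longleftrightarrow> (f x, f y) \<in> r)"
proof -
  obtain xs where xs: "set xs = X" "increasing s xs"
    using increasing_list_of_finite[OF s X] by blast
  obtain Y where Y: "finite Y" "card Y = card X" "Y \<subseteq> Field r"
    using infinite_arbitrarily_large[OF r(2)] by blast
  obtain ys where ys: "set ys = Y" "increasing r ys"
    using increasing_list_of_finite[OF r(1) Y(1,3)] by blast
  have len: "length xs = length ys"
    using xs ys Y(2) increasing_distinct distinct_card by metis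
  have "\<forall>x\<in>X. \<exists>t. t < length xs \<and> xs ! t = x"
    using xs by (auto simp: in_set_conv_nth)
  then obtain g where g: "\<And>x. x \<in> X \<Longrightarrow> g x < length xs \<and> xs ! g x = x" by metis
  have "(x, y) \<in> s \<longleftrightarrow> (ys ! g x, ys ! g y) \<in> r" if "x \<in> X" "y \<in> X" for x y
    using g[OF that(1)] g[OF that(2)] len
      increasing_nth_le_iff[OF s xs(2), of "g x" "g y"] increasing_nth_le_iff[OF r(1) ys(2), of "g x" "g y"]
    by simp
  moreover have "(\<lambda>x. ys ! g x) ` X \<subseteq> Field r"
    using g len ys Y(3) by auto
  ultimately show ?thesis by blast
qed

lemma finite_seq_sim:
  assumes "\<And>\<alpha>. \<alpha> < k \<Longrightarrow> Linear_order (s \<alpha>)" "\<And>\<alpha>. \<alpha> < k \<Longrightarrow> tuple_seq (n \<alpha>) (r \<alpha>) (b \<alpha>)"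
    and "\<And>\<alpha>. \<alpha> < k \<Longrightarrow> finite (X \<alpha>) \<and> X \<alpha> \<subseteq> Field (s \<alpha>)"
  shows "\<exists>f. seq_sim k s r (\<lambda>\<alpha>. (\<lambda>x. (x, f \<alpha> x)) ` X \<alpha>)"
proof -
  have "\<forall>\<alpha>. \<exists>f. \<alpha> < k \<longrightarrow> f ` X \<alpha> \<subseteq> Field (r \<alpha>) \<and>
      (\<forall>x\<in>X \<alpha>. \<forall>y\<in>X \<alpha>. (x, y) \<in> s \<alpha> \<longleftrightarrow> (f x, f y) \<in> r \<alpha>)"
    using assms finite_order_embedding unfolding tuple_seq_def by metis
  then obtain f where f: "\<And>\<alpha>. \<alpha> < k \<Longrightarrow> f \<alpha> ` X \<alpha> \<subseteq> Field (r \<alpha>) \<and>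
      (\<forall>x\<in>X \<alpha>. \<forall>y\<in>X \<alpha>. (x, y) \<in> s \<alpha> \<longleftrightarrow> (f \<alpha> x, f \<alpha> y) \<in> r \<alpha>)"
    by metis
  have "seq_sim k s r (\<lambda>\<alpha>. (\<lambda>x. (x, f \<alpha> x)) ` X \<alpha>)"
    unfolding seq_sim_def using f assms(3) by blast
  then show ?thesis by (intro exI[of _ f])
qed

section \<open>Mutual and simultaneous indiscernibility\<close>

lemma length_concat_const:
  "(\<And>x. x \<in> set xs \<Longrightarrow> length (f x) = n) \<Longrightarrow> length (concat (map f xs)) = length xs * n"
  by (induction xs) auto

lemma set_zip_concat:
  assumes "length xs = length ys" "\<And>t. t < length xs \<Longrightarrow> length (f (xs ! t)) = length (g (ys ! t))"
  shows "set (zip (concat (map f xs)) (concat (map g ys))) = (\<Union>(x, y)\<in>set (zip xs ys). set (zip (f x) (g y)))"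
  using assms
proof (induction xs ys rule: list_induct2)
  case (Cons x xs y ys)
  have "length (f x) = length (g y)" "\<And>t. t < length xs \<Longrightarrow> length (f (xs ! t)) = length (g (ys ! t))"
    using Cons.prems[of 0] Cons.prems[of "Suc t" for t] by auto
  then show ?case using Cons.IH by simp
qed simp

text \<open>Indiscernibility of one sequence over the others moves that sequence and fixes the
  others pointwise; the composition of these \<open>k\<close> relations moves all at once.
  \<open>P \<alpha>\<close> collects the entries of a sequence and \<open>T \<alpha>\<close> its
  matched pairs.\<close>

lemma multi_indiscernible_if_mutually:
  fixes r :: "nat \<Rightarrow> 'i rel"
  assumes mut: "mutually_indiscernible L M A k n r b"
  shows "multi_indiscernible L M A k n r b"
  unfolding multi_indiscernible_def
proof (intro conjI allI impI same_emI_finite)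
  show tup: "tuple_seq (n \<alpha>) (r \<alpha>) (b \<alpha>)" if "\<alpha> < k" for \<alpha>
    using mut that unfolding mutually_indiscernible_def indiscernible_def by blast
  fix \<rho> assume \<rho>: "seq_sim k r r \<rho>" and fin: "\<And>\<alpha>. finite (\<rho> \<alpha>)"
  define P where "P \<alpha> = (\<Union>i\<in>Field (r \<alpha>). set (b \<alpha> i))" for \<alpha>
  define T where "T \<alpha> = (\<Union>(i, j)\<in>\<rho> \<alpha>. set (zip (b \<alpha> i) (b \<alpha> j)))" for \<alpha>
  have T: "T \<alpha> \<subseteq> P \<alpha> \<times> P \<alpha>" if "\<alpha> < k" for \<alpha>
    using \<rho> that unfolding T_def P_def seq_sim_def by (fastforce dest: set_zip_leftD set_zip_rightD)
  have step: "elementary_rel L M (Id_on (A \<union> (\<Union>\<beta>\<in>{..<k} - {\<alpha>}. P \<beta>)) \<union> T \<alpha>)" if \<alpha>: "\<alpha> < k" for \<alpha>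
  proof -
    have r: "Linear_order (r \<alpha>)" using tup[OF \<alpha>] by (simp add: tuple_seq_def)
    have sub: "\<rho> \<alpha> \<subseteq> Field (r \<alpha>) \<times> Field (r \<alpha>)"
      and iff: "\<And>i j i' j'. (i, j) \<in> \<rho> \<alpha> \<Longrightarrow> (i', j') \<in> \<rho> \<alpha> \<Longrightarrow> (i, i') \<in> r \<alpha> \<longleftrightarrow> (j, j') \<in> r \<alpha>"
      using \<rho> \<alpha> unfolding seq_sim_def by blast+
    \<comment> \<open>Since \<open>(i, i)\<close> belongs to the order, \<open>j\<close> and
      \<open>j'\<close> are related in both directions; so \<open>\<rho> \<alpha>\<close> is a
      partial function.\<close>
    have uniq: "j = j'" if "(i, j) \<in> \<rho> \<alpha>" "(i, j') \<in> \<rho> \<alpha>" for i j j'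
      using iff[OF that] iff[OF that(2,1)] Linear_orderD(1,2)[OF r] sub that by blast
    have "finite (Domain (\<rho> \<alpha>))" "Domain (\<rho> \<alpha>) \<subseteq> Field (r \<alpha>)"
      using fin sub by (auto intro: finite_Domain)
    from increasing_list_of_finite[OF r this]
    obtain xs where xs: "set xs = Domain (\<rho> \<alpha>)" "increasing (r \<alpha>) xs" by blast
    define f where "f i = (SOME j. (i, j) \<in> \<rho> \<alpha>)" for i
    have f: "(i, f i) \<in> \<rho> \<alpha>" if "i \<in> Domain (\<rho> \<alpha>)" for i
      using that by (auto simp: f_def intro: someI)
    let ?js = "map f xs"
    have zip: "set (zip xs ?js) = \<rho> \<alpha>"
      using f uniq xs(1) by (fastforce simp: zip_map2 zip_same_conv_map)
    have "increasing (r \<alpha>) ?js"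
      unfolding increasing_def
    proof
      show "set ?js \<subseteq> Field (r \<alpha>)" using f xs(1) sub by auto
      have "(f i, f j) \<in> r \<alpha> \<and> f i \<noteq> f j"
        if "i \<in> set xs" "j \<in> set xs" "(i, j) \<in> r \<alpha> \<and> i \<noteq> j" for i j
        using that xs(1) f[of i] f[of j] iff[of i "f i" j "f j"] iff[of j "f j" i "f i"]
          Linear_orderD(1,2)[OF r] sub by (metis SigmaD2 subsetD)
      then show "sorted_wrt (\<lambda>i j. (i, j) \<in> r \<alpha> \<and> i \<noteq> j) ?js"
        unfolding sorted_wrt_map
        using xs(2) by (auto simp: increasing_def intro: sorted_wrt_mono_rel[rotated])
    qed
    moreover have "indiscernible L M (A \<union> (\<Union>\<beta>\<in>{..<k} - {\<alpha>}. P \<beta>)) (n \<alpha>) (r \<alpha>) (b \<alpha>)"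
      using mut \<alpha> by (simp add: mutually_indiscernible_def P_def)
    moreover have "length xs = length ?js" by simp
    ultimately have "same_type L M (A \<union> (\<Union>\<beta>\<in>{..<k} - {\<alpha>}. P \<beta>)) (concat (map (b \<alpha>) xs)) (concat (map (b \<alpha>) ?js))"
      using xs(2) unfolding indiscernible_def by blast
    from elementary_rel_if_same_type[OF this] show ?thesis
    proof (rule elementary_rel_mono)
      have "length (b \<alpha> (xs ! t)) = length (b \<alpha> (?js ! t))" if "t < length xs" for t
        using that xs(1) f sub tup[OF \<alpha>] unfolding tuple_seq_def
        by (metis SigmaD1 SigmaD2 length_map nth_map nth_mem subsetD)
      then have "T \<alpha> = set (zip (concat (map (b \<alpha>) xs)) (concat (map (b \<alpha>) ?js)))"
        by (subst set_zip_concat) (simp_all only: T_def zip length_map)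
      then show "Id_on (A \<union> (\<Union>\<beta>\<in>{..<k} - {\<alpha>}. P \<beta>)) \<union> T \<alpha> \<subseteq>
          Id_on (A \<union> (\<Union>\<beta>\<in>{..<k} - {\<alpha>}. P \<beta>)) \<union> set (zip (concat (map (b \<alpha>) xs)) (concat (map (b \<alpha>) ?js)))"
        by blast
    qed
  qed
  txt \<open>Exchange the sequences one after the other.\<close>
  have "elementary_rel L M (Id_on A \<union> (\<Union>\<alpha><t. T \<alpha>) \<union> Id_on (\<Union>\<alpha>\<in>{t..<k}. P \<alpha>))" if "t \<le> k" for t
    using that
  proof (induction t)
    case 0
    have "Id_on A \<union> (\<Union>\<alpha><0. T \<alpha>) \<union> Id_on (\<Union>\<alpha>\<in>{0..<k}. P \<alpha>) = Id_on (A \<union> (\<Union>\<alpha>\<in>{0..<k}. P \<alpha>))"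
      by auto
    then show ?case by (metis elementary_rel_Id_on)
  next
    case (Suc t)
    then have "t < k" by simp
    have "elementary_rel L M ((Id_on A \<union> (\<Union>\<alpha><t. T \<alpha>) \<union> Id_on (\<Union>\<alpha>\<in>{t..<k}. P \<alpha>)) O
        (Id_on (A \<union> (\<Union>\<beta>\<in>{..<k} - {t}. P \<beta>)) \<union> T t))"
      using Suc step[of t] by (intro elementary_rel_comp) auto
    moreover have "Id_on A \<union> (\<Union>\<alpha><Suc t. T \<alpha>) \<union> Id_on (\<Union>\<alpha>\<in>{Suc t..<k}. P \<alpha>) \<subseteq>
      (Id_on A \<union> (\<Union>\<alpha><t. T \<alpha>) \<union> Id_on (\<Union>\<alpha>\<in>{t..<k}. P \<alpha>)) O
        (Id_on (A \<union> (\<Union>\<beta>\<in>{..<k} - {t}. P \<beta>)) \<union> T t)" (is "?l \<subseteq> ?r1 O ?r2")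
    proof
      \<comment> \<open>A pair from a sequence moved earlier passes through its second entry, a pair
        from sequence \<open>t\<close> through its first.\<close>
      fix z assume "z \<in> ?l"
      then consider "z \<in> Id_on A" | \<alpha> where "\<alpha> < t" "z \<in> T \<alpha>" | "z \<in> T t"
        | \<alpha> x where "\<alpha> \<in> {Suc t..<k}" "z = (x, x)" "x \<in> P \<alpha>"
        by (auto simp: less_Suc_eq)
      then show "z \<in> ?r1 O ?r2"
      proof cases
        case (2 \<alpha>)
        then have "\<alpha> \<in> {..<k} - {t}" "snd z \<in> P \<alpha>" using \<open>t < k\<close> T[of \<alpha>] by auto
        then have "(snd z, snd z) \<in> ?r2" by blast
        moreover have "(fst z, snd z) \<in> ?r1" using 2 by auto
        ultimately show ?thesis by (metis prod.collapse relcomp.relcompI)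
      next
        case 3
        then have "fst z \<in> P t" using T[OF \<open>t < k\<close>] by auto
        then have "(fst z, fst z) \<in> ?r1" using \<open>t < k\<close> by auto
        moreover have "(fst z, snd z) \<in> ?r2" using 3 by auto
        ultimately show ?thesis by (metis prod.collapse relcomp.relcompI)
      next
        case (4 \<alpha> x)
        have "\<alpha> \<in> {t..<k}" "\<alpha> \<in> {..<k} - {t}" using 4(1) by auto
        then have "(x, x) \<in> ?r1" "(x, x) \<in> ?r2" using 4(3) by blast+
        then show ?thesis using 4(2) by blast
      qed blast
    qed
    ultimately show ?case by (rule elementary_rel_mono)
  qed
  from this[of k] have "elementary_rel L M (Id_on A \<union> (\<Union>\<alpha><k. T \<alpha>))" by simp
  then show "elementary_rel L M (Id_on A \<union> lift_rel k b b \<rho>)"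
    by (simp add: lift_rel_def T_def)
qed

lemma mutually_indiscernible_if_multi:
  assumes multi: "multi_indiscernible L M A k n r b"
  shows "mutually_indiscernible L M A k n r b"
  unfolding mutually_indiscernible_def indiscernible_def
proof (intro allI impI conjI)
  fix \<alpha> assume \<alpha>: "\<alpha> < k"
  show tup: "tuple_seq (n \<alpha>) (r \<alpha>) (b \<alpha>)"
    using multi \<alpha> by (simp add: multi_indiscernible_def)
  then have r: "Linear_order (r \<alpha>)" by (simp add: tuple_seq_def)
  fix xs js
  assume *: "increasing (r \<alpha>) xs \<and> increasing (r \<alpha>) js \<and> length xs = length js"
  \<comment> \<open>Sequence \<open>\<alpha>\<close> is moved and the others are matched
    identically, which turns their entries into parameters.\<close>
  define \<rho> where "\<rho> \<beta> = (if \<beta> = \<alpha> then set (zip xs js) else Id_on (Field (r \<beta>)))" for \<beta>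
  have "seq_sim k r r \<rho>"
    unfolding seq_sim_def
  proof (intro allI impI conjI)
    fix \<beta> assume "\<beta> < k"
    show "\<rho> \<beta> \<subseteq> Field (r \<beta>) \<times> Field (r \<beta>)"
      using * by (auto simp: \<rho>_def increasing_def dest: set_zip_leftD set_zip_rightD)
    fix i j i' j' assume "(i, j) \<in> \<rho> \<beta>" "(i', j') \<in> \<rho> \<beta>"
    then show "(i, i') \<in> r \<beta> \<longleftrightarrow> (j, j') \<in> r \<beta>"
      using * by (auto simp: \<rho>_def set_zip increasing_nth_le_iff[OF r] split: if_splits)
  qed
  then have elem: "elementary_rel L M (Id_on A \<union> lift_rel k b b \<rho>)"
    using multi by (auto simp: multi_indiscernible_def same_em_def)
  have len: "length (b \<alpha> (xs ! t)) = length (b \<alpha> (js ! t))" if "t < length xs" for t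
    using that * tup unfolding increasing_def tuple_seq_def by (metis nth_mem subsetD)
  let ?C = "A \<union> (\<Union>\<beta>\<in>{..<k} - {\<alpha>}. \<Union>i\<in>Field (r \<beta>). set (b \<beta> i))"
  have "set (zip (concat (map (b \<alpha>) xs)) (concat (map (b \<alpha>) js))) \<subseteq> lift_rel k b b \<rho>"
  proof -
    have "(\<Union>(x, y)\<in>\<rho> \<alpha>. set (zip (b \<alpha> x) (b \<alpha> y))) \<subseteq> lift_rel k b b \<rho>"
      unfolding lift_rel_def using \<alpha> by blast
    then show ?thesis using * len by (subst set_zip_concat) (auto simp: \<rho>_def)
  qed
  moreover have "Id_on ?C \<subseteq> Id_on A \<union> lift_rel k b b \<rho>"
  proof -
    have "(x, x) \<in> lift_rel k b b \<rho>" if "\<beta> < k" "\<beta> \<noteq> \<alpha>" "i \<in> Field (r \<beta>)" "x \<in> set (b \<beta> i)" for \<beta> i x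
      using that lift_relI[of \<beta> k i i \<rho> _ b b] by (auto simp: \<rho>_def in_set_conv_nth)
    then show ?thesis by auto
  qed
  ultimately have "elementary_rel L M (Id_on ?C \<union> set (zip (concat (map (b \<alpha>) xs)) (concat (map (b \<alpha>) js))))"
    using elem by (elim elementary_rel_mono) blast
  moreover have "length (concat (map (b \<alpha>) xs)) = length (concat (map (b \<alpha>) js))"
    using * tup by (subst (1 2) length_concat_const[where n = "n \<alpha>"]) (auto simp: increasing_def tuple_seq_def)
  ultimately show "same_type L M ?C (concat (map (b \<alpha>) xs)) (concat (map (b \<alpha>) js))"
    by (rule same_type_if_elementary_rel)
qed

lemma indiscernible_iff_mutually:
  "indiscernible L M A n r b \<longleftrightarrow> mutually_indiscernible L M A 1 (\<lambda>_. n) (\<lambda>_. r) (\<lambda>_. b)"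
proof -
  have "{..<1} - {0} = ({} :: nat set)" by auto
  then show ?thesis by (simp add: mutually_indiscernible_def)
qed

lemma indiscernible_iff_multi:
  "indiscernible L M A n r b \<longleftrightarrow> multi_indiscernible L M A 1 (\<lambda>_. n) (\<lambda>_. r) (\<lambda>_. b)"
  unfolding indiscernible_iff_mutually
  using multi_indiscernible_if_mutually mutually_indiscernible_if_multi by blast

section \<open>Extending indiscernible families\<close>

locale saturated_over =
  fixes L :: "('f, 'r) lang" and \<kappa> :: "'k rel" and M :: "('f, 'r, 'a) struct" and A :: "'a set"
  assumes Card_order_kappa: "Card_order \<kappa>" and uncountable_kappa: "natLeq <o \<kappa>"
    and saturated: "saturated L \<kappa> M" and small: "|A| <o \<kappa>"
begin

text \<open>Saturation has to cover the countably many entries of a pattern on top of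
  \<open>A\<close>; this is where the uncountability of \<open>\<kappa>\<close> enters.\<close>

lemma small_Un_countable:
  assumes "|B| <o \<kappa>" "countable C"
  shows "|B \<union> C| <o \<kappa>"
proof -
  have "infinite (Field \<kappa>)"
    using cinfinite_mono[OF ordLess_imp_ordLeq[OF uncountable_kappa] natLeq_cinfinite]
    by (simp add: cinfinite_def)
  moreover have "|C| <o \<kappa>"
    using assms(2) uncountable_kappa countable_card_le_natLeq ordLeq_ordLess_trans by blast
  ultimately show ?thesis
    using card_of_Un_ordLess_infinite_Field Card_order_kappa assms(1) by blast
qed

lemma elementary_rel_extend_list:
  assumes "elementary_rel L M R" "|Domain R| <o \<kappa>"
  shows "\<exists>xs. length xs = length ys \<and> elementary_rel L M (R \<union> set (zip xs ys))"
proof (induction ys)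
  case Nil
  then show ?case using assms by auto
next
  case (Cons y ys)
  then obtain xs where xs: "length xs = length ys" "elementary_rel L M (R \<union> set (zip xs ys))"
    by blast
  have "|Domain (R \<union> set (zip xs ys))| <o \<kappa>"
    using small_Un_countable[OF assms(2), of "Domain (set (zip xs ys))"]
    by (simp add: Domain_Un_eq countable_finite finite_Domain)
  then obtain x where "elementary_rel L M (insert (x, y) (R \<union> set (zip xs ys)))"
    using elementary_rel_extend[OF saturated xs(2)] by blast
  then show ?case using xs(1) by (intro exI[of _ "x # xs"]) simp
qed

lemma Domain_lift_rel_small:
  assumes "\<And>\<alpha>. \<alpha> < k \<Longrightarrow> finite (\<rho> \<alpha>)"
  shows "|Domain (Id_on A \<union> lift_rel k b d \<rho>)| <o \<kappa>"
proof -
  have "finite (lift_rel k b d \<rho>)"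
    using assms by (auto simp: lift_rel_def)
  then show ?thesis
    using small_Un_countable[OF small, of "Domain (lift_rel k b d \<rho>)"]
    by (simp add: Domain_Un_eq countable_finite finite_Domain)
qed

lemma realizes_transfer:
  assumes c: "realizes M m c p" and p: "type_over L M A m p" and "length c' = m"
    and elem: "elementary_rel L M (Id_on A \<union> S)" and zip: "set (zip c' c) \<subseteq> S"
  shows "realizes M m c' p"
  unfolding realizes_def
proof (intro conjI ballI, rule assms)
  fix x assume "x \<in> p"
  then obtain \<phi> a where x: "x = (\<phi>, a)" "(\<phi>, a) \<in> p" by (cases x) auto
  then have *: "set a \<subseteq> A" "is_fm L (length a + m) \<phi>" "holds M \<phi> (a @ c)" "length c = m"
    using p c by (auto simp: type_over_def realizes_def)
  have "list_all2 (\<lambda>x y. (x, y) \<in> Id_on A \<union> S) (a @ c') (a @ c)"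
    using * zip assms(3) by (intro list_all2_appendI) (auto simp: list_all2_conv_all_nth set_zip)
  from elementary_rel_holds[OF elem this] show "case x of (\<phi>, a) \<Rightarrow> holds M \<phi> (a @ c')"
    using * x assms(3) by simp
qed

text \<open>\<open>em_on k n r b D d\<close>: the points in the finite set \<open>D\<close> of the partial family \<open>d\<close> indexed by
  the rationals realize the type prescribed by \<open>b\<close>.\<close>

definition em_on where
  "em_on k n r b D d \<longleftrightarrow> (\<forall>(\<alpha>, q)\<in>D. length (d \<alpha> q) = n \<alpha>) \<and>
     (\<forall>\<rho>. seq_sim k (\<lambda>_. ord_rel :: rat rel) r \<rho> \<and> (\<forall>\<alpha><k. \<forall>q\<in>Domain (\<rho> \<alpha>). (\<alpha>, q) \<in> D) \<longrightarrow>
        elementary_rel L M (Id_on A \<union> lift_rel k d b \<rho>))"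

text \<open>One embedding \<open>f\<close> of the finitely many indices is enough. The old tuples
  match \<open>b\<close> along \<open>f\<close> by hypothesis, and saturation supplies
  \<open>v\<close> so that the new one does too. Any other matching is \<open>f\<close> followed by
  a rearrangement of the indices of \<open>b\<close>, for which \<open>b\<close> is
  indiscernible.\<close>

lemma em_on_step:
  assumes multi: "multi_indiscernible L M A k n r b"
    and D: "finite D" and d: "em_on k n r b D d" and \<beta>: "\<beta> < k" "(\<beta>, q) \<notin> D"
  shows "\<exists>v. em_on k n r b (insert (\<beta>, q) D) (d(\<beta> := (d \<beta>)(q := v)))"
proof -
  define X where "X \<alpha> = {x. (\<alpha>, x) \<in> insert (\<beta>, q) D}" for \<alpha>
  define X0 where "X0 \<alpha> = {x. (\<alpha>, x) \<in> D}" for \<alpha>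
  have "X \<alpha> = Pair \<alpha> -` insert (\<beta>, q) D" for \<alpha> by (simp only: X_def vimage_def)
  then have finX: "finite (X \<alpha>)" for \<alpha>
    using D by (simp add: finite_vimageI inj_on_def)
  have tup: "\<And>\<alpha>. \<alpha> < k \<Longrightarrow> tuple_seq (n \<alpha>) (r \<alpha>) (b \<alpha>)"
    using multi by (simp add: multi_indiscernible_def)
  obtain f where f: "seq_sim k (\<lambda>_. ord_rel) r (\<lambda>\<alpha>. (\<lambda>x. (x, f \<alpha> x)) ` X \<alpha>)"
    using finite_seq_sim[of k "\<lambda>_. ord_rel" n r b X, OF _ tup] finX by auto
  let ?F = "\<lambda>\<alpha>. (\<lambda>x. (x, f \<alpha> x)) ` X \<alpha>" and ?G = "\<lambda>\<alpha>. (\<lambda>x. (x, f \<alpha> x)) ` X0 \<alpha>"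
  have X0: "X0 \<alpha> \<subseteq> X \<alpha>" for \<alpha> by (auto simp: X_def X0_def)
  have lenf: "length (b \<alpha> (f \<alpha> x)) = n \<alpha>" if "\<alpha> < k" "x \<in> X \<alpha>" for \<alpha> x
    using tup[OF that(1)] f that unfolding seq_sim_def tuple_seq_def by blast
  have "seq_sim k (\<lambda>_. ord_rel) r ?G"
    using f by (rule seq_sim_mono) (use X0 in auto)
  then have "elementary_rel L M (Id_on A \<union> lift_rel k d b ?G)"
    using d by (auto simp: em_on_def X0_def)
  moreover have "|Domain (Id_on A \<union> lift_rel k d b ?G)| <o \<kappa>"
    using finX X0 by (intro Domain_lift_rel_small finite_imageI) (meson finite_subset)
  ultimately obtain v where v: "length v = length (b \<beta> (f \<beta> q))"
    "elementary_rel L M (Id_on A \<union> lift_rel k d b ?G \<union> set (zip v (b \<beta> (f \<beta> q))))"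
    using elementary_rel_extend_list by blast
  define d' where "d' = d(\<beta> := (d \<beta>)(q := v))"
  have len': "length (d' \<alpha> x) = n \<alpha>" if "(\<alpha>, x) \<in> insert (\<beta>, q) D" for \<alpha> x
    using d that v(1) lenf[of \<beta> q] \<beta> by (auto simp: d'_def em_on_def X_def)
  have elem: "elementary_rel L M (Id_on A \<union> lift_rel k d' b ?F)"
    using v(2)
  proof (rule elementary_rel_mono)
    have "(x, y) \<in> lift_rel k d b ?G \<union> set (zip v (b \<beta> (f \<beta> q)))"
      if "(x, y) \<in> lift_rel k d' b ?F" for x y
      using that
    proof (rule lift_relE)
      fix \<alpha> i j t
      assume *: "\<alpha> < k" "(i, j) \<in> ?F \<alpha>" "t < length (d' \<alpha> i)" "t < length (b \<alpha> j)"
        "x = d' \<alpha> i ! t" "y = b \<alpha> j ! t"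
      show ?thesis
      proof (cases "\<alpha> = \<beta> \<and> i = q")
        case True
        then show ?thesis using * by (auto simp: d'_def set_zip)
      next
        case False
        then have "d' \<alpha> i = d \<alpha> i" by (auto simp: d'_def)
        moreover have "(i, j) \<in> ?G \<alpha>" using * False by (auto simp: X_def X0_def)
        ultimately show ?thesis
          using * lift_relI[of \<alpha> k i j ?G t d b] by simp
      qed
    qed
    then show "Id_on A \<union> lift_rel k d' b ?F \<subseteq> Id_on A \<union> lift_rel k d b ?G \<union> set (zip v (b \<beta> (f \<beta> q)))"
      by auto
  qed
  have elem': "elementary_rel L M (Id_on A \<union> lift_rel k d' b \<rho>)"
    if \<rho>: "seq_sim k (\<lambda>_. ord_rel) r \<rho>" and dom: "\<forall>\<alpha><k. \<forall>x\<in>Domain (\<rho> \<alpha>). (\<alpha>, x) \<in> insert (\<beta>, q) D" for \<rho>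
  proof -
    \<comment> \<open>Back along \<open>f\<close> and then along \<open>\<rho>\<close> is a matching
      of \<open>b\<close> with itself.\<close>
    let ?\<sigma> = "\<lambda>\<alpha>. (?F \<alpha>)\<inverse> O \<rho> \<alpha>"
    have "seq_sim k r r ?\<sigma>"
      using seq_sim_comp[OF seq_sim_converse[OF f] \<rho>] .
    then have "elementary_rel L M (Id_on A \<union> lift_rel k b b ?\<sigma>)"
      using multi by (auto simp: multi_indiscernible_def same_em_def)
    from elementary_rel_comp[OF elem this] show ?thesis
    proof (rule elementary_rel_mono, intro Id_lift_rel_comp)
      fix \<alpha> i j assume *: "\<alpha> < k" "(i, j) \<in> \<rho> \<alpha>"
      then have i: "i \<in> X \<alpha>" "(\<alpha>, i) \<in> insert (\<beta>, q) D" using dom by (auto simp: X_def)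
      show "\<exists>l. (i, l) \<in> ?F \<alpha> \<and> (l, j) \<in> ?\<sigma> \<alpha> \<and> length (b \<alpha> l) = length (d' \<alpha> i)"
        using * i lenf[of \<alpha> i] len'[of \<alpha> i] by (intro exI[of _ "f \<alpha> i"]) auto
    qed
  qed
  have "em_on k n r b (insert (\<beta>, q) D) d'"
    unfolding em_on_def
  proof (intro conjI allI impI)
    show "\<forall>(\<alpha>, x)\<in>insert (\<beta>, q) D. length (d' \<alpha> x) = n \<alpha>" using len' by auto
  qed (rule elem', auto)
  then show ?thesis unfolding d'_def by (rule exI)
qed

text \<open>The pairs of a sequence number and a rational are enumerated, and each stage adds at
  most one tuple; the prescribed entries are present from stage 0 on. The limit family matches
  \<open>b\<close>, and its own indiscernibility follows by passing through
  \<open>b\<close>.\<close>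

lemma multi_indiscernible_extension:
  assumes multi: "multi_indiscernible L M A k n r b"
    and \<rho>0: "seq_sim k (\<lambda>_. ord_rel :: rat rel) r \<rho>0" "\<And>\<alpha>. finite (\<rho>0 \<alpha>)"
  obtains d where "multi_indiscernible L M A k n (\<lambda>_. ord_rel :: rat rel) d"
    and "\<And>\<alpha> q i. \<alpha> < k \<Longrightarrow> (q, i) \<in> \<rho>0 \<alpha> \<Longrightarrow> d \<alpha> q = b \<alpha> i"
proof -
  have tup: "tuple_seq (n \<alpha>) (r \<alpha>) (b \<alpha>)" if "\<alpha> < k" for \<alpha>
    using multi that by (simp add: multi_indiscernible_def)
  have lin: "Linear_order (r \<alpha>)" if "\<alpha> < k" for \<alpha> using tup[OF that] by (simp add: tuple_seq_def)
  have uniq: "i = i'" if "\<alpha> < k" "(q, i) \<in> \<rho>0 \<alpha>" "(q, i') \<in> \<rho>0 \<alpha>" for \<alpha> q i i'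
    using \<rho>0(1) that Linear_orderD(2)[OF lin[OF that(1)]] unfolding seq_sim_def by (metis in_ord_rel order_refl)
  define D0 where "D0 = (\<Union>\<alpha><k. Pair \<alpha> ` Domain (\<rho>0 \<alpha>))"
  define D where "D t = D0 \<union> {x \<in> from_nat ` {..<t}. fst x < k}" for t
  have finD: "finite (D t)" for t
    using \<rho>0(2) by (auto simp: D_def D0_def finite_Domain)
  define d0 where "d0 \<alpha> q = b \<alpha> (SOME i. (q, i) \<in> \<rho>0 \<alpha>)" for \<alpha> q
  have d0: "d0 \<alpha> q = b \<alpha> i" if "\<alpha> < k" "(q, i) \<in> \<rho>0 \<alpha>" for \<alpha> q i
    using uniq[OF that(1)] that(2) unfolding d0_def by (metis someI_ex)
  have em0: "em_on k n r b (D 0) d0"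
    unfolding em_on_def
  proof (intro conjI allI impI)
    have "length (d0 \<alpha> q) = n \<alpha>" if "\<alpha> < k" "(q, i) \<in> \<rho>0 \<alpha>" for \<alpha> q i
      using d0[OF that] tup[OF that(1)] \<rho>0(1) that unfolding seq_sim_def tuple_seq_def by fastforce
    then show "\<forall>(\<alpha>, q)\<in>D 0. length (d0 \<alpha> q) = n \<alpha>" by (auto simp: D_def D0_def)
    fix \<rho> assume \<rho>: "seq_sim k (\<lambda>_. ord_rel :: rat rel) r \<rho> \<and> (\<forall>\<alpha><k. \<forall>q\<in>Domain (\<rho> \<alpha>). (\<alpha>, q) \<in> D 0)"
    \<comment> \<open>\<open>d0\<close> copies \<open>b\<close> along \<open>\<rho>0\<close>, so a
      matching of \<open>d0\<close> with \<open>b\<close> amounts to one of \<open>b\<close> with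
      itself.\<close>
    let ?\<sigma> = "\<lambda>\<alpha>. (\<rho>0 \<alpha>)\<inverse> O \<rho> \<alpha>"
    have "seq_sim k r r ?\<sigma>"
      using seq_sim_comp[OF seq_sim_converse[OF \<rho>0(1)]] \<rho> by blast
    then have "elementary_rel L M (Id_on A \<union> lift_rel k b b ?\<sigma>)"
      using multi by (auto simp: multi_indiscernible_def same_em_def)
    moreover have "lift_rel k d0 b \<rho> \<subseteq> lift_rel k b b ?\<sigma>"
    proof (clarify elim!: lift_relE)
      fix \<alpha> q j t assume *: "\<alpha> < k" "(q, j) \<in> \<rho> \<alpha>" "t < length (d0 \<alpha> q)" "t < length (b \<alpha> j)"
      then have "(\<alpha>, q) \<in> D 0" using \<rho> by blast
      then obtain i where "(q, i) \<in> \<rho>0 \<alpha>" using * by (auto simp: D_def D0_def)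
      then show "(d0 \<alpha> q ! t, b \<alpha> j ! t) \<in> lift_rel k b b ?\<sigma>"
        using * d0[of \<alpha> q i] by (auto intro!: lift_relI)
    qed
    ultimately show "elementary_rel L M (Id_on A \<union> lift_rel k d0 b \<rho>)"
      by (elim elementary_rel_mono) blast
  qed
  have "\<exists>ds. \<forall>t. (em_on k n r b (D t) (ds t) \<and> (t = 0 \<longrightarrow> ds t = d0)) \<and>
      (\<forall>(\<alpha>, q)\<in>D t. ds (Suc t) \<alpha> q = ds t \<alpha> q)"
  proof (rule dependent_nat_choice)
    show "\<exists>d. em_on k n r b (D 0) d \<and> (0 = 0 \<longrightarrow> d = d0)" using em0 by blast
    fix d t assume d: "em_on k n r b (D t) d \<and> (t = 0 \<longrightarrow> d = d0)"
    obtain \<beta> q where x: "(from_nat t :: nat \<times> rat) = (\<beta>, q)" by (cases "from_nat t :: nat \<times> rat")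
    have DSuc: "D (Suc t) = (if \<beta> < k then insert (\<beta>, q) (D t) else D t)"
      using x by (auto simp: D_def lessThan_Suc)
    show "\<exists>d'. (em_on k n r b (D (Suc t)) d' \<and> (Suc t = 0 \<longrightarrow> d' = d0)) \<and>
        (\<forall>(\<alpha>, q)\<in>D t. d' \<alpha> q = d \<alpha> q)"
    proof (cases "\<beta> < k \<and> (\<beta>, q) \<notin> D t")
      case True
      then obtain v where "em_on k n r b (insert (\<beta>, q) (D t)) (d(\<beta> := (d \<beta>)(q := v)))"
        using em_on_step[OF multi finD] d by blast
      then show ?thesis using True DSuc
        by (intro exI[of _ "d(\<beta> := (d \<beta>)(q := v))"]) auto
    next
      case False
      then have "D (Suc t) = D t" using DSuc by auto
      then show ?thesis using d by auto
    qed
  qed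
  then obtain ds where ds: "\<And>t. em_on k n r b (D t) (ds t)" "ds 0 = d0"
    "\<And>t. \<forall>(\<alpha>, q)\<in>D t. ds (Suc t) \<alpha> q = ds t \<alpha> q" by metis
  have mono: "D t \<subseteq> D t'" if "t \<le> t'" for t t' using that by (auto simp: D_def)
  have stable: "ds t' \<alpha> q = ds t \<alpha> q" if "t \<le> t'" "(\<alpha>, q) \<in> D t" for t t' \<alpha> q
    using that(1)
  proof (induction t' rule: dec_induct)
    case (step t')
    then have "(\<alpha>, q) \<in> D t'" using mono[OF step(1)] that(2) by blast
    then show ?case using ds(3)[of t'] step.IH by auto
  qed simp
  \<comment> \<open>Each value is read off at a stage that is certain to contain its index; later
    stages keep it.\<close>
  define e where "e \<alpha> q = ds (Suc (to_nat (\<alpha>, q))) \<alpha> q" for \<alpha> q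
  have inD: "(\<alpha>, q) \<in> D (Suc (to_nat (\<alpha>, q)))" if "\<alpha> < k" for \<alpha> q
    using that by (auto simp: D_def intro!: image_eqI[of _ _ "to_nat (\<alpha>, q)"])
  have e_eq: "e \<alpha> q = ds t \<alpha> q" if "\<alpha> < k" "to_nat (\<alpha>, q) < t" for \<alpha> q t
    using stable[of "Suc (to_nat (\<alpha>, q))" t] inD that by (simp add: e_def Suc_leI)
  have e_len: "length (e \<alpha> q) = n \<alpha>" if "\<alpha> < k" for \<alpha> q
    using ds(1)[of "Suc (to_nat (\<alpha>, q))"] inD[OF that] unfolding e_def em_on_def by blast
  have em: "same_em L M A k (\<lambda>_. ord_rel :: rat rel) e r b"
  proof (rule same_emI_finite)
    fix \<rho> assume \<rho>: "seq_sim k (\<lambda>_. ord_rel :: rat rel) r \<rho>" "\<And>\<alpha>. finite (\<rho> \<alpha>)"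
    \<comment> \<open>A finite matching is settled at one finite stage.\<close>
    have "finite (to_nat ` (\<Union>\<alpha><k. Pair \<alpha> ` Domain (\<rho> \<alpha>)))"
      using \<rho>(2) by (auto simp: finite_Domain)
    from finite_nat_bounded[OF this]
    obtain t where t0: "to_nat ` (\<Union>\<alpha><k. Pair \<alpha> ` Domain (\<rho> \<alpha>)) \<subseteq> {..<t}" by (elim exE)
    have t: "to_nat (\<alpha>, q) < t" if "\<alpha> < k" "(q, i) \<in> \<rho> \<alpha>" for \<alpha> q i
    proof -
      have "(\<alpha>, q) \<in> (\<Union>\<alpha><k. Pair \<alpha> ` Domain (\<rho> \<alpha>))" using that by auto
      then show ?thesis using t0 by (meson imageI lessThan_iff subsetD)
    qed
    have "lift_rel k e b \<rho> \<subseteq> lift_rel k (ds t) b \<rho>"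
    proof (clarify elim!: lift_relE)
      fix \<alpha> q j s assume *: "\<alpha> < k" "(q, j) \<in> \<rho> \<alpha>" "s < length (e \<alpha> q)" "s < length (b \<alpha> j)"
      then show "(e \<alpha> q ! s, b \<alpha> j ! s) \<in> lift_rel k (ds t) b \<rho>"
        using e_eq[OF *(1) t[OF *(1,2)]] by (auto intro!: lift_relI)
    qed
    moreover have "\<forall>\<alpha><k. \<forall>q\<in>Domain (\<rho> \<alpha>). (\<alpha>, q) \<in> D t"
      using inD mono t by (meson DomainE Suc_leI subsetD)
    then have "elementary_rel L M (Id_on A \<union> lift_rel k (ds t) b \<rho>)"
      using ds(1)[of t] \<rho>(1) unfolding em_on_def by blast
    ultimately show "elementary_rel L M (Id_on A \<union> lift_rel k e b \<rho>)"
      by (elim elementary_rel_mono) blast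
  qed
  have "multi_indiscernible L M A k n (\<lambda>_. ord_rel :: rat rel) e"
    unfolding multi_indiscernible_def
  proof (intro conjI allI impI same_emI_finite)
    show "tuple_seq (n \<alpha>) ord_rel (e \<alpha>)" if "\<alpha> < k" for \<alpha>
      using e_len[OF that] by (simp add: tuple_seq_def infinite_UNIV_char_0)
    fix \<rho> assume \<rho>: "seq_sim k (\<lambda>_. ord_rel :: rat rel) (\<lambda>_. ord_rel :: rat rel) \<rho>" "\<And>\<alpha>. finite (\<rho> \<alpha>)"
    \<comment> \<open>The indices on the right of \<open>\<rho>\<close> are embedded in the orders
      of \<open>b\<close>; the tuples on both sides are then matched with the same tuples of
      \<open>b\<close>.\<close>
    obtain f where f: "seq_sim k (\<lambda>_. ord_rel :: rat rel) r (\<lambda>\<alpha>. (\<lambda>x. (x, f \<alpha> x)) ` Range (\<rho> \<alpha>))"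
      using finite_seq_sim[of k "\<lambda>_. ord_rel" n r b "\<lambda>\<alpha>. Range (\<rho> \<alpha>)", OF _ tup] \<rho>(2)
      by (auto simp: finite_Range)
    let ?F = "\<lambda>\<alpha>. (\<lambda>x. (x, f \<alpha> x)) ` Range (\<rho> \<alpha>)"
    have "elementary_rel L M (Id_on A \<union> lift_rel k e b (\<lambda>\<alpha>. \<rho> \<alpha> O ?F \<alpha>))"
      using em seq_sim_comp[OF \<rho>(1) f] unfolding same_em_def by blast
    moreover have "elementary_rel L M (Id_on A \<union> lift_rel k e b ?F)"
      using em f unfolding same_em_def by blast
    then have "elementary_rel L M ((Id_on A \<union> lift_rel k e b ?F)\<inverse>)"
      by (rule elementary_rel_converse)
    then have "elementary_rel L M (Id_on A \<union> lift_rel k b e (\<lambda>\<alpha>. (?F \<alpha>)\<inverse>))"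
      by (simp only: converse_Un converse_Id_on lift_rel_converse)
    ultimately have "elementary_rel L M ((Id_on A \<union> lift_rel k e b (\<lambda>\<alpha>. \<rho> \<alpha> O ?F \<alpha>)) O
        (Id_on A \<union> lift_rel k b e (\<lambda>\<alpha>. (?F \<alpha>)\<inverse>)))"
      by (rule elementary_rel_comp)
    then show "elementary_rel L M (Id_on A \<union> lift_rel k e e \<rho>)"
    proof (rule elementary_rel_mono, intro Id_lift_rel_comp)
      fix \<alpha> i j assume *: "\<alpha> < k" "(i, j) \<in> \<rho> \<alpha>"
      then have "f \<alpha> j \<in> Field (r \<alpha>)"
        using f unfolding seq_sim_def by blast
      then have "length (b \<alpha> (f \<alpha> j)) = length (e \<alpha> i)"
        using tup[OF *(1)] e_len[OF *(1)] by (simp add: tuple_seq_def)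
      then show "\<exists>l. (i, l) \<in> \<rho> \<alpha> O ?F \<alpha> \<and> (l, j) \<in> (?F \<alpha>)\<inverse> \<and> length (b \<alpha> l) = length (e \<alpha> i)"
        using * by (intro exI[of _ "f \<alpha> j"]) auto
    qed
  qed
  moreover have "e \<alpha> q = b \<alpha> i" if "\<alpha> < k" "(q, i) \<in> \<rho>0 \<alpha>" for \<alpha> q i
  proof -
    have "(\<alpha>, q) \<in> D 0" using that by (auto simp: D_def D0_def)
    from stable[OF _ this, of "Suc (to_nat (\<alpha>, q))"] show ?thesis
      using d0[OF that] ds(2) by (simp add: e_def)
  qed
  ultimately show ?thesis using that by blast
qed

end

section \<open>Sequences obtained from indiscernible families\<close>

lemma seq_simD:
  assumes "seq_sim k r s \<rho>" "\<alpha> < k" "(i, j) \<in> \<rho> \<alpha>"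
  shows "i \<in> Field (r \<alpha>)" "j \<in> Field (s \<alpha>)"
    and "(i', j') \<in> \<rho> \<alpha> \<Longrightarrow> (i, i') \<in> r \<alpha> \<longleftrightarrow> (j, j') \<in> s \<alpha>"
    and "(i', j') \<in> \<rho> \<alpha> \<Longrightarrow> Linear_order (r \<alpha>) \<Longrightarrow> Linear_order (s \<alpha>) \<Longrightarrow> i = i' \<longleftrightarrow> j = j'"
proof -
  have sub: "\<rho> \<alpha> \<subseteq> Field (r \<alpha>) \<times> Field (s \<alpha>)"
    and iff: "\<And>i j i' j'. (i, j) \<in> \<rho> \<alpha> \<Longrightarrow> (i', j') \<in> \<rho> \<alpha> \<Longrightarrow> (i, i') \<in> r \<alpha> \<longleftrightarrow> (j, j') \<in> s \<alpha>"
    using assms(1,2) unfolding seq_sim_def by blast+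
  show "i \<in> Field (r \<alpha>)" "j \<in> Field (s \<alpha>)" using sub assms(3) by auto
  show "(i, i') \<in> r \<alpha> \<longleftrightarrow> (j, j') \<in> s \<alpha>" if "(i', j') \<in> \<rho> \<alpha>" using iff assms(3) that by blast
  assume *: "(i', j') \<in> \<rho> \<alpha>" "Linear_order (r \<alpha>)" "Linear_order (s \<alpha>)"
  show "i = i' \<longleftrightarrow> j = j'"
    using iff[OF assms(3) *(1)] iff[OF *(1) assms(3)] sub assms(3) *(1)
      Linear_orderD(1,2)[OF *(2)] Linear_orderD(1,2)[OF *(3)]
    by blast
qed

lemma multi_indiscernible_elem:
  "multi_indiscernible L M A k n r b \<Longrightarrow> seq_sim k r r \<rho> \<Longrightarrow>
    elementary_rel L M (Id_on A \<union> lift_rel k b b \<rho>)"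
  by (simp add: multi_indiscernible_def same_em_def)

text \<open>A matching of blocks induces a matching of their members: two members are compared by
  their blocks or, within one block, by their places. The tuple \<open>a \<alpha>\<close> comes from
  \<open>A\<close>, so appending it contributes only identity pairs.\<close>

lemma multi_indiscernible_blocks:
  assumes multi: "multi_indiscernible L M A k n r b"
    and s: "\<And>\<alpha>. \<alpha> < k \<Longrightarrow> Linear_order (s \<alpha>) \<and> infinite (Field (s \<alpha>))"
    and E: "\<And>\<alpha> j. \<alpha> < k \<Longrightarrow> j \<in> Field (s \<alpha>) \<Longrightarrow> length (E \<alpha> j) = l \<alpha> \<and> set (E \<alpha> j) \<subseteq> Field (r \<alpha>)"
    and ord: "\<And>\<alpha> j j' t t'. \<alpha> < k \<Longrightarrow> j \<in> Field (s \<alpha>) \<Longrightarrow> j' \<in> Field (s \<alpha>) \<Longrightarrow> t < l \<alpha> \<Longrightarrow> t' < l \<alpha> \<Longrightarrow>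
      (E \<alpha> j ! t, E \<alpha> j' ! t') \<in> r \<alpha> \<longleftrightarrow> (if j = j' then t \<le> t' else (j, j') \<in> s \<alpha>)"
    and a: "\<And>\<alpha>. \<alpha> < k \<Longrightarrow> set (a \<alpha>) \<subseteq> A"
  shows "multi_indiscernible L M A k (\<lambda>\<alpha>. l \<alpha> * n \<alpha> + length (a \<alpha>)) s
    (\<lambda>\<alpha> j. concat (map (b \<alpha>) (E \<alpha> j)) @ a \<alpha>)"
  unfolding multi_indiscernible_def same_em_def
proof (intro conjI allI impI)
  have lenb: "length (b \<alpha> i) = n \<alpha>" if "\<alpha> < k" "i \<in> Field (r \<alpha>)" for \<alpha> i
    using multi that by (simp add: multi_indiscernible_def tuple_seq_def)
  show "tuple_seq (l \<alpha> * n \<alpha> + length (a \<alpha>)) (s \<alpha>) (\<lambda>j. concat (map (b \<alpha>) (E \<alpha> j)) @ a \<alpha>)"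
    if "\<alpha> < k" for \<alpha>
    unfolding tuple_seq_def
  proof (intro conjI ballI)
    show "length (concat (map (b \<alpha>) (E \<alpha> j)) @ a \<alpha>) = l \<alpha> * n \<alpha> + length (a \<alpha>)"
      if "j \<in> Field (s \<alpha>)" for j
      using E[OF \<open>\<alpha> < k\<close> that] lenb[OF \<open>\<alpha> < k\<close>] by (simp add: length_concat_const[where n = "n \<alpha>"] subset_iff)
  qed (use s[OF that] in auto)
  fix \<rho> assume \<rho>: "seq_sim k s s \<rho>"
  define \<sigma> where "\<sigma> \<alpha> = (\<Union>(i, j)\<in>\<rho> \<alpha>. set (zip (E \<alpha> i) (E \<alpha> j)))" for \<alpha>
  have \<sigma>E: "\<exists>i j t. (i, j) \<in> \<rho> \<alpha> \<and> i \<in> Field (s \<alpha>) \<and> j \<in> Field (s \<alpha>) \<and> t < l \<alpha> \<and> x = E \<alpha> i ! t \<and> y = E \<alpha> j ! t"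
    if "\<alpha> < k" "(x, y) \<in> \<sigma> \<alpha>" for \<alpha> x y
    using that seq_simD(1,2)[OF \<rho> that(1)] E[OF that(1)] unfolding \<sigma>_def
    by (fastforce simp: set_zip)
  have "seq_sim k r r \<sigma>"
    unfolding seq_sim_def
  proof (intro allI impI conjI)
    fix \<alpha> assume \<alpha>: "\<alpha> < k"
    show "\<sigma> \<alpha> \<subseteq> Field (r \<alpha>) \<times> Field (r \<alpha>)"
    proof
      fix z assume "z \<in> \<sigma> \<alpha>"
      then obtain i j t where "i \<in> Field (s \<alpha>)" "j \<in> Field (s \<alpha>)" "t < l \<alpha>" "z = (E \<alpha> i ! t, E \<alpha> j ! t)"
        using \<sigma>E[OF \<alpha>, of "fst z" "snd z"] by (metis prod.collapse)
      then show "z \<in> Field (r \<alpha>) \<times> Field (r \<alpha>)"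
        using E[OF \<alpha>] by (metis SigmaI nth_mem subsetD)
    qed
    fix x y x' y' assume "(x, y) \<in> \<sigma> \<alpha>" "(x', y') \<in> \<sigma> \<alpha>"
    then obtain i j t i' j' t' where
      1: "(i, j) \<in> \<rho> \<alpha>" "i \<in> Field (s \<alpha>)" "j \<in> Field (s \<alpha>)" "t < l \<alpha>" "x = E \<alpha> i ! t" "y = E \<alpha> j ! t" and
      2: "(i', j') \<in> \<rho> \<alpha>" "i' \<in> Field (s \<alpha>)" "j' \<in> Field (s \<alpha>)" "t' < l \<alpha>" "x' = E \<alpha> i' ! t'" "y' = E \<alpha> j' ! t'"
      using \<sigma>E[OF \<alpha>] by meson
    show "(x, x') \<in> r \<alpha> \<longleftrightarrow> (y, y') \<in> r \<alpha>"
      using 1 2 seq_simD(3,4)[OF \<rho> \<alpha> 1(1) 2(1)] s[OF \<alpha>] by (simp add: ord \<alpha>)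
  qed
  from multi_indiscernible_elem[OF multi this]
  show "elementary_rel L M (Id_on A \<union> lift_rel k (\<lambda>\<alpha> j. concat (map (b \<alpha>) (E \<alpha> j)) @ a \<alpha>)
      (\<lambda>\<alpha> j. concat (map (b \<alpha>) (E \<alpha> j)) @ a \<alpha>) \<rho>)"
  proof (rule elementary_rel_mono)
    have "set (zip (concat (map (b \<alpha>) (E \<alpha> i)) @ a \<alpha>) (concat (map (b \<alpha>) (E \<alpha> j)) @ a \<alpha>)) \<subseteq>
        Id_on A \<union> lift_rel k b b \<sigma>" if \<alpha>: "\<alpha> < k" and ij: "(i, j) \<in> \<rho> \<alpha>" for \<alpha> i j
    proof -
      have f: "i \<in> Field (s \<alpha>)" "j \<in> Field (s \<alpha>)" using seq_simD(1,2)[OF \<rho> \<alpha> ij] by auto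
      have nth: "length (b \<alpha> (E \<alpha> i ! t)) = n \<alpha>" if "t < l \<alpha>" "i \<in> Field (s \<alpha>)" for i t
        using E[OF \<alpha> that(2)] that(1) lenb[OF \<alpha>] by (metis nth_mem subsetD)
      have len: "length (concat (map (b \<alpha>) (E \<alpha> i))) = l \<alpha> * n \<alpha>" if "i \<in> Field (s \<alpha>)" for i
        using E[OF \<alpha> that] lenb[OF \<alpha>] by (simp add: length_concat_const[where n = "n \<alpha>"] subset_iff)
      have "set (zip (concat (map (b \<alpha>) (E \<alpha> i))) (concat (map (b \<alpha>) (E \<alpha> j)))) =
          (\<Union>(x, y)\<in>set (zip (E \<alpha> i) (E \<alpha> j)). set (zip (b \<alpha> x) (b \<alpha> y)))"
        using E[OF \<alpha> f(1)] E[OF \<alpha> f(2)] nth f by (intro set_zip_concat) auto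
      also have "\<dots> \<subseteq> lift_rel k b b \<sigma>"
        unfolding lift_rel_def \<sigma>_def using \<alpha> ij by blast
      finally have "set (zip (concat (map (b \<alpha>) (E \<alpha> i))) (concat (map (b \<alpha>) (E \<alpha> j)))) \<subseteq> lift_rel k b b \<sigma>" .
      moreover have "set (zip (a \<alpha>) (a \<alpha>)) \<subseteq> Id_on A"
        using a[OF \<alpha>] by (auto simp: zip_same_conv_map)
      ultimately show ?thesis using len f by auto
    qed
    then have "lift_rel k (\<lambda>\<alpha> j. concat (map (b \<alpha>) (E \<alpha> j)) @ a \<alpha>)
      (\<lambda>\<alpha> j. concat (map (b \<alpha>) (E \<alpha> j)) @ a \<alpha>) \<rho> \<subseteq> Id_on A \<union> lift_rel k b b \<sigma>"
      unfolding lift_rel_def[of _ _ _ \<rho>] by blast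
    then show "Id_on A \<union> lift_rel k (\<lambda>\<alpha> j. concat (map (b \<alpha>) (E \<alpha> j)) @ a \<alpha>)
      (\<lambda>\<alpha> j. concat (map (b \<alpha>) (E \<alpha> j)) @ a \<alpha>) \<rho> \<subseteq> Id_on A \<union> lift_rel k b b \<sigma>" by blast
  qed
qed

lemma multi_indiscernible_pairs:
  fixes b :: "nat \<Rightarrow> 'i::linorder \<Rightarrow> 'a list" and f :: "nat \<Rightarrow> 'i"
  assumes "multi_indiscernible L M A k n (\<lambda>_. ord_rel) b" "strict_mono f"
  shows "multi_indiscernible L M A k (\<lambda>\<alpha>. n \<alpha> + n \<alpha>) (\<lambda>_. natLeq)
    (\<lambda>\<alpha> i. b \<alpha> (f (2 * i)) @ b \<alpha> (f (2 * i + 1)))"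
proof -
  have "multi_indiscernible L M A k (\<lambda>\<alpha>. 2 * n \<alpha> + length ([] :: 'a list)) (\<lambda>_. ord_rel)
    (\<lambda>\<alpha> i. concat (map (b \<alpha>) [f (2 * i), f (2 * i + 1)]) @ [])"
    using assms(1)
  proof (rule multi_indiscernible_blocks[where E = "\<lambda>_ i. [f (2 * i), f (2 * i + 1)]" and l = "\<lambda>_. 2" and a = "\<lambda>_. []"])
    fix j j' t t' :: nat assume "t < 2" "t' < 2"
    then show "([f (2 * j), f (2 * j + 1)] ! t, [f (2 * j'), f (2 * j' + 1)] ! t') \<in> ord_rel \<longleftrightarrow>
        (if j = j' then t \<le> t' else (j, j') \<in> ord_rel)"
      using assms(2) by (auto simp: less_2_cases_iff strict_mono_less_eq)
  qed auto
  then show ?thesis by (simp add: natLeq_eq_ord_rel mult_2)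
qed

text \<open>Carries the order of \<open>nat\<close> into \<open>'i\<close>, the type from which the
  index orders in the theorem are drawn.\<close>

definition transport :: "(nat \<Rightarrow> 'i) \<Rightarrow> 'i rel" where
  "transport g = {(g x, g y) |x y. x \<le> y}"

lemma Field_transport: "Field (transport g) = range g"
  by (auto simp: Field_def transport_def)

lemma in_transport: "inj g \<Longrightarrow> (g x, g y) \<in> transport g \<longleftrightarrow> x \<le> y"
  by (auto simp: transport_def inj_eq)

lemma Linear_order_transport:
  assumes "inj g"
  shows "Linear_order (transport g)"
  unfolding order_on_defs Field_transport
  using assms
  by (auto simp: refl_on_def trans_def antisym_def total_on_def in_transport transport_def inj_eq)

lemma multi_indiscernible_transport:
  fixes b :: "nat \<Rightarrow> nat \<Rightarrow> 'a list"
  assumes "multi_indiscernible L M A k n (\<lambda>_. natLeq) b" "inj g"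
  shows "multi_indiscernible L M A k n (\<lambda>_. transport g) (\<lambda>\<alpha> i. b \<alpha> (inv g i))"
proof -
  have "multi_indiscernible L M A k (\<lambda>\<alpha>. 1 * n \<alpha> + length ([] :: 'a list)) (\<lambda>_. transport g)
    (\<lambda>\<alpha> i. concat (map (b \<alpha>) [inv g i]) @ [])"
    using assms(1)
  proof (rule multi_indiscernible_blocks[where E = "\<lambda>_ i. [inv g i]" and l = "\<lambda>_. 1" and a = "\<lambda>_. []"])
    show "Linear_order (transport g) \<and> infinite (Field (transport g))"
      using Linear_order_transport[OF assms(2)] assms(2) by (simp add: Field_transport finite_image_iff)
    fix j j' and t t' :: nat assume "j \<in> Field (transport g)" "j' \<in> Field (transport g)" "t < 1" "t' < 1"
    then show "([inv g j] ! t, [inv g j'] ! t') \<in> natLeq \<longleftrightarrow> (if j = j' then t \<le> t' else (j, j') \<in> transport g)"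
      using assms(2) by (auto simp: Field_transport in_transport natLeq_def)
  qed (auto simp: natLeq_eq_ord_rel)
  then show ?thesis by simp
qed

lemma increasing_transport:
  "inj g \<Longrightarrow> sorted_wrt (<) xs \<Longrightarrow> increasing (transport g) (map g xs)"
  unfolding increasing_def sorted_wrt_map Field_transport
  by (auto simp: in_transport inj_eq intro: sorted_wrt_mono_rel[rotated])

text \<open>The pieces follow one another in \<open>r\<close>, so comparisons across two pieces
  depend on their numbers alone, and independent matchings of the pieces glue to one matching of the
  whole sequence.\<close>

lemma multi_indiscernible_pieces:
  assumes multi: "multi_indiscernible L M A 1 (\<lambda>_. n) (\<lambda>_. r) (\<lambda>_. b)"
    and s: "\<And>\<alpha>. \<alpha> < k \<Longrightarrow> Linear_order (s \<alpha>) \<and> infinite (Field (s \<alpha>))"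
    and g: "\<And>\<alpha> j. \<alpha> < k \<Longrightarrow> j \<in> Field (s \<alpha>) \<Longrightarrow> g \<alpha> j \<in> Field r"
    and ord: "\<And>\<alpha> \<beta> i j. \<alpha> < k \<Longrightarrow> \<beta> < k \<Longrightarrow> i \<in> Field (s \<alpha>) \<Longrightarrow> j \<in> Field (s \<beta>) \<Longrightarrow>
      (g \<alpha> i, g \<beta> j) \<in> r \<longleftrightarrow> \<alpha> < \<beta> \<or> \<alpha> = \<beta> \<and> (i, j) \<in> s \<alpha>"
  shows "multi_indiscernible L M A k (\<lambda>_. n) s (\<lambda>\<alpha> j. b (g \<alpha> j))"
  unfolding multi_indiscernible_def same_em_def
proof (intro conjI allI impI)
  show "tuple_seq n (s \<alpha>) (\<lambda>j. b (g \<alpha> j))" if "\<alpha> < k" for \<alpha>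
    using multi s[OF that] g[OF that] by (auto simp: multi_indiscernible_def tuple_seq_def)
  fix \<rho> assume \<rho>: "seq_sim k s s \<rho>"
  define \<sigma> where "\<sigma> = (\<lambda>_::nat. {(g \<alpha> i, g \<alpha> j) |\<alpha> i j. \<alpha> < k \<and> (i, j) \<in> \<rho> \<alpha>})"
  have "seq_sim 1 (\<lambda>_. r) (\<lambda>_. r) \<sigma>"
    unfolding seq_sim_def
  proof (intro allI impI conjI)
    fix \<gamma> :: nat
    show "\<sigma> \<gamma> \<subseteq> Field r \<times> Field r"
      using seq_simD(1,2)[OF \<rho>] g by (auto simp: \<sigma>_def)
    fix x y x' y' assume "(x, y) \<in> \<sigma> \<gamma>" "(x', y') \<in> \<sigma> \<gamma>"
    then obtain \<alpha> i j \<beta> i' j' where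
      1: "\<alpha> < k" "(i, j) \<in> \<rho> \<alpha>" "x = g \<alpha> i" "y = g \<alpha> j" and
      2: "\<beta> < k" "(i', j') \<in> \<rho> \<beta>" "x' = g \<beta> i'" "y' = g \<beta> j'"
      unfolding \<sigma>_def by blast
    show "(x, x') \<in> r \<longleftrightarrow> (y, y') \<in> r"
      using 1 2 seq_simD(1,2)[OF \<rho> 1(1,2)] seq_simD(1,2)[OF \<rho> 2(1,2)] seq_simD(3)[OF \<rho> 1(1,2)]
      by (auto simp: ord)
  qed
  from multi_indiscernible_elem[OF multi this]
  show "elementary_rel L M (Id_on A \<union> lift_rel k (\<lambda>\<alpha> j. b (g \<alpha> j)) (\<lambda>\<alpha> j. b (g \<alpha> j)) \<rho>)"
  proof (rule elementary_rel_mono)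
    have "lift_rel k (\<lambda>\<alpha> j. b (g \<alpha> j)) (\<lambda>\<alpha> j. b (g \<alpha> j)) \<rho> \<subseteq> lift_rel 1 (\<lambda>_. b) (\<lambda>_. b) \<sigma>"
      unfolding lift_rel_def \<sigma>_def by fastforce
    then show "Id_on A \<union> lift_rel k (\<lambda>\<alpha> j. b (g \<alpha> j)) (\<lambda>\<alpha> j. b (g \<alpha> j)) \<rho> \<subseteq>
        Id_on A \<union> lift_rel 1 (\<lambda>_. b) (\<lambda>_. b) \<sigma>" by blast
  qed
qed

text \<open>A matching of the common indices is applied to all \<open>k\<close> sequences
  alike.\<close>

lemma multi_indiscernible_merge:
  assumes multi: "multi_indiscernible L M A k n (\<lambda>_. r) b" and "k \<ge> 1"
  shows "multi_indiscernible L M A 1 (\<lambda>_. \<Sum>\<alpha><k. n \<alpha>) (\<lambda>_. r) (\<lambda>_ i. concat (map (\<lambda>\<alpha>. b \<alpha> i) [0..<k]))"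
  unfolding multi_indiscernible_def same_em_def
proof (intro conjI allI impI)
  have tup: "tuple_seq (n \<alpha>) r (b \<alpha>)" if "\<alpha> < k" for \<alpha>
    using multi that by (simp add: multi_indiscernible_def)
  have "length (concat (map (\<lambda>\<alpha>. b \<alpha> i) [0..<k])) = (\<Sum>\<alpha><k. n \<alpha>)" if "i \<in> Field r" for i
    using tup that by (simp add: length_concat comp_def sum_list_sum_nth tuple_seq_def lessThan_atLeast0)
  then show "tuple_seq (\<Sum>\<alpha><k. n \<alpha>) r (\<lambda>i. concat (map (\<lambda>\<alpha>. b \<alpha> i) [0..<k]))"
    using tup[of 0] assms(2) by (auto simp: tuple_seq_def)
  fix \<rho> :: "nat \<Rightarrow> _" assume \<rho>: "seq_sim 1 (\<lambda>_. r) (\<lambda>_. r) \<rho>"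
  then have "seq_sim k (\<lambda>_. r) (\<lambda>_. r) (\<lambda>_. \<rho> 0)"
    unfolding seq_sim_def by auto
  from multi_indiscernible_elem[OF multi this]
  show "elementary_rel L M (Id_on A \<union> lift_rel 1 (\<lambda>_ i. concat (map (\<lambda>\<alpha>. b \<alpha> i) [0..<k]))
      (\<lambda>_ i. concat (map (\<lambda>\<alpha>. b \<alpha> i) [0..<k])) \<rho>)"
  proof (rule elementary_rel_mono)
    have "set (zip (concat (map (\<lambda>\<alpha>. b \<alpha> i) [0..<k])) (concat (map (\<lambda>\<alpha>. b \<alpha> j) [0..<k]))) \<subseteq>
        lift_rel k b b (\<lambda>_. \<rho> 0)" if ij: "(i, j) \<in> \<rho> 0" for i j
    proof -
      have f: "i \<in> Field r" "j \<in> Field r" using seq_simD(1,2)[OF \<rho> _ ij] by auto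
      then have "set (zip (concat (map (\<lambda>\<alpha>. b \<alpha> i) [0..<k])) (concat (map (\<lambda>\<alpha>. b \<alpha> j) [0..<k]))) =
          (\<Union>(x, y)\<in>set (zip [0..<k] [0..<k]). set (zip (b x i) (b y j)))"
        using tup by (intro set_zip_concat) (auto simp: tuple_seq_def)
      also have "\<dots> \<subseteq> lift_rel k b b (\<lambda>_. \<rho> 0)"
        unfolding lift_rel_def using ij by (fastforce simp: zip_same_conv_map)
      finally show ?thesis .
    qed
    then show "Id_on A \<union> lift_rel 1 (\<lambda>_ i. concat (map (\<lambda>\<alpha>. b \<alpha> i) [0..<k]))
      (\<lambda>_ i. concat (map (\<lambda>\<alpha>. b \<alpha> i) [0..<k])) \<rho> \<subseteq> Id_on A \<union> lift_rel k b b (\<lambda>_. \<rho> 0)"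
      unfolding lift_rel_def[of 1] by (auto simp del: set_zip)
  qed
qed

section \<open>Building formulas\<close>

lemma xor_formula:
  assumes "is_fm L (n + m) \<theta>"
  obtains \<psi> where "is_fm L (n + n + m) \<psi>"
    and "\<And>x x' c. length x = n \<Longrightarrow> length x' = n \<Longrightarrow> length c = m \<Longrightarrow>
      holds M \<psi> ((x @ x') @ c) \<longleftrightarrow> holds M \<theta> (x @ c) \<noteq> holds M \<theta> (x' @ c)"
proof -
  \<comment> \<open>\<open>P\<close> reads the first tuple and skips the second, \<open>Q\<close>
    the other way round; \<open>c\<close> stands behind both.\<close>
  define P where "P = rename \<theta> (\<lambda>i. if i < n then i else i + n)"
  define Q where "Q = rename \<theta> (\<lambda>i. n + i)"
  let ?\<psi> = "Neg (Conj (Neg (Conj P (Neg Q))) (Neg (Conj (Neg P) Q)))"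
  have "is_fm L (n + n + m) P" "is_fm L (n + n + m) Q"
    unfolding P_def Q_def using assms by (auto intro!: is_fm_rename)
  then have "is_fm L (n + n + m) ?\<psi>" by simp
  moreover have "holds M ?\<psi> ((x @ x') @ c) \<longleftrightarrow> holds M \<theta> (x @ c) \<noteq> holds M \<theta> (x' @ c)"
    if "length x = n" "length x' = n" "length c = m" for x x' c
  proof -
    have "holds M P ((x @ x') @ c) \<longleftrightarrow> holds M \<theta> (x @ c)"
      unfolding P_def using that assms by (intro holds_rename[where L = L]) (auto simp: nth_append)
    moreover have "holds M Q ((x @ x') @ c) \<longleftrightarrow> holds M \<theta> (x' @ c)"
      unfolding Q_def using that assms by (intro holds_rename[where L = L]) (auto simp: nth_append)
    ultimately show ?thesis by auto
  qed
  ultimately show ?thesis by (rule that)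
qed

lemma disj_formula:
  fixes k :: nat
  assumes "\<And>\<alpha>. \<alpha> < k \<Longrightarrow> is_fm L N (\<phi> \<alpha>)" "k \<ge> 1"
  obtains \<psi> where "is_fm L N \<psi>" "\<And>us. holds M \<psi> us \<longleftrightarrow> (\<exists>\<alpha><k. holds M (\<phi> \<alpha>) us)"
proof -
  have "\<exists>\<psi>. is_fm L N \<psi> \<and> (\<forall>us. holds M \<psi> us \<longleftrightarrow> (\<exists>\<alpha><k. holds M (\<phi> \<alpha>) us))"
    using assms(2,1)
  proof (induction k rule: dec_induct)
    case base
    then show ?case by (intro exI[of _ "\<phi> 0"]) auto
  next
    case (step k)
    then obtain \<psi> where "is_fm L N \<psi>" "\<forall>us. holds M \<psi> us \<longleftrightarrow> (\<exists>\<alpha><k. holds M (\<phi> \<alpha>) us)" by auto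
    then show ?case using step.prems[of k]
      by (intro exI[of _ "Neg (Conj (Neg \<psi>) (Neg (\<phi> k)))"]) (auto simp: less_Suc_eq)
  qed
  then show ?thesis using that by blast
qed

text \<open>Parameters from \<open>A\<close> are kept as a tuple \<open>a'\<close> next to
  \<open>u\<close>, where they can be absorbed into the entries of a sequence; those outside
  \<open>A\<close> are read off from \<open>c\<close>.\<close>

lemma separate_parameters:
  assumes \<theta>: "is_fm L (length a + N) \<theta>" and a: "set a \<subseteq> A \<union> set c"
  shows "\<exists>a' \<theta>'. set a' \<subseteq> A \<and> is_fm L (N + length a' + length c) \<theta>' \<and>
    (\<forall>u. length u = N \<longrightarrow> (holds M \<theta>' ((u @ a') @ c) \<longleftrightarrow> holds M \<theta> (a @ u)))"
proof -
  define a' where "a' = filter (\<lambda>x. x \<in> A) a"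
  have "\<forall>i. \<exists>s. i < length a \<longrightarrow> s < length (a' @ c) \<and> (a' @ c) ! s = a ! i"
  proof (intro allI)
    fix i
    have "a ! i \<in> set (a' @ c)" if "i < length a"
    proof -
      have "a ! i \<in> set a" using that by (rule nth_mem)
      then show ?thesis using a unfolding a'_def set_append set_filter by blast
    qed
    then show "\<exists>s. i < length a \<longrightarrow> s < length (a' @ c) \<and> (a' @ c) ! s = a ! i"
      unfolding in_set_conv_nth by blast
  qed
  then obtain g where g: "\<And>i. i < length a \<Longrightarrow> g i < length (a' @ c) \<and> (a' @ c) ! g i = a ! i" by metis
  define f where "f i = (if i < length a then N + g i else i - length a)" for i
  have "is_fm L (N + length a' + length c) (rename \<theta> f)"
    using \<theta> g by (intro is_fm_rename) (auto simp: f_def)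
  moreover have "holds M (rename \<theta> f) ((u @ a') @ c) \<longleftrightarrow> holds M \<theta> (a @ u)" if "length u = N" for u
  proof (rule holds_rename[where L = L])
    show "is_fm L (length (a @ u)) \<theta>" using \<theta> that by simp
    show "f i < length ((u @ a') @ c) \<and> ((u @ a') @ c) ! f i = (a @ u) ! i" if "i < length (a @ u)" for i
      using that g[of i] \<open>length u = N\<close> unfolding append_assoc
      by (auto simp: f_def nth_append simp del: append_assoc)
  qed
  ultimately show ?thesis
    by (intro exI[of _ a'] exI[of _ "rename \<theta> f"]) (auto simp: a'_def)
qed

section \<open>From dp-rank to randomness patterns\<close>

text \<open>The list consists of \<open>2 * \<eta> + 1\<close> entries with the left value
  \<open>x\<close>, then the one of 0 and 1 whose value is not \<open>x\<close>, then entries with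
  the right value \<open>y\<close>. Cut into pairs, the exceptional entry completes pair
  \<open>\<eta>\<close>, and both members of every other pair have the same value.\<close>

lemma isolating_pairs:
  fixes g :: "int \<Rightarrow> bool"
  assumes "g 0 \<noteq> g 1" "\<eta> < N"
  obtains f :: "nat \<Rightarrow> int" where "\<And>s t. s < t \<Longrightarrow> t < 2 * N \<Longrightarrow> f s < f t"
    and "\<And>i. i < N \<Longrightarrow> g (f (2 * i)) \<noteq> g (f (2 * i + 1)) \<longleftrightarrow> i = \<eta>"
proof -
  have mono: "\<exists>v. infinite {j \<in> S. g j = v}" if "infinite S" for S
  proof (rule ccontr)
    assume "\<not> ?thesis"
    then have "finite ({j \<in> S. g j = True} \<union> {j \<in> S. g j = False})" by (intro finite_UnI) blast+
    moreover have "S = {j \<in> S. g j = True} \<union> {j \<in> S. g j = False}" by auto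
    ultimately show False using that by metis
  qed
  obtain x where x: "infinite {j \<in> {..<0}. g j = x}" using mono[OF infinite_Iio] by blast
  obtain y where y: "infinite {j \<in> {1<..}. g j = y}" using mono[OF infinite_Ioi] by blast
  obtain e where e: "g e \<noteq> x" "e = 0 \<or> e = 1" using assms(1) by metis
  obtain S where S: "S \<subseteq> {j \<in> {..<0}. g j = x}" "card S = 2 * \<eta> + 1" "finite S"
    using infinite_arbitrarily_large[OF x] by metis
  obtain T where T: "T \<subseteq> {j \<in> {1<..}. g j = y}" "card T = 2 * (N - \<eta> - 1)" "finite T"
    using infinite_arbitrarily_large[OF y] by metis
  let ?ss = "sorted_list_of_set S" and ?ts = "sorted_list_of_set T"
  let ?xs = "?ss @ [e] @ ?ts"
  have len: "length ?ss = 2 * \<eta> + 1" "length ?ts = 2 * (N - \<eta> - 1)" using S T by auto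
  have len': "length ?xs = 2 * N" using len assms(2) by simp
  have "i < 0" "1 < j" "i < j" if "i \<in> S" "j \<in> T" for i j
    using S(1) T(1) that by force+
  moreover have "i < 0" if "i \<in> S" for i using S(1) that by auto
  moreover have "1 < j" if "j \<in> T" for j using T(1) that by auto
  ultimately have "sorted_wrt (<) ?xs"
    using S(3) T(3) e(2) by (fastforce simp: sorted_wrt_append strict_sorted_list_of_set)
  then have less: "?xs ! s < ?xs ! t" if "s < t" "t < 2 * N" for s t
    using that len' by (auto simp: sorted_wrt_iff_nth_less)
  have left: "g (?xs ! s) = x" if "s < 2 * \<eta> + 1" for s
  proof -
    have "?xs ! s \<in> set ?ss" using that len(1) by (simp add: nth_append)
    then show ?thesis using S by auto
  qed
  have mid: "?xs ! (2 * \<eta> + 1) = e" using len(1) by (simp add: nth_append)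
  have right: "g (?xs ! s) = y" if "s \<ge> 2 * \<eta> + 2" "s < 2 * N" for s
  proof -
    have "?xs ! s = ?ts ! (s - (2 * \<eta> + 2))" using that len by (simp add: nth_append nth_Cons')
    moreover have "?ts ! (s - (2 * \<eta> + 2)) \<in> set ?ts" using that len assms(2) by (intro nth_mem) auto
    ultimately show ?thesis using T by auto
  qed
  have "g (?xs ! (2 * i)) \<noteq> g (?xs ! (2 * i + 1)) \<longleftrightarrow> i = \<eta>" if "i < N" for i
  proof (cases i \<eta> rule: linorder_cases)
    case less
    then show ?thesis using left[of "2 * i"] left[of "2 * i + 1"] by simp
  next
    case equal
    then show ?thesis using left[of "2 * i"] mid e(1) by simp
  next
    case greater
    then show ?thesis using right[of "2 * i"] right[of "2 * i + 1"] that by simp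
  qed
  then show ?thesis using that[of "(!) ?xs"] less by blast
qed

lemma realizes_Un: "realizes M m c (p \<union> q) \<longleftrightarrow> realizes M m c p \<and> realizes M m c q"
  by (auto simp: realizes_def)

lemma realizes_subset: "realizes M m c q \<Longrightarrow> q' \<subseteq> q \<Longrightarrow> realizes M m c q'"
  by (auto simp: realizes_def)

text \<open>Consecutive blocks of \<open>l\<close> rationals around the prescribed block
  \<open>u\<close> at 0. Block -1 ends with \<open>lo - 1\<close> and block 1 begins with
  \<open>hi + l\<close>, so all blocks are separated from \<open>u\<close> and from each
  other.\<close>

lemma block_sequence:
  fixes u :: "rat list" and lo hi :: rat and l :: nat
  assumes u: "length u = l" "sorted_wrt (<) u" "\<And>x. x \<in> set u \<Longrightarrow> lo \<le> x \<and> x \<le> hi"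
    and "l > 0"
  defines "E \<equiv> \<lambda>j::int. if j = 0 then u else
    map (\<lambda>t. (if j < 0 then lo else hi) + of_int j * of_nat l + of_nat t) [0..<l]"
  shows "length (E j) = l"
    and "t < l \<Longrightarrow> t' < l \<Longrightarrow> E j ! t \<le> E j' ! t' \<longleftrightarrow> (if j = j' then t \<le> t' else j \<le> j')"
proof -
  show "length (E j) = l" using u(1) by (simp add: E_def)
  have "lo \<le> hi" using u(1,3) \<open>l > 0\<close> by (cases u) (auto intro: order_trans)
  have bound: "lo \<le> u ! t \<and> u ! t \<le> hi" if "t < l" for t
    using u(1,3) that by simp
  have same: "E j ! t < E j ! t'" if "t < t'" "t' < l" for j t t'
    using that u(1,2) by (auto simp: E_def sorted_wrt_iff_nth_less)
  have lin: "(of_int j :: rat) * of_nat l + of_nat t < of_int j' * of_nat l + of_nat t'"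
    if "j < j'" "t < l" for j j' :: int and t t' :: nat
  proof -
    have "of_int (j + 1) * (of_nat l :: rat) \<le> of_int j' * of_nat l"
      using that(1) by (intro mult_right_mono of_nat_0_le_iff) (simp only: of_int_le_iff)
    moreover have "(of_nat t :: rat) < of_nat l" using that by simp
    ultimately show ?thesis by (simp add: algebra_simps add_less_le_mono)
  qed
  have diff: "E j ! t < E j' ! t'" if "j < j'" "t < l" "t' < l" for j j' t t'
  proof -
    have *: "of_int j * of_nat l + of_nat t < (of_int j' * of_nat l + of_nat t' :: rat)"
      using lin that by blast
    have neg: "of_int j * of_nat l + of_nat t < (0 :: rat)" if "j < 0"
      using lin[OF that \<open>t < l\<close>, of 0] by simp
    have pos: "(0 :: rat) < of_int j' * of_nat l + of_nat t'" if "0 < j'"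
      using lin[OF that \<open>l > 0\<close>, of t'] by simp
    consider "j < 0" "j' < 0" | "j < 0" "j' = 0" | "j < 0" "j' > 0" | "j = 0" "j' > 0" | "j > 0" "j' > 0"
      using \<open>j < j'\<close> by linarith
    then show ?thesis
      using that * neg pos bound[of t] bound[of t'] \<open>lo \<le> hi\<close> by cases (auto simp: E_def)
  qed
  show "E j ! t \<le> E j' ! t' \<longleftrightarrow> (if j = j' then t \<le> t' else j \<le> j')" if "t < l" "t' < l"
    using that diff[of j j' t t'] diff[of j' j t' t] same[of t t' j] same[of t' t j]
    by (cases j j' rule: linorder_cases; cases t t' rule: linorder_cases) auto
qed

context saturated_over
begin

text \<open>\<open>c\<close> itself shows the pattern only along scattered indices
  \<open>f \<alpha>\<close>, chosen according to \<open>\<eta>\<close>. Indiscernibility matches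
  them with \<open>0, ..., 2 * N - 1\<close>, and saturation supplies \<open>c'\<close> lying over
  these as \<open>c\<close> lies over the scattered ones; it realizes \<open>p\<close> because
  \<open>A\<close> is fixed.\<close>

lemma randomness_pattern_if_alternation:
  fixes e :: "nat \<Rightarrow> int \<Rightarrow> 'a list"
  assumes p: "type_over L M A m p" and c: "realizes M m c p"
    and multi: "multi_indiscernible L M A k n (\<lambda>_. ord_rel) e"
    and \<theta>: "\<And>\<alpha>. \<alpha> < k \<Longrightarrow> is_fm L (n \<alpha> + m) (\<theta> \<alpha>)"
    and alt: "\<And>\<alpha>. \<alpha> < k \<Longrightarrow> holds M (\<theta> \<alpha>) (e \<alpha> 0 @ c) \<noteq> holds M (\<theta> \<alpha>) (e \<alpha> 1 @ c)"
  shows "\<exists>n b \<phi>. randomness_pattern L M A m p k n b \<phi>"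
proof -
  have len: "length (e \<alpha> i) = n \<alpha>" if "\<alpha> < k" for \<alpha> i
    using multi that by (simp add: multi_indiscernible_def tuple_seq_def)
  have lenc: "length c = m" using c by (simp add: realizes_def)
  have "\<forall>\<alpha>. \<exists>\<psi>. \<alpha> < k \<longrightarrow> is_fm L (n \<alpha> + n \<alpha> + m) \<psi> \<and>
     (\<forall>x x' c. length x = n \<alpha> \<longrightarrow> length x' = n \<alpha> \<longrightarrow> length c = m \<longrightarrow>
      (holds M \<psi> ((x @ x') @ c) \<longleftrightarrow> holds M (\<theta> \<alpha>) (x @ c) \<noteq> holds M (\<theta> \<alpha>) (x' @ c)))"
    using xor_formula[OF \<theta>] by metis
  then obtain \<psi> where \<psi>: "\<And>\<alpha>. \<alpha> < k \<Longrightarrow> is_fm L (n \<alpha> + n \<alpha> + m) (\<psi> \<alpha>)"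
    "\<And>\<alpha> x x' c. \<alpha> < k \<Longrightarrow> length x = n \<alpha> \<Longrightarrow> length x' = n \<alpha> \<Longrightarrow> length c = m \<Longrightarrow>
      holds M (\<psi> \<alpha>) ((x @ x') @ c) \<longleftrightarrow> holds M (\<theta> \<alpha>) (x @ c) \<noteq> holds M (\<theta> \<alpha>) (x' @ c)"
    by metis
  define b where "b \<alpha> i = e \<alpha> (int (2 * i)) @ e \<alpha> (int (2 * i + 1))" for \<alpha> i
  have "strict_mono int" by (simp add: strict_mono_def)
  then have "mutually_indiscernible L M A k (\<lambda>\<alpha>. n \<alpha> + n \<alpha>) (\<lambda>_. natLeq) b"
    unfolding b_def by (intro mutually_indiscernible_if_multi multi_indiscernible_pairs multi)
  moreover have "consistent M m
          (p \<union> {(\<psi> \<alpha>, b \<alpha> (\<eta> \<alpha>)) |\<alpha>. \<alpha> < k} \<union> {(Neg (\<psi> \<alpha>), b \<alpha> i) |\<alpha> i. \<alpha> < k \<and> i \<noteq> \<eta> \<alpha>})"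
    (is "consistent M m (p \<union> ?X \<union> ?Y)") for \<eta>
    unfolding consistent_def
  proof (intro allI impI)
    fix q assume q: "finite q \<and> q \<subseteq> p \<union> ?X \<union> ?Y"
    \<comment> \<open>A finite part mentions finitely many indices, so it is enough to control the
      first \<open>N\<close> pairs of each sequence.\<close>
    define Y where "Y N = {(Neg (\<psi> \<alpha>), b \<alpha> i) |\<alpha> i. \<alpha> < k \<and> i < N \<and> i \<noteq> \<eta> \<alpha>}" for N
    have "\<exists>N. q \<subseteq> p \<union> ?X \<union> Y N"
      using q[THEN conjunct1] q[THEN conjunct2]
    proof (induction q rule: finite_induct)
      case (insert z q)
      then obtain N where N: "q \<subseteq> p \<union> ?X \<union> Y N" by auto
      have Ymono: "Y N \<subseteq> Y N'" if "N \<le> N'" for N N' using that by (force simp: Y_def)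
      have "\<exists>N'. z \<in> p \<union> ?X \<union> Y N'"
      proof (cases "z \<in> p \<union> ?X")
        case False
        then obtain \<alpha> i where "\<alpha> < k" "i \<noteq> \<eta> \<alpha>" "z = (Neg (\<psi> \<alpha>), b \<alpha> i)" using insert.prems by blast
        then have "z \<in> Y (Suc i)" unfolding Y_def by blast
        then show ?thesis by blast
      qed auto
      then obtain N' where N': "z \<in> p \<union> ?X \<union> Y N'" by blast
      show ?case using N N' Ymono[of N "max N N'"] Ymono[of N' "max N N'"]
        by (intro exI[of _ "max N N'"]) auto
    qed auto
    then obtain N0 where N0: "q \<subseteq> p \<union> ?X \<union> Y N0" by blast
    \<comment> \<open>Not only the indices below \<open>N0\<close> but also all the values
      \<open>\<eta> \<alpha>\<close> have to be covered.\<close>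
    define N where "N = N0 + Suc (\<Sum>\<alpha><k. \<eta> \<alpha>)"
    have \<eta>N: "\<eta> \<alpha> < N" if "\<alpha> < k" for \<alpha>
      using member_le_sum[of \<alpha> "{..<k}" \<eta>] that by (auto simp: N_def)
    have "\<forall>\<alpha>. \<exists>f :: nat \<Rightarrow> int. \<alpha> < k \<longrightarrow> (\<forall>s t. s < t \<longrightarrow> t < 2 * N \<longrightarrow> f s < f t) \<and>
        (\<forall>i<N. (holds M (\<theta> \<alpha>) (e \<alpha> (f (2 * i)) @ c) \<noteq> holds M (\<theta> \<alpha>) (e \<alpha> (f (2 * i + 1)) @ c)) \<longleftrightarrow> i = \<eta> \<alpha>)"
    proof (intro allI)
      fix \<alpha>
      show "\<exists>f :: nat \<Rightarrow> int. \<alpha> < k \<longrightarrow> (\<forall>s t. s < t \<longrightarrow> t < 2 * N \<longrightarrow> f s < f t) \<and>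
        (\<forall>i<N. (holds M (\<theta> \<alpha>) (e \<alpha> (f (2 * i)) @ c) \<noteq> holds M (\<theta> \<alpha>) (e \<alpha> (f (2 * i + 1)) @ c)) \<longleftrightarrow> i = \<eta> \<alpha>)"
      proof (cases "\<alpha> < k")
        case True
        show ?thesis
          by (rule isolating_pairs[of "\<lambda>j. holds M (\<theta> \<alpha>) (e \<alpha> j @ c)" "\<eta> \<alpha>" N, OF alt[OF True] \<eta>N[OF True]]) blast
      qed auto
    qed
    then obtain f :: "nat \<Rightarrow> nat \<Rightarrow> int" where
      f: "\<And>\<alpha> s t. \<alpha> < k \<Longrightarrow> s < t \<Longrightarrow> t < 2 * N \<Longrightarrow> f \<alpha> s < f \<alpha> t"
      "\<And>\<alpha> i. \<alpha> < k \<Longrightarrow> i < N \<Longrightarrow>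
        (holds M (\<theta> \<alpha>) (e \<alpha> (f \<alpha> (2 * i)) @ c) \<noteq> holds M (\<theta> \<alpha>) (e \<alpha> (f \<alpha> (2 * i + 1)) @ c)) \<longleftrightarrow> i = \<eta> \<alpha>"
      by metis
    define \<rho> where "\<rho> \<alpha> = (\<lambda>s. (int s, f \<alpha> s)) ` {..<2 * N}" for \<alpha>
    have "seq_sim k (\<lambda>_. ord_rel) (\<lambda>_. ord_rel) \<rho>"
      unfolding seq_sim_def
    proof (intro allI impI conjI)
      fix \<alpha> i j i' j' assume "\<alpha> < k" "(i, j) \<in> \<rho> \<alpha>" "(i', j') \<in> \<rho> \<alpha>"
      then obtain s t where "s < 2 * N" "t < 2 * N" "i = int s" "i' = int t" "j = f \<alpha> s" "j' = f \<alpha> t"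
        by (auto simp: \<rho>_def)
      then show "(i, i') \<in> ord_rel \<longleftrightarrow> (j, j') \<in> ord_rel"
        using f(1)[OF \<open>\<alpha> < k\<close>, of s t] f(1)[OF \<open>\<alpha> < k\<close>, of t s]
        by (cases s t rule: linorder_cases) auto
    qed auto
    then have "elementary_rel L M (Id_on A \<union> lift_rel k e e \<rho>)"
      by (rule multi_indiscernible_elem[OF multi])
    moreover have "|Domain (Id_on A \<union> lift_rel k e e \<rho>)| <o \<kappa>"
      by (rule Domain_lift_rel_small) (simp add: \<rho>_def)
    ultimately obtain c' where c': "length c' = length c"
      "elementary_rel L M (Id_on A \<union> lift_rel k e e \<rho> \<union> set (zip c' c))"
      using elementary_rel_extend_list by blast
    have real_p: "realizes M m c' p"
      using c p c' lenc by (intro realizes_transfer[of m c p c' "lift_rel k e e \<rho> \<union> set (zip c' c)"])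
        (auto simp: Un_assoc)
    have tr: "holds M (\<theta> \<alpha>) (e \<alpha> (int s) @ c') \<longleftrightarrow> holds M (\<theta> \<alpha>) (e \<alpha> (f \<alpha> s) @ c)"
      if "\<alpha> < k" "s < 2 * N" for \<alpha> s
    proof (rule elementary_rel_holds[OF c'(2)])
      show "is_fm L (length (e \<alpha> (int s) @ c')) (\<theta> \<alpha>)" using \<theta> len that c'(1) lenc by simp
      have "(int s, f \<alpha> s) \<in> \<rho> \<alpha>" using that by (auto simp: \<rho>_def)
      then show "list_all2 (\<lambda>x y. (x, y) \<in> Id_on A \<union> lift_rel k e e \<rho> \<union> set (zip c' c))
          (e \<alpha> (int s) @ c') (e \<alpha> (f \<alpha> s) @ c)"
        using len that c'(1) lift_relI[of \<alpha> k "int s" "f \<alpha> s" \<rho> _ e e]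
        by (intro list_all2_appendI) (auto simp: list_all2_conv_all_nth set_zip)
    qed
    have pat: "holds M (\<psi> \<alpha>) (b \<alpha> i @ c') \<longleftrightarrow> i = \<eta> \<alpha>" if "\<alpha> < k" "i < N" for \<alpha> i
      using that tr[of \<alpha> "2 * i"] tr[of \<alpha> "2 * i + 1"] f(2)[OF that] c'(1) lenc
      unfolding b_def by (subst \<psi>(2)) (auto simp: len)
    have real_XY: "realizes M m c' (?X \<union> Y N)"
      using pat \<eta>N c'(1) lenc unfolding realizes_def Y_def by auto
    have "Y N0 \<subseteq> Y N" by (force simp: Y_def N_def)
    then have "q \<subseteq> p \<union> (?X \<union> Y N)" using N0 by blast
    moreover have "realizes M m c' (p \<union> (?X \<union> Y N))"
      unfolding realizes_Un[of M m c' p] using real_p real_XY by (rule conjI)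
    ultimately have "realizes M m c' q" by (rule realizes_subset[rotated])
    then show "\<exists>c. realizes M m c q" ..
  qed
  ultimately have "randomness_pattern L M A m p k (\<lambda>\<alpha>. n \<alpha> + n \<alpha>) b \<psi>"
    using \<psi>(1) unfolding randomness_pattern_def by blast
  then show ?thesis by blast
qed

text \<open>Parameters from \<open>A\<close> are attached to both blocks, so that \<open>c\<close>
  is the only other parameter left.\<close>

lemma not_indiscernible_witness:
  assumes tup: "tuple_seq n r b" and not: "\<not> indiscernible L M (A \<union> set c) n r b"
  shows "\<exists>us vs a \<theta>. increasing r us \<and> increasing r vs \<and> length us = length vs \<and> set a \<subseteq> A \<and>
    is_fm L (length us * n + length a + length c) \<theta> \<and>
    holds M \<theta> ((concat (map b us) @ a) @ c) \<noteq> holds M \<theta> ((concat (map b vs) @ a) @ c)"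
proof -
  obtain us vs where uv: "increasing r us" "increasing r vs" "length us = length vs"
    "\<not> same_type L M (A \<union> set c) (concat (map b us)) (concat (map b vs))"
    using tup not unfolding indiscernible_def by blast
  have len: "length (concat (map b ws)) = length ws * n" if "increasing r ws" for ws
    using that tup by (intro length_concat_const) (auto simp: increasing_def tuple_seq_def)
  obtain \<theta> a where \<theta>: "set a \<subseteq> A \<union> set c" "is_fm L (length a + length us * n) \<theta>"
    "holds M \<theta> (a @ concat (map b us)) \<noteq> holds M \<theta> (a @ concat (map b vs))"
    using uv(4) len[OF uv(1)] len[OF uv(2)] uv(3) unfolding same_type_def by auto
  obtain a' \<theta>' where "set a' \<subseteq> A" "is_fm L (length us * n + length a' + length c) \<theta>'"
    "\<And>u. length u = length us * n \<Longrightarrow> holds M \<theta>' ((u @ a') @ c) \<longleftrightarrow> holds M \<theta> (a @ u)"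
    using separate_parameters[OF \<theta>(2,1)] by blast
  then show ?thesis
    using uv \<theta>(3) len[OF uv(1)] len[OF uv(2)]
    by (intro exI[of _ us] exI[of _ vs] exI[of _ a'] exI[of _ \<theta>']) simp
qed

lemma randomness_pattern_if_dp_rank:
  assumes p: "type_over L M A m p" and rk: "dp_rank_ge TYPE('i) L M A m p k"
  shows "\<exists>n b \<phi>. randomness_pattern L M A m p k n b \<phi>"
proof -
  obtain c n and r :: "nat \<Rightarrow> 'i rel" and b where c: "realizes M m c p"
    and mut: "mutually_indiscernible L M A k n r b"
    and not: "\<And>\<alpha>. \<alpha> < k \<Longrightarrow> \<not> indiscernible L M (A \<union> set c) (n \<alpha>) (r \<alpha>) (b \<alpha>)"
    using rk unfolding dp_rank_ge_def by blast
  have multi: "multi_indiscernible L M A k n r b"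
    by (rule multi_indiscernible_if_mutually[OF mut])
  have tup: "tuple_seq (n \<alpha>) (r \<alpha>) (b \<alpha>)" if "\<alpha> < k" for \<alpha>
    using multi that by (simp add: multi_indiscernible_def)
  have lenc: "length c = m" using c by (simp add: realizes_def)
  \<comment> \<open>The data are packed into one tuple, so that a single choice picks them for every
    sequence.\<close>
  define W where "W \<alpha> = (\<lambda>(us, vs, a, \<theta>). increasing (r \<alpha>) us \<and> increasing (r \<alpha>) vs \<and> length us = length vs \<and>
    set a \<subseteq> A \<and> is_fm L (length us * n \<alpha> + length a + m) \<theta> \<and>
    holds M \<theta> ((concat (map (b \<alpha>) us) @ a) @ c) \<noteq> holds M \<theta> ((concat (map (b \<alpha>) vs) @ a) @ c))" for \<alpha>
  have "\<exists>z. W \<alpha> z" if "\<alpha> < k" for \<alpha>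
    using not_indiscernible_witness[OF tup[OF that] not[OF that]] unfolding W_def lenc by simp
  then obtain z where z: "\<And>\<alpha>. \<alpha> < k \<Longrightarrow> W \<alpha> (z \<alpha>)" by metis
  define us where "us \<alpha> = fst (z \<alpha>)" for \<alpha>
  define vs where "vs \<alpha> = fst (snd (z \<alpha>))" for \<alpha>
  define a where "a \<alpha> = fst (snd (snd (z \<alpha>)))" for \<alpha>
  define \<theta> where "\<theta> \<alpha> = snd (snd (snd (z \<alpha>)))" for \<alpha>
  have w: "increasing (r \<alpha>) (us \<alpha>)" "increasing (r \<alpha>) (vs \<alpha>)"
    "length (us \<alpha>) = length (vs \<alpha>)" "set (a \<alpha>) \<subseteq> A"
    "is_fm L (length (us \<alpha>) * n \<alpha> + length (a \<alpha>) + m) (\<theta> \<alpha>)"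
    "holds M (\<theta> \<alpha>) ((concat (map (b \<alpha>) (us \<alpha>)) @ a \<alpha>) @ c) \<noteq>
      holds M (\<theta> \<alpha>) ((concat (map (b \<alpha>) (vs \<alpha>)) @ a \<alpha>) @ c)" if "\<alpha> < k" for \<alpha>
    using z[OF that] unfolding W_def us_def vs_def a_def \<theta>_def case_prod_beta by blast+
  define l where "l \<alpha> = length (us \<alpha>)" for \<alpha>
  \<comment> \<open>Empty blocks cannot be told apart by any formula, so the blocks of a witness are
    nonempty.\<close>
  have l: "l \<alpha> > 0" if "\<alpha> < k" for \<alpha>
    using w(3,6)[OF that] by (cases "us \<alpha>"; cases "vs \<alpha>") (auto simp: l_def)
  define X where "X \<alpha> = set (us \<alpha>) \<union> set (vs \<alpha>)" for \<alpha>
  have "\<exists>f. seq_sim k r (\<lambda>_. ord_rel :: rat rel) (\<lambda>\<alpha>. (\<lambda>x. (x, f \<alpha> x)) ` X \<alpha>)"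
  proof (rule finite_seq_sim)
    show "Linear_order (r \<alpha>)" if "\<alpha> < k" for \<alpha> using tup[OF that] by (simp add: tuple_seq_def)
    \<comment> \<open>Only the order matters here; a sequence of empty tuples presents the rationals
      as a target.\<close>
    show "tuple_seq 0 (ord_rel :: rat rel) (\<lambda>_. [])" by (simp add: tuple_seq_def infinite_UNIV_char_0)
    show "finite (X \<alpha>) \<and> X \<alpha> \<subseteq> Field (r \<alpha>)" if "\<alpha> < k" for \<alpha>
      using w(1,2)[OF that] by (simp add: X_def increasing_def)
  qed
  then obtain f where f: "seq_sim k r (\<lambda>_. ord_rel :: rat rel) (\<lambda>\<alpha>. (\<lambda>x. (x, f \<alpha> x)) ` X \<alpha>)" ..
  \<comment> \<open>The indices of both blocks are prescribed, so that \<open>d\<close> still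
    contains the two blocks which \<open>\<theta> \<alpha>\<close> distinguishes over
    \<open>c\<close>.\<close>
  have "finite (((\<lambda>x. (x, f \<alpha> x)) ` X \<alpha>)\<inverse>)" for \<alpha> by (simp add: X_def)
  then obtain d where d: "multi_indiscernible L M A k n (\<lambda>_. ord_rel :: rat rel) d"
    and d_eq: "\<And>\<alpha> q i. \<alpha> < k \<Longrightarrow> (q, i) \<in> ((\<lambda>x. (x, f \<alpha> x)) ` X \<alpha>)\<inverse> \<Longrightarrow> d \<alpha> q = b \<alpha> i"
    using multi_indiscernible_extension[OF multi seq_sim_converse[OF f]] by metis
  have dmap: "map (d \<alpha>) (map (f \<alpha>) ws) = map (b \<alpha>) ws" if "\<alpha> < k" "set ws \<subseteq> X \<alpha>" for \<alpha> ws
    using d_eq[OF that(1)] that(2) by auto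
  have fmono: "sorted_wrt (<) (map (f \<alpha>) ws)" if \<alpha>: "\<alpha> < k" and ws: "set ws \<subseteq> X \<alpha>" "increasing (r \<alpha>) ws" for \<alpha> ws
  proof -
    have "f \<alpha> x < f \<alpha> y" if "x \<in> set ws" "y \<in> set ws" "(x, y) \<in> r \<alpha> \<and> x \<noteq> y" for x y
    proof -
      have xy: "(x, f \<alpha> x) \<in> (\<lambda>x. (x, f \<alpha> x)) ` X \<alpha>" "(y, f \<alpha> y) \<in> (\<lambda>x. (x, f \<alpha> x)) ` X \<alpha>"
        using that ws by auto
      show ?thesis
        using seq_simD(3,4)[OF f \<alpha> xy] that(3) tup[OF \<alpha>] by (auto simp: tuple_seq_def)
    qed
    then show ?thesis
      unfolding sorted_wrt_map using ws(2) by (auto simp: increasing_def intro: sorted_wrt_mono_rel[rotated])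
  qed
  define lo where "lo \<alpha> = Min (f \<alpha> ` X \<alpha>)" for \<alpha>
  define hi where "hi \<alpha> = Max (f \<alpha> ` X \<alpha>)" for \<alpha>
  have bnd: "lo \<alpha> \<le> x \<and> x \<le> hi \<alpha>" if "x \<in> f \<alpha> ` X \<alpha>" for \<alpha> x
    using that by (auto simp: lo_def hi_def X_def)
  define E where "E \<alpha> u = (\<lambda>j::int. if j = 0 then u else
    map (\<lambda>t. (if j < 0 then lo \<alpha> else hi \<alpha>) + of_int j * of_nat (l \<alpha>) + of_nat t) [0..<l \<alpha>])" for \<alpha> u
  define D where "D \<alpha> u j = concat (map (d \<alpha>) (E \<alpha> u j)) @ a \<alpha>" for \<alpha> u j
  \<comment> \<open>Block 1 is the same for both choices of block 0, while the values of
    \<open>\<theta> \<alpha>\<close> on the two choices differ; hence one of them differs from the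
    value on block 1.\<close>
  have "\<forall>\<alpha>. \<exists>u. \<alpha> < k \<longrightarrow> (u = map (f \<alpha>) (us \<alpha>) \<or> u = map (f \<alpha>) (vs \<alpha>)) \<and>
      holds M (\<theta> \<alpha>) (D \<alpha> u 0 @ c) \<noteq> holds M (\<theta> \<alpha>) (D \<alpha> u 1 @ c)"
  proof (intro allI)
    fix \<alpha>
    show "\<exists>u. \<alpha> < k \<longrightarrow> (u = map (f \<alpha>) (us \<alpha>) \<or> u = map (f \<alpha>) (vs \<alpha>)) \<and>
      holds M (\<theta> \<alpha>) (D \<alpha> u 0 @ c) \<noteq> holds M (\<theta> \<alpha>) (D \<alpha> u 1 @ c)"
    proof (cases "\<alpha> < k")
      case True
      have "D \<alpha> u 1 = D \<alpha> u' 1" for u u' by (simp add: D_def E_def)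
      moreover have "holds M (\<theta> \<alpha>) (D \<alpha> (map (f \<alpha>) (us \<alpha>)) 0 @ c) \<noteq>
          holds M (\<theta> \<alpha>) (D \<alpha> (map (f \<alpha>) (vs \<alpha>)) 0 @ c)"
        using w(6)[OF True] dmap[OF True, of "us \<alpha>"] dmap[OF True, of "vs \<alpha>"]
        unfolding D_def E_def by (simp add: X_def del: map_map)
      ultimately show ?thesis by metis
    qed auto
  qed
  then obtain u where u: "\<And>\<alpha>. \<alpha> < k \<Longrightarrow> u \<alpha> = map (f \<alpha>) (us \<alpha>) \<or> u \<alpha> = map (f \<alpha>) (vs \<alpha>)"
    "\<And>\<alpha>. \<alpha> < k \<Longrightarrow> holds M (\<theta> \<alpha>) (D \<alpha> (u \<alpha>) 0 @ c) \<noteq> holds M (\<theta> \<alpha>) (D \<alpha> (u \<alpha>) 1 @ c)"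
    by metis
  have u': "length (u \<alpha>) = l \<alpha>" "sorted_wrt (<) (u \<alpha>)" "\<And>x. x \<in> set (u \<alpha>) \<Longrightarrow> lo \<alpha> \<le> x \<and> x \<le> hi \<alpha>"
    if "\<alpha> < k" for \<alpha>
  proof -
    show "length (u \<alpha>) = l \<alpha>" using u(1)[OF that] w(3)[OF that] by (auto simp: l_def)
    show "sorted_wrt (<) (u \<alpha>)"
      using u(1)[OF that] fmono[OF that, of "us \<alpha>"] fmono[OF that, of "vs \<alpha>"] w(1,2)[OF that]
      by (auto simp: X_def)
    show "lo \<alpha> \<le> x \<and> x \<le> hi \<alpha>" if "x \<in> set (u \<alpha>)" for x
      using u(1)[OF \<open>\<alpha> < k\<close>] that by (intro bnd) (auto simp: X_def)
  qed
  have block: "length (E \<alpha> (u \<alpha>) j) = l \<alpha>"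
    "t < l \<alpha> \<Longrightarrow> t' < l \<alpha> \<Longrightarrow> E \<alpha> (u \<alpha>) j ! t \<le> E \<alpha> (u \<alpha>) j' ! t' \<longleftrightarrow> (if j = j' then t \<le> t' else j \<le> j')"
    if "\<alpha> < k" for \<alpha> j j' t t'
    unfolding E_def by (rule block_sequence[OF u'[OF that] l[OF that]]; assumption)+
  have "multi_indiscernible L M A k (\<lambda>\<alpha>. l \<alpha> * n \<alpha> + length (a \<alpha>)) (\<lambda>_. ord_rel :: int rel)
      (\<lambda>\<alpha> j. concat (map (d \<alpha>) (E \<alpha> (u \<alpha>) j)) @ a \<alpha>)"
    using d
  proof (rule multi_indiscernible_blocks)
    fix \<alpha> and j j' :: int and t t' assume "\<alpha> < k" "t < l \<alpha>" "t' < l \<alpha>"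
    then show "(E \<alpha> (u \<alpha>) j ! t, E \<alpha> (u \<alpha>) j' ! t') \<in> ord_rel \<longleftrightarrow> (if j = j' then t \<le> t' else (j, j') \<in> ord_rel)"
      using block(2)[of \<alpha> t t' j j'] by simp
  qed (use block(1) w(4) in \<open>auto simp: infinite_UNIV_char_0\<close>)
  then have "multi_indiscernible L M A k (\<lambda>\<alpha>. l \<alpha> * n \<alpha> + length (a \<alpha>)) (\<lambda>_. ord_rel :: int rel)
      (\<lambda>\<alpha>. D \<alpha> (u \<alpha>))"
    by (simp add: D_def[abs_def])
  then show ?thesis
    using w(5) u(2) by (intro randomness_pattern_if_alternation[OF p c]) (auto simp: l_def)
qed

end

section \<open>Alternation and dp-rank\<close>

lemma realizesD: "realizes M m c q \<Longrightarrow> (\<phi>, a) \<in> q \<Longrightarrow> holds M \<phi> (a @ c)"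
  by (auto simp: realizes_def)

context saturated_over
begin

lemma indiscernible_extension:
  assumes ind: "indiscernible L M A n r b" and xs: "increasing r xs"
  obtains d where "multi_indiscernible L M A 1 (\<lambda>_. n) (\<lambda>_. ord_rel :: rat rel) (\<lambda>_. d)"
    and "\<And>t. t < length xs \<Longrightarrow> d (of_nat t) = b (xs ! t)"
proof -
  have r: "Linear_order r" using ind by (simp add: indiscernible_def tuple_seq_def)
  let ?\<rho> = "\<lambda>_::nat. (\<lambda>t. (of_nat t :: rat, xs ! t)) ` {..<length xs}"
  have sim: "seq_sim 1 (\<lambda>_. ord_rel :: rat rel) (\<lambda>_. r) ?\<rho>"
    unfolding seq_sim_def
  proof (intro allI impI conjI)
    fix \<alpha> :: nat and i j i' j' assume "(i, j) \<in> ?\<rho> \<alpha>" "(i', j') \<in> ?\<rho> \<alpha>"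
    then show "(i, i') \<in> ord_rel \<longleftrightarrow> (j, j') \<in> r"
      by (auto simp: increasing_nth_le_iff[OF r xs])
  qed (use xs in \<open>auto simp: increasing_def\<close>)
  have "multi_indiscernible L M A 1 (\<lambda>_. n) (\<lambda>_. r) (\<lambda>_. b)"
    using ind indiscernible_iff_multi by blast
  from multi_indiscernible_extension[OF this sim] obtain d where d: "multi_indiscernible L M A 1 (\<lambda>_. n) (\<lambda>_. ord_rel :: rat rel) d"
    and eq: "\<And>\<alpha> q i. \<alpha> < 1 \<Longrightarrow> (q, i) \<in> ?\<rho> \<alpha> \<Longrightarrow> d \<alpha> q = b i"
    by auto
  \<comment> \<open>The extension is a family indexed by sequence numbers, of which only member 0 is
    meaningful; it is replaced by a constant family.\<close>
  have "lift_rel 1 d d \<rho> = lift_rel 1 (\<lambda>_. d 0) (\<lambda>_. d 0) \<rho>" for \<rho> :: "nat \<Rightarrow> rat rel"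
    by (simp add: lift_rel_def)
  then have "multi_indiscernible L M A 1 (\<lambda>_. n) (\<lambda>_. ord_rel :: rat rel) (\<lambda>_. d 0)"
    using d by (simp add: multi_indiscernible_def same_em_def)
  then show ?thesis using eq[of 0] by (intro that) auto
qed

lemma dp_rank_if_alt:
  assumes inf: "infinite (UNIV :: 'i set)" and \<phi>: "is_fm L (n + m) \<phi>"
    and alt: "alt_ge TYPE('i) L M A m p n \<phi> (2 * k)"
  shows "dp_rank_ge TYPE('i) L M A m p k"
proof -
  obtain r :: "'i rel" and b c xs where ind: "indiscernible L M A n r b" and c: "realizes M m c p"
    and xs: "increasing r xs" "length xs = Suc (2 * k)"
    and alt: "\<And>j. j < 2 * k \<Longrightarrow> holds M \<phi> (b (xs ! j) @ c) \<noteq> holds M \<phi> (b (xs ! Suc j) @ c)"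
    using alt unfolding alt_ge_def by blast
  obtain d where d: "multi_indiscernible L M A 1 (\<lambda>_. n) (\<lambda>_. ord_rel :: rat rel) (\<lambda>_. d)"
    and d_eq: "\<And>t. t < length xs \<Longrightarrow> d (of_nat t) = b (xs ! t)"
    using indiscernible_extension[OF ind xs(1)] by blast
  have lenc: "length c = m" using c by (simp add: realizes_def)
  have lend: "length (d q) = n" for q
    using d by (simp add: multi_indiscernible_def tuple_seq_def)
  obtain g :: "nat \<Rightarrow> 'i" where g: "inj g" using infinite_countable_subset[OF inf] by blast
  \<comment> \<open>\<open>h \<alpha>\<close> increases from \<open>2 * \<alpha>\<close> towards
    \<open>2 * \<alpha> + 2\<close> and takes the value \<open>2 * \<alpha> + 1\<close> at 1. So
    piece \<open>\<alpha>\<close> starts with two prescribed entries between which the truth value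
    changes.\<close>
  define h :: "nat \<Rightarrow> nat \<Rightarrow> rat" where "h \<alpha> j = of_nat (2 * \<alpha>) + 2 - 2 / of_nat (Suc j)" for \<alpha> j
  have h: "h \<alpha> i \<le> h \<beta> j \<longleftrightarrow> \<alpha> < \<beta> \<or> \<alpha> = \<beta> \<and> i \<le> j" for \<alpha> \<beta> i j
  proof -
    have bnd: "of_nat (2 * \<alpha>) \<le> h \<alpha> i" "h \<alpha> i < of_nat (2 * \<alpha> + 2)" for \<alpha> i
      by (simp_all add: h_def field_simps)
    have lt: "h \<alpha> i < h \<beta> j" if "\<alpha> < \<beta>" for \<alpha> \<beta> i j
    proof -
      have "(of_nat (2 * \<alpha> + 2) :: rat) \<le> of_nat (2 * \<beta>)" using that by (simp only: of_nat_le_iff)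
      then show ?thesis using bnd(2)[of \<alpha> i] bnd(1)[of \<beta> j] by linarith
    qed
    have "h \<alpha> i < h \<alpha> j" if "i < j" for i j
      using that by (simp add: h_def frac_less2)
    then have "h \<alpha> i \<le> h \<alpha> j \<longleftrightarrow> i \<le> j" for i j
      by (metis linorder_not_less order_le_less)
    then show ?thesis using lt[of \<alpha> \<beta> i j] lt[of \<beta> \<alpha> j i] by (cases \<alpha> \<beta> rule: linorder_cases) auto
  qed
  have "multi_indiscernible L M A k (\<lambda>_. n) (\<lambda>_. natLeq) (\<lambda>\<alpha> j. d (h \<alpha> j))"
    by (rule multi_indiscernible_pieces[OF d]) (auto simp: natLeq_eq_ord_rel h)
  from multi_indiscernible_transport[OF this g]
  have "mutually_indiscernible L M A k (\<lambda>_. n) (\<lambda>_. transport g) (\<lambda>\<alpha> i. d (h \<alpha> (inv g i)))"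
    by (rule mutually_indiscernible_if_multi)
  moreover have "\<not> indiscernible L M (A \<union> set c) n (transport g) (\<lambda>i. d (h \<alpha> (inv g i)))" if \<alpha>: "\<alpha> < k" for \<alpha>
  proof
    assume "indiscernible L M (A \<union> set c) n (transport g) (\<lambda>i. d (h \<alpha> (inv g i)))"
    moreover have "increasing (transport g) [g i]" for i
      using increasing_transport[OF g, of "[i]"] by simp
    ultimately have "same_type L M (A \<union> set c)
        (concat (map (\<lambda>i. d (h \<alpha> (inv g i))) [g 0])) (concat (map (\<lambda>i. d (h \<alpha> (inv g i))) [g 1]))"
      unfolding indiscernible_def by (metis length_Cons)
    then have "same_type L M (A \<union> set c) (d (h \<alpha> 0)) (d (h \<alpha> 1))"
      using g by simp
    from elementary_rel_if_same_type[OF this]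
    have "holds M \<phi> (d (h \<alpha> 0) @ c) \<longleftrightarrow> holds M \<phi> (d (h \<alpha> 1) @ c)"
    proof (rule elementary_rel_holds)
      show "list_all2 (\<lambda>x y. (x, y) \<in> Id_on (A \<union> set c) \<union> set (zip (d (h \<alpha> 0)) (d (h \<alpha> 1))))
          (d (h \<alpha> 0) @ c) (d (h \<alpha> 1) @ c)"
        using lend by (intro list_all2_appendI) (auto simp: list_all2_conv_all_nth set_zip)
    qed (use \<phi> lend lenc in simp)
    moreover have "h \<alpha> 0 = of_nat (2 * \<alpha>)" "h \<alpha> 1 = of_nat (Suc (2 * \<alpha>))"
      by (simp_all add: h_def)
    ultimately show False
      using alt[of "2 * \<alpha>"] d_eq[of "2 * \<alpha>"] d_eq[of "Suc (2 * \<alpha>)"] \<alpha> xs(2) by simp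
  qed
  ultimately show ?thesis
    using c unfolding dp_rank_ge_def
    by (intro exI[of _ c] exI[of _ "\<lambda>_. n"] exI[of _ "\<lambda>_. transport g"] exI[of _ "\<lambda>\<alpha> i. d (h \<alpha> (inv g i))"]) auto
qed

text \<open>In \<open>r\<close> the given pairs need not extend to an infinite sequence of pairs:
  all other indices may lie between the two members of one pair. Over the rationals they are placed
  at \<open>2 * i\<close> and \<open>2 * i + 1\<close>, and further pairs follow.\<close>

lemma alt_ge_pairs:
  fixes r :: "'j rel"
  assumes inf: "infinite (UNIV :: 'i set)" and ind: "indiscernible L M A n r b" and c: "realizes M m c p"
    and xs: "increasing r xs" "length xs = 2 * Suc l"
    and alt: "\<And>j. j \<le> l \<Longrightarrow>
      (holds M \<phi> (b (xs ! (2 * j)) @ c) \<noteq> holds M \<phi> (b (xs ! (2 * j + 1)) @ c)) \<longleftrightarrow> odd j"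
    and \<psi>: "\<And>x x' c. length x = n \<Longrightarrow> length x' = n \<Longrightarrow> length c = m \<Longrightarrow>
      holds M \<psi> ((x @ x') @ c) \<longleftrightarrow> holds M \<phi> (x @ c) \<noteq> holds M \<phi> (x' @ c)"
  shows "alt_ge TYPE('i) L M A m p (n + n) \<psi> l"
proof -
  obtain d where d: "multi_indiscernible L M A 1 (\<lambda>_. n) (\<lambda>_. ord_rel :: rat rel) (\<lambda>_. d)"
    and d_eq: "\<And>t. t < length xs \<Longrightarrow> d (of_nat t) = b (xs ! t)"
    using indiscernible_extension[OF ind xs(1)] by blast
  have lenc: "length c = m" using c by (simp add: realizes_def)
  have lend: "length (d q) = n" for q
    using d by (simp add: multi_indiscernible_def tuple_seq_def)
  obtain g :: "nat \<Rightarrow> 'i" where g: "inj g" using infinite_countable_subset[OF inf] by blast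
  define e where "e i = d (of_nat (2 * i)) @ d (of_nat (2 * i + 1))" for i :: nat
  have "strict_mono (of_nat :: nat \<Rightarrow> rat)" by (simp add: strict_mono_def)
  from multi_indiscernible_transport[OF multi_indiscernible_pairs[OF d this] g]
  have "indiscernible L M A (n + n) (transport g) (\<lambda>i. e (inv g i))"
    unfolding indiscernible_iff_multi e_def .
  moreover have "increasing (transport g) (map g [0..<Suc l])"
    by (rule increasing_transport[OF g sorted_wrt_upt])
  moreover have val: "holds M \<psi> (e j @ c) \<longleftrightarrow> odd j" if "j \<le> l" for j
  proof -
    have "2 * j < length xs" "2 * j + 1 < length xs" using that xs(2) by auto
    from d_eq[OF this(1)] d_eq[OF this(2)] show ?thesis
      using alt[OF that] \<psi>[OF lend lend lenc, of "of_nat (2 * j)" "of_nat (2 * j + 1)"]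
      unfolding e_def by metis
  qed
  have "holds M \<psi> (e (inv g (map g [0..<Suc l] ! j)) @ c) \<noteq>
      holds M \<psi> (e (inv g (map g [0..<Suc l] ! Suc j)) @ c)" if "j < l" for j
    using that val[of j] val[of "Suc j"] g by (simp del: upt_Suc)
  ultimately show ?thesis
    using c unfolding alt_ge_def
    by (intro exI[of _ "transport g"] exI[of _ "\<lambda>i. e (inv g i)"] exI[of _ c] exI[of _ "map g [0..<Suc l]"]) simp
qed

lemma realizes_if_consistent:
  assumes p: "type_over L M A m p" and q: "consistent M m (p \<union> q)" "countable C"
    "\<And>\<phi> a. (\<phi>, a) \<in> q \<Longrightarrow> set a \<subseteq> C \<and> is_fm L (length a + m) \<phi>"
  obtains c where "realizes M m c p" "realizes M m c q"
proof -
  have "type_over L M (A \<union> C) m (p \<union> q)"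
    using p q unfolding type_over_def by blast
  then obtain c where "realizes M m c (p \<union> q)"
    using saturated small_Un_countable[OF small q(2)] unfolding saturated_def by blast
  then show ?thesis using that[of c] by (simp add: realizes_Un)
qed

end

section \<open>From randomness patterns to traces\<close>

lemma nth_concat_family:
  fixes k :: nat
  assumes "\<And>\<alpha>. \<alpha> < k \<Longrightarrow> length (x \<alpha>) = n \<alpha>" "\<alpha> < k" "t < n \<alpha>"
  shows "concat (map x [0..<k]) ! ((\<Sum>\<beta><\<alpha>. n \<beta>) + t) = x \<alpha> ! t \<and>
    (\<Sum>\<beta><\<alpha>. n \<beta>) + t < (\<Sum>\<beta><k. n \<beta>)"
  using assms
proof (induction k)
  case (Suc k)
  have len: "length (concat (map x [0..<k])) = (\<Sum>\<beta><k. n \<beta>)"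
    using Suc.prems(1) by (simp add: length_concat comp_def sum_list_sum_nth lessThan_atLeast0)
  show ?case
  proof (cases "\<alpha> < k")
    case True
    then show ?thesis using Suc.IH Suc.prems len by (simp add: nth_append)
  next
    case False
    then have "\<alpha> = k" using Suc.prems by simp
    then show ?thesis using Suc.prems len by (simp add: nth_append)
  qed
qed simp

context saturated_over
begin

text \<open>With \<open>\<eta>\<close> an enumeration of \<open>I'\<close>, formula
  \<open>\<alpha>\<close> holds exactly at the index \<open>\<eta> \<alpha>\<close>, so the
  disjunction holds exactly on \<open>I'\<close>. The sequences are glued index by index to let all
  formulas speak about the same tuple.\<close>

lemma traces_if_randomness_pattern:
  assumes inf: "infinite (UNIV :: 'i set)" and p: "type_over L M A m p" and "k \<ge> 1"
    and pat: "randomness_pattern L M A m p k n b \<phi>"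
  shows "\<exists>n \<phi> (r :: 'i rel) b. is_fm L (n + m) \<phi> \<and> indiscernible L M A n r b \<and>
    (\<forall>I'. I' \<subseteq> Field r \<and> card I' = k \<longrightarrow>
      (\<exists>c. realizes M m c p \<and> {i \<in> Field r. holds M \<phi> (b i @ c)} = I'))"
proof -
  have fm: "\<And>\<alpha>. \<alpha> < k \<Longrightarrow> is_fm L (n \<alpha> + m) (\<phi> \<alpha>)"
    and multi: "multi_indiscernible L M A k n (\<lambda>_. natLeq) b"
    and cons: "\<And>\<eta>. consistent M m
          (p \<union> {(\<phi> \<alpha>, b \<alpha> (\<eta> \<alpha>)) |\<alpha>. \<alpha> < k} \<union> {(Neg (\<phi> \<alpha>), b \<alpha> i) |\<alpha> i. \<alpha> < k \<and> i \<noteq> \<eta> \<alpha>})"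
    using pat multi_indiscernible_if_mutually unfolding randomness_pattern_def by blast+
  have len: "length (b \<alpha> i) = n \<alpha>" if "\<alpha> < k" for \<alpha> i
    using multi that by (simp add: multi_indiscernible_def tuple_seq_def natLeq_eq_ord_rel)
  obtain g :: "nat \<Rightarrow> 'i" where g: "inj g" using infinite_countable_subset[OF inf] by blast
  define N where "N = (\<Sum>\<alpha><k. n \<alpha>)"
  define e where "e i = concat (map (\<lambda>\<alpha>. b \<alpha> i) [0..<k])" for i
  have lene: "length (e i) = N" for i
    using len by (simp add: e_def N_def length_concat comp_def sum_list_sum_nth lessThan_atLeast0)
  have ind: "indiscernible L M A N (transport g) (\<lambda>i. e (inv g i))"
    unfolding indiscernible_iff_multi e_def N_def
    by (rule multi_indiscernible_transport[OF multi_indiscernible_merge[OF multi \<open>k \<ge> 1\<close>] g])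
  \<comment> \<open>The parameters of formula \<open>\<alpha>\<close> are found in slot
    \<open>\<alpha>\<close> of the glued tuple, and \<open>y\<close> behind all slots.\<close>
  define f where "f \<alpha> i = (if i < n \<alpha> then (\<Sum>\<beta><\<alpha>. n \<beta>) + i else N + (i - n \<alpha>))" for \<alpha> i
  have nth: "e j ! ((\<Sum>\<beta><\<alpha>. n \<beta>) + t) = b \<alpha> j ! t \<and> (\<Sum>\<beta><\<alpha>. n \<beta>) + t < N"
    if "\<alpha> < k" "t < n \<alpha>" for \<alpha> t j
    unfolding e_def N_def using nth_concat_family[of k "\<lambda>\<alpha>. b \<alpha> j" n \<alpha> t] len that by simp
  have fm': "is_fm L (N + m) (rename (\<phi> \<alpha>) (f \<alpha>))" if "\<alpha> < k" for \<alpha>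
    using fm[OF that] nth[OF that] by (intro is_fm_rename) (auto simp: f_def trans_less_add1)
  have holds': "holds M (rename (\<phi> \<alpha>) (f \<alpha>)) (e j @ c) \<longleftrightarrow> holds M (\<phi> \<alpha>) (b \<alpha> j @ c)"
    if "\<alpha> < k" "length c = m" for \<alpha> j c
  proof (rule holds_rename[where L = L])
    show "is_fm L (length (b \<alpha> j @ c)) (\<phi> \<alpha>)" using fm len that by simp
    show "f \<alpha> i < length (e j @ c) \<and> (e j @ c) ! f \<alpha> i = (b \<alpha> j @ c) ! i" if "i < length (b \<alpha> j @ c)" for i
      using that nth[OF \<open>\<alpha> < k\<close>, of i j] len[OF \<open>\<alpha> < k\<close>] lene
      by (auto simp: f_def nth_append trans_less_add1)
  qed
  obtain \<psi> where \<psi>: "is_fm L (N + m) \<psi>"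
    "\<And>us. holds M \<psi> us \<longleftrightarrow> (\<exists>\<alpha><k. holds M (rename (\<phi> \<alpha>) (f \<alpha>)) us)"
    using disj_formula[where \<phi> = "\<lambda>\<alpha>. rename (\<phi> \<alpha>) (f \<alpha>)" and M = M, OF fm' \<open>k \<ge> 1\<close>] by blast
  have "\<exists>c. realizes M m c p \<and> {i \<in> Field (transport g). holds M \<psi> (e (inv g i) @ c)} = I'"
    if I': "I' \<subseteq> Field (transport g)" "card I' = k" for I'
  proof -
    define J where "J = g -` I'"
    have I'J: "I' = g ` J" using I'(1) by (auto simp: J_def Field_transport)
    then have "card J = k" using I'(2) g by (metis card_image inj_on_subset subset_UNIV)
    moreover have "finite J" using \<open>card J = k\<close> \<open>k \<ge> 1\<close> card.infinite by fastforce
    ultimately obtain \<eta> where \<eta>: "bij_betw \<eta> {0..<k} J"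
      using ex_bij_betw_nat_finite by blast
    let ?q = "{(\<phi> \<alpha>, b \<alpha> (\<eta> \<alpha>)) |\<alpha>. \<alpha> < k} \<union> {(Neg (\<phi> \<alpha>), b \<alpha> i) |\<alpha> i. \<alpha> < k \<and> i \<noteq> \<eta> \<alpha>}"
    obtain c where c: "realizes M m c p" "realizes M m c ?q"
    proof (rule realizes_if_consistent[OF p])
      show "consistent M m (p \<union> ?q)" using cons[of \<eta>] by (simp add: Un_assoc)
      show "countable (\<Union>\<alpha>. \<Union>i. set (b \<alpha> i))"
        by (rule countable_UN, simp, rule countable_UN, simp, rule countable_finite, simp)
      show "set a \<subseteq> (\<Union>\<alpha>. \<Union>i. set (b \<alpha> i)) \<and> is_fm L (length a + m) \<chi>" if "(\<chi>, a) \<in> ?q" for \<chi> a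
        using that fm len by auto
    qed
    have lenc: "length c = m" using c by (simp add: realizes_def)
    have "holds M (\<phi> \<alpha>) (b \<alpha> i @ c) \<longleftrightarrow> i = \<eta> \<alpha>" if "\<alpha> < k" for \<alpha> i
    proof (cases "i = \<eta> \<alpha>")
      case True
      then have "(\<phi> \<alpha>, b \<alpha> i) \<in> ?q" using that by blast
      from realizesD[OF c(2) this] show ?thesis using True by simp
    next
      case False
      then have "(Neg (\<phi> \<alpha>), b \<alpha> i) \<in> ?q" using that by blast
      from realizesD[OF c(2) this] show ?thesis using False by simp
    qed
    then have eqJ: "holds M \<psi> (e j @ c) \<longleftrightarrow> j \<in> J" for j
      using \<eta> holds' lenc by (auto simp: \<psi>(2) bij_betw_def)
    have "{i \<in> Field (transport g). holds M \<psi> (e (inv g i) @ c)} = I'"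
      unfolding Field_transport I'J eqJ using g by auto
    then show ?thesis using c(1) by blast
  qed
  then show ?thesis using \<psi>(1) ind by blast
qed

end

section \<open>Counting types\<close>

text \<open>Different traces of size \<open>k\<close> give different \<open>\<phi>\<close>-types,
  and \<open>N choose k\<close> is at least \<open>(N / k) ^ k\<close>, which forces the exponent to
  be at least \<open>k\<close>.\<close>

lemma vc_density_ge_if_traces:
  assumes inf: "infinite (Field r)" and "k \<ge> 1"
    and tr: "\<And>I'. I' \<subseteq> Field r \<Longrightarrow> card I' = k \<Longrightarrow>
      \<exists>c. realizes M m c p \<and> {i \<in> Field r. holds M \<phi> (b i @ c)} = I'"
  shows "vc_density M m p \<phi> (b ` Field r) \<ge> ereal (real k)"
proof -
  \<comment> \<open>Some trace of size \<open>k\<close> contains \<open>i\<close> but not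
    \<open>j\<close>, so \<open>b i\<close> and \<open>b j\<close> differ; subsets of the index set
    can then be recovered from types.\<close>
  have inj: "inj_on b (Field r)"
  proof (rule inj_onI, rule ccontr)
    fix i j assume ij: "i \<in> Field r" "j \<in> Field r" "b i = b j" "i \<noteq> j"
    obtain S where S: "finite S" "card S = k - 1" "S \<subseteq> Field r - {i, j}"
      using infinite_arbitrarily_large[of "Field r - {i, j}" "k - 1"] inf by auto
    then have "card (insert i S) = k" "insert i S \<subseteq> Field r" "j \<notin> insert i S"
      using \<open>k \<ge> 1\<close> ij by (auto simp: card_insert_if)
    then obtain c where c: "{i \<in> Field r. holds M \<phi> (b i @ c)} = insert i S"
      using tr by blast
    have "i \<in> {i \<in> Field r. holds M \<phi> (b i @ c)}" "j \<notin> {i \<in> Field r. holds M \<phi> (b i @ c)}"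
      unfolding c using \<open>j \<notin> insert i S\<close> by auto
    then have "holds M \<phi> (b i @ c)" "\<not> holds M \<phi> (b j @ c)"
      using ij(2) by blast+
    then show False using ij(3) by simp
  qed
  have count: "N choose k \<le> card (phi_types M m p \<phi> (b ` S))"
    if S: "finite S" "S \<subseteq> Field r" "card S = N" for S N
  proof -
    define q where "q I' = {(\<phi>, b i) |i. i \<in> I'} \<union> {(Neg \<phi>, b i) |i. i \<in> S - I'}" for I'
    have fin: "finite (phi_types M m p \<phi> (b ` S))"
    proof (rule finite_subset)
      show "phi_types M m p \<phi> (b ` S) \<subseteq> Pow ({\<phi>, Neg \<phi>} \<times> b ` S)"
        by (auto simp: phi_types_def)
    qed (use S in simp)
    have mem: "(\<phi>, b i) \<in> q I' \<longleftrightarrow> i \<in> I'" "(Neg \<phi>, b i) \<in> q I' \<longleftrightarrow> i \<notin> I'" if "I' \<subseteq> S" "i \<in> S" for I' i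
    proof -
      have eq: "b i = b j \<longleftrightarrow> i = j" if "j \<in> S" for j
        using that \<open>i \<in> S\<close> by (rule inj_on_eq_iff[OF inj_on_subset[OF inj S(2)], rotated])
      have "(\<phi>, b i) \<in> q I' \<longleftrightarrow> (\<exists>j\<in>I'. b i = b j)" "(Neg \<phi>, b i) \<in> q I' \<longleftrightarrow> (\<exists>j\<in>S - I'. b i = b j)"
        by (auto simp: q_def)
      then show "(\<phi>, b i) \<in> q I' \<longleftrightarrow> i \<in> I'" "(Neg \<phi>, b i) \<in> q I' \<longleftrightarrow> i \<notin> I'"
        using eq that by (metis subsetD, metis DiffD1 DiffD2 DiffI)
    qed
    have "inj_on q {I'. I' \<subseteq> S \<and> card I' = k}"
    proof (rule inj_onI)
      fix I J assume "I \<in> {I'. I' \<subseteq> S \<and> card I' = k}" "J \<in> {I'. I' \<subseteq> S \<and> card I' = k}" "q I = q J"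
      then show "I = J" using mem(1)[of I] mem(1)[of J] by blast
    qed
    moreover have "q I' \<in> phi_types M m p \<phi> (b ` S)" if I': "I' \<subseteq> S" "card I' = k" for I'
      unfolding phi_types_def
    proof (intro CollectI conjI ballI)
      show "q I' \<subseteq> {\<phi>, Neg \<phi>} \<times> b ` S" using I' by (auto simp: q_def)
      show "((\<phi>, x) \<in> q I') \<noteq> ((Neg \<phi>, x) \<in> q I')" if "x \<in> b ` S" for x
        using that mem[OF I'(1)] by auto
      obtain c where c: "realizes M m c p" "{i \<in> Field r. holds M \<phi> (b i @ c)} = I'"
        using tr[of I'] I' S(2) by auto
      have "realizes M m c (p \<union> q I')"
        using c I' S(2) by (auto simp: realizes_def q_def)
      then show "consistent M m (p \<union> q I')"
        unfolding consistent_def realizes_def by blast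
    qed
    ultimately have "card {I'. I' \<subseteq> S \<and> card I' = k} \<le> card (phi_types M m p \<phi> (b ` S))"
      using fin by (intro card_inj_on_le[of q]) auto
    then show ?thesis using n_subsets[OF S(1)] S(3) by simp
  qed
  show ?thesis
    unfolding vc_density_def
  proof (rule Inf_greatest)
    fix x assume "x \<in> {ereal s |s. s \<ge> 0 \<and> (\<exists>f :: nat \<Rightarrow> real. (\<forall>n. f n \<ge> 0) \<and> f \<in> O(\<lambda>n. real n powr s) \<and>
      (\<forall>C'. finite C' \<and> C' \<subseteq> b ` Field r \<longrightarrow> real (card (phi_types M m p \<phi> C')) \<le> f (card C')))}"
    then obtain s f where s: "x = ereal s" and f: "\<forall>n. f n \<ge> 0" "f \<in> O(\<lambda>n. real n powr s)"
      "\<forall>C'. finite C' \<and> C' \<subseteq> b ` Field r \<longrightarrow> real (card (phi_types M m p \<phi> C')) \<le> f (card C')"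
      by blast
    have le: "real (N choose k) \<le> f N" for N
    proof -
      obtain S where S: "finite S" "card S = N" "S \<subseteq> Field r"
        using infinite_arbitrarily_large[OF inf] by blast
      have "real (N choose k) \<le> real (card (phi_types M m p \<phi> (b ` S)))"
        using count[OF S(1,3,2)] by simp
      also have "\<dots> \<le> f (card (b ` S))" using f(3) S by blast
      also have "card (b ` S) = N" using S inj by (metis card_image inj_on_subset)
      finally show ?thesis .
    qed
    have "(\<lambda>N. real N powr real k) \<in> O(f)"
    proof (rule bigoI)
      show "\<forall>\<^sub>F N in sequentially. norm (real N powr real k) \<le> real k ^ k * norm (f N)"
        using eventually_ge_at_top[of k]
      proof eventually_elim
        case (elim N)
        have "(real N / real k) ^ k \<le> real (N choose k)"
          using binomial_ge_n_over_k_pow_k[OF elim, where 'a = real] .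
        also have "\<dots> \<le> f N" by (rule le)
        finally have "real N ^ k \<le> real k ^ k * f N"
          using \<open>k \<ge> 1\<close> by (simp add: power_divide field_simps)
        moreover have "real N powr real k = real N ^ k"
          using elim \<open>k \<ge> 1\<close> by (simp add: powr_realpow)
        ultimately show ?case using f(1) by simp
      qed
    qed
    from landau_o.big_trans[OF this f(2)]
    have "(\<lambda>N. real N powr real k) \<in> O(\<lambda>N. real N powr s)" .
    then have "real k \<le> s"
      using powr_bigo_iff[OF filterlim_real_sequentially, of "real k" s] by simp
    then show "ereal (real k) \<le> x" by (simp add: s)
  qed
qed

section \<open>Covering and counting the changes of truth value\<close>

text \<open>Take the least element, discard everything less than \<open>G\<close> above it, and
  repeat. If the elements run out early, the list is padded with \<open>hi\<close> to have length
  exactly \<open>t\<close>.\<close>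

lemma greedy_cover:
  fixes D :: "nat set"
  shows "(\<exists>ds. length ds = Suc t \<and> set ds \<subseteq> {d \<in> D. lo \<le> d \<and> d < hi} \<and> sorted_wrt (\<lambda>x y. x + G \<le> y) ds) \<or>
    (\<exists>xs. length xs = t \<and> set xs \<subseteq> {..hi} \<and> {d \<in> D. lo \<le> d \<and> d < hi} \<subseteq> (\<Union>x\<in>set xs. {x..<x + G}))"
proof (induction t arbitrary: lo)
  case 0
  show ?case
  proof (cases "{d \<in> D. lo \<le> d \<and> d < hi} = {}")
    case True
    then show ?thesis by (intro disjI2 exI[of _ "[]"]) auto
  next
    case False
    then obtain d where "d \<in> {d \<in> D. lo \<le> d \<and> d < hi}" by blast
    then show ?thesis by (intro disjI1 exI[of _ "[d]"]) auto
  qed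
next
  case (Suc t)
  show ?case
  proof (cases "{d \<in> D. lo \<le> d \<and> d < hi} = {}")
    case True
    then show ?thesis by (intro disjI2 exI[of _ "replicate (Suc t) hi"]) auto
  next
    case False
    define d where "d = (LEAST d. d \<in> {d \<in> D. lo \<le> d \<and> d < hi})"
    have d: "d \<in> {d \<in> D. lo \<le> d \<and> d < hi}"
      unfolding d_def by (rule LeastI_ex) (use False in blast)
    have least: "d \<le> d'" if "d' \<in> {d \<in> D. lo \<le> d \<and> d < hi}" for d'
      unfolding d_def using that by (rule Least_le)
    from Suc.IH[of "d + G"] show ?thesis
    proof (elim disjE exE conjE)
      fix ds assume ds: "length ds = Suc t" "set ds \<subseteq> {e \<in> D. d + G \<le> e \<and> e < hi}"
        "sorted_wrt (\<lambda>x y. x + G \<le> y) ds"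
      then have "sorted_wrt (\<lambda>x y. x + G \<le> y) (d # ds)" by auto
      moreover have "set (d # ds) \<subseteq> {d \<in> D. lo \<le> d \<and> d < hi}"
        using ds(2) d by fastforce
      ultimately show ?thesis using ds(1) by (intro disjI1 exI[of _ "d # ds"]) simp
    next
      fix xs assume xs: "length xs = t" "set xs \<subseteq> {..hi}"
        "{e \<in> D. d + G \<le> e \<and> e < hi} \<subseteq> (\<Union>x\<in>set xs. {x..<x + G})"
      have "{d \<in> D. lo \<le> d \<and> d < hi} \<subseteq> (\<Union>x\<in>set (d # xs). {x..<x + G})"
      proof
        fix e assume e: "e \<in> {d \<in> D. lo \<le> d \<and> d < hi}"
        show "e \<in> (\<Union>x\<in>set (d # xs). {x..<x + G})"
        proof (cases "e < d + G")
          case True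
          then show ?thesis using least[OF e] by auto
        next
          case False
          then have "e \<in> {e \<in> D. d + G \<le> e \<and> e < hi}" using e by auto
          then have "e \<in> (\<Union>x\<in>set xs. {x..<x + G})" by (rule subsetD[OF xs(3)])
          then show ?thesis by auto
        qed
      qed
      then show ?thesis using xs d by (intro disjI2 exI[of _ "d # xs"]) auto
    qed
  qed
qed

definition changes :: "nat \<Rightarrow> (nat \<Rightarrow> bool) \<Rightarrow> nat set" where
  "changes n w = {i. Suc i < n \<and> w i \<noteq> w (Suc i)}"

lemma finite_changes: "finite (changes n w)"
  by (rule finite_subset[of _ "{..<n}"]) (auto simp: changes_def)

text \<open>The clause on \<open>last xs\<close> is what the induction needs: \<open>Suc n\<close>
  can be appended exactly when the value changes between \<open>n\<close> and
  \<open>Suc n\<close>.\<close>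

lemma alternating_list:
  "\<exists>xs. sorted_wrt (<) xs \<and> set xs \<subseteq> {..n} \<and> length xs = Suc (card (changes (Suc n) w)) \<and>
    (\<forall>j. Suc j < length xs \<longrightarrow> w (xs ! j) \<noteq> w (xs ! Suc j)) \<and> w (last xs) = w n"
proof (induction n)
  case 0
  have "changes (Suc 0) w = {}" by (auto simp: changes_def)
  then show ?case by (intro exI[of _ "[0]"]) auto
next
  case (Suc n)
  then obtain xs where xs: "sorted_wrt (<) xs" "set xs \<subseteq> {..n}" "length xs = Suc (card (changes (Suc n) w))"
    "\<forall>j. Suc j < length xs \<longrightarrow> w (xs ! j) \<noteq> w (xs ! Suc j)" "w (last xs) = w n" by blast
  show ?case
  proof (cases "w n = w (Suc n)")
    case True
    then have "changes (Suc (Suc n)) w = changes (Suc n) w" by (auto simp: changes_def less_Suc_eq)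
    then show ?thesis using xs True by (intro exI[of _ xs]) auto
  next
    case False
    then have "changes (Suc (Suc n)) w = insert n (changes (Suc n) w)" by (auto simp: changes_def less_Suc_eq)
    moreover have "n \<notin> changes (Suc n) w" by (simp add: changes_def)
    ultimately have card: "card (changes (Suc (Suc n)) w) = Suc (card (changes (Suc n) w))"
      using finite_changes by simp
    have ne: "xs \<noteq> []" using xs(3) by auto
    let ?ys = "xs @ [Suc n]"
    have "w (?ys ! j) \<noteq> w (?ys ! Suc j)" if "Suc j < length ?ys" for j
    proof (cases "Suc j < length xs")
      case True
      then show ?thesis using xs(4) by (simp add: nth_append)
    next
      case False
      then have "j = length xs - 1" "Suc j = length xs" using that by auto
      then have "?ys ! j = last xs" "?ys ! Suc j = Suc n"
        using ne by (simp_all add: nth_append last_conv_nth)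
      then show ?thesis using xs(5) \<open>w n \<noteq> w (Suc n)\<close> by simp
    qed
    moreover have "sorted_wrt (<) ?ys" using xs(1,2) by (auto simp: sorted_wrt_append)
    ultimately show ?thesis using xs(2,3) card by (intro exI[of _ ?ys]) auto
  qed
qed

text \<open>A gap of length \<open>2 * k + 3\<close> between two change positions leaves room for a pair of
  consecutive positions without a change, since there are fewer than \<open>2 * k\<close> changes.\<close>

lemma alternating_pairs:
  assumes few: "card (changes n w) < 2 * k" and "k \<ge> 1"
    and ds: "length ds = k" "set ds \<subseteq> {d \<in> changes n w. 2 * k + 3 \<le> d \<and> d < n - (2 * k + 3)}"
      "sorted_wrt (\<lambda>x y. x + (2 * k + 3) \<le> y) ds"
  obtains a :: "nat \<Rightarrow> nat" where "\<And>j. j < 2 * k \<Longrightarrow> a j + 2 \<le> a (Suc j)" "Suc (a (2 * k)) < n"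
    "\<And>j. j \<le> 2 * k \<Longrightarrow> w (a j) \<noteq> w (Suc (a j)) \<longleftrightarrow> odd j"
proof -
  have "\<exists>i. x \<le> i \<and> i < x + 2 * k \<and> i \<notin> changes n w" for x
  proof (rule ccontr)
    assume "\<not> ?thesis"
    then have "{x..<x + 2 * k} \<subseteq> changes n w" by auto
    from card_mono[OF finite_changes this] show False using few by simp
  qed
  then obtain gap where gap: "\<And>x. x \<le> gap x \<and> gap x < x + 2 * k \<and> gap x \<notin> changes n w" by metis
  have nth: "ds ! j \<in> changes n w" "2 * k + 3 \<le> ds ! j" "ds ! j < n - (2 * k + 3)" if "j < k" for j
  proof -
    have "ds ! j \<in> set ds" using ds(1) that by simp
    then have "ds ! j \<in> {d \<in> changes n w. 2 * k + 3 \<le> d \<and> d < n - (2 * k + 3)}"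
      by (rule subsetD[OF ds(2)])
    then show "ds ! j \<in> changes n w" "2 * k + 3 \<le> ds ! j" "ds ! j < n - (2 * k + 3)" by simp_all
  qed
  have step: "ds ! j + (2 * k + 3) \<le> ds ! Suc j" if "Suc j < k" for j
    using ds(1,3) that by (simp add: sorted_wrt_iff_nth_less)
  \<comment> \<open>Odd places hold the changes; even places hold unchanged pairs, found behind the
    previous change or, for \<open>j = 0\<close>, at the beginning. The search starts 2 behind a
    change to keep the pairs disjoint. The unchanged pair thus begins at most
    \<open>2 * k + 1\<close> behind the change, and the 2 places it occupies give the constant
    \<open>2 * k + 3\<close>.\<close>
  define a where "a j = (if odd j then ds ! (j div 2) else if j = 0 then gap 0 else gap (ds ! (j div 2 - 1) + 2))" for j
  have odd: "a (Suc (2 * i)) = ds ! i" for i by (simp add: a_def)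
  have even: "a (2 * Suc i) = gap (ds ! i + 2)" for i by (simp add: a_def)
  have zero: "a 0 = gap 0" by (simp add: a_def)
  have "a j + 2 \<le> a (Suc j)" if "j < 2 * k" for j
  proof (cases "even j")
    case True
    then obtain i where i: "j = 2 * i" by (elim evenE)
    show ?thesis
    proof (cases i)
      case 0
      then show ?thesis using gap[of 0] nth(2)[of 0] \<open>k \<ge> 1\<close> zero odd[of 0] i by simp
    next
      case (Suc i')
      then show ?thesis using gap[of "ds ! i' + 2"] step[of i'] that i even[of i'] odd[of i] by simp
    qed
  next
    case False
    then obtain i where i: "j = Suc (2 * i)" by (elim oddE) simp
    then have "a (Suc j) = gap (ds ! i + 2)" "a j = ds ! i" using even[of i] odd[of i] by simp_all
    then show ?thesis using gap[of "ds ! i + 2"] by simp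
  qed
  moreover have last: "Suc (a (2 * k)) < n"
  proof -
    obtain i where i: "k = Suc i" using \<open>k \<ge> 1\<close> by (cases k) auto
    then have "a (2 * k) = gap (ds ! i + 2)" "ds ! i < n - (2 * k + 3)"
      using even[of i] nth(3)[of i] by simp_all
    then show ?thesis using gap[of "ds ! i + 2"] by arith
  qed
  moreover have "w (a j) \<noteq> w (Suc (a j)) \<longleftrightarrow> odd j" if "j \<le> 2 * k" for j
  proof (cases "even j")
    case False
    then obtain i where i: "j = Suc (2 * i)" by (elim oddE) simp
    then show ?thesis using nth(1)[of i] that odd[of i] by (simp add: changes_def)
  next
    case True
    have mono: "a j \<le> a (2 * k)" if "j \<le> 2 * k" for j
      using that
    proof (induction rule: inc_induct)
      case (step j)
      then show ?case using \<open>\<And>j. j < 2 * k \<Longrightarrow> a j + 2 \<le> a (Suc j)\<close>[of j] by simp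
    qed simp
    have "a j \<notin> changes n w" using True gap by (simp add: a_def)
    moreover have "Suc (a j) < n" using mono[OF that] last by simp
    ultimately show ?thesis using True by (simp add: changes_def)
  qed
  ultimately show ?thesis by (rule that)
qed

text \<open>A subset of \<open>{..<n}\<close> is determined by its changes and by whether it
  contains 0, which gives the factor 2. The changes lie in one of at most
  \<open>(n + 1) ^ (k - 1)\<close> sets \<open>U xs\<close>, each with at most
  \<open>(k + 1) * G\<close> elements.\<close>

lemma card_few_changes:
  fixes n k G :: nat
  assumes "k \<ge> 1"
  defines "U \<equiv> \<lambda>xs. {..<G} \<union> {n - G..<n} \<union> (\<Union>x\<in>set xs. {x..<x + G})"
  shows "card {W. W \<subseteq> {..<n} \<and> (\<exists>xs. length xs = k - 1 \<and> set xs \<subseteq> {..n} \<and> changes n (\<lambda>i. i \<in> W) \<subseteq> U xs)}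
    \<le> 2 * 2 ^ ((k + 1) * G) * (n + 1) ^ (k - 1)" (is "card ?\<W> \<le> _")
proof -
  let ?Ls = "{xs. set xs \<subseteq> {..n} \<and> length xs = k - 1}"
  let ?F = "\<Union>xs\<in>?Ls. Pow (U xs)"
  let ?f = "\<lambda>W. (0 \<in> W, changes n (\<lambda>i. i \<in> W))"
  have finU: "finite (U xs)" for xs by (simp add: U_def)
  have finL: "finite ?Ls" by (rule finite_lists_length_eq) simp
  have cardU: "card (U xs) \<le> (k + 1) * G" if "xs \<in> ?Ls" for xs
  proof -
    have "card (\<Union>x\<in>set xs. {x..<x + G}) \<le> (\<Sum>x\<in>set xs. card {x..<x + G})"
      by (rule card_UN_le) simp
    also have "\<dots> \<le> length xs * G" using card_length[of xs] by simp
    finally have "card (\<Union>x\<in>set xs. {x..<x + G}) \<le> (k - 1) * G" using that by simp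
    moreover have "card (U xs) \<le> card {..<G} + card {n - G..<n} + card (\<Union>x\<in>set xs. {x..<x + G})"
      unfolding U_def by (meson card_Un_le add_le_mono order_trans order_refl)
    moreover have "card {n - G..<n} \<le> G" by simp
    ultimately have "card (U xs) \<le> G + G + (k - 1) * G" by simp
    also have "\<dots> = (k + 1) * G" using \<open>k \<ge> 1\<close> by (cases k) auto
    finally show ?thesis .
  qed
  have "inj_on ?f (Pow {..<n})"
  proof (rule inj_onI)
    fix W W' assume W: "W \<in> Pow {..<n}" "W' \<in> Pow {..<n}" "?f W = ?f W'"
    have "i \<in> W \<longleftrightarrow> i \<in> W'" if "i < n" for i
      using that
    proof (induction i)
      case (Suc i)
      have "i \<in> changes n (\<lambda>i. i \<in> W) \<longleftrightarrow> i \<in> changes n (\<lambda>i. i \<in> W')" using W(3) by simp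
      then show ?case using Suc by (auto simp: changes_def)
    qed (use W(3) in simp)
    then show "W = W'" using W(1,2) by blast
  qed
  then have "inj_on ?f ?\<W>" by (rule inj_on_subset) auto
  moreover have "?f ` ?\<W> \<subseteq> UNIV \<times> ?F" by blast
  moreover have finF: "finite ?F" using finL finU by simp
  ultimately have "card ?\<W> \<le> card ((UNIV :: bool set) \<times> ?F)"
    by (intro card_inj_on_le[of ?f]) auto
  also have "\<dots> = 2 * card ?F" by (simp add: card_cartesian_product)
  also have "card ?F \<le> (\<Sum>xs\<in>?Ls. card (Pow (U xs)))" by (rule card_UN_le[OF finL])
  also have "\<dots> \<le> (\<Sum>xs\<in>?Ls. 2 ^ ((k + 1) * G))"
    using cardU by (intro sum_mono) (simp add: card_Pow[OF finU])
  also have "\<dots> = (n + 1) ^ (k - 1) * 2 ^ ((k + 1) * G)"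
    using card_lists_length_eq[of "{..n}" "k - 1"] by simp
  finally show ?thesis by (simp add: mult_ac)
qed

lemma vc_density_le:
  assumes "k \<ge> 1" and "\<And>C'. finite C' \<Longrightarrow> C' \<subseteq> C \<Longrightarrow> card (phi_types M m p \<phi> C') \<le> K * (card C' + 1) ^ (k - 1)"
  shows "vc_density M m p \<phi> C \<le> ereal (real k - 1)"
  unfolding vc_density_def
proof (rule Inf_lower, intro CollectI exI conjI)
  let ?f = "\<lambda>n. real (K * (n + 1) ^ (k - 1))"
  show "0 \<le> real k - 1" using assms(1) by simp
  show "?f \<in> O(\<lambda>n. real n powr (real k - 1))"
  proof (rule bigoI)
    show "\<forall>\<^sub>F n in sequentially. norm (?f n) \<le> (K * 2 ^ (k - 1)) * norm (real n powr (real k - 1))"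
      using eventually_ge_at_top[of 1]
    proof eventually_elim
      case (elim n)
      have "real n powr (real k - 1) = real n ^ (k - 1)"
        using elim assms(1) powr_realpow[of "real n" "k - 1"] by (simp add: of_nat_diff)
      \<comment> \<open>For positive \<open>n\<close>, replacing \<open>n + 1\<close> by
        \<open>2 * n\<close> costs only a constant factor.\<close>
      moreover have "(real n + 1) ^ (k - 1) \<le> (2 * real n) ^ (k - 1)"
        using elim by (intro power_mono) auto
      ultimately show ?case by (simp add: power_mult_distrib mult.assoc mult_left_mono add.commute)
    qed
  qed
  show "\<forall>C'. finite C' \<and> C' \<subseteq> C \<longrightarrow> real (card (phi_types M m p \<phi> C')) \<le> ?f (card C')"
    using assms(2) by (simp only: of_nat_le_iff) blast
qed auto

section \<open>From large density to alternation\<close>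

context saturated_over
begin

text \<open>A \<open>\<phi>\<close>-type over \<open>C\<close> is coded by the set of positions at
  which it contains \<open>\<phi>\<close>. Few alternations of \<open>\<phi>\<close> bound the
  number of changes, and few alternations of \<open>\<psi>\<close> bound the number of their
  clusters. The resulting polynomial bound of degree \<open>k - 1\<close> contradicts the
  density.\<close>

lemma alt_if_vc_density:
  fixes r :: "'i rel"
  assumes inf: "infinite (UNIV :: 'i set)" and p: "type_over L M A m p" and "k \<ge> 1"
    and \<phi>: "is_fm L (n + m) \<phi>" and ind: "indiscernible L M A n r b"
    and dens: "vc_density M m p \<phi> (b ` Field r) > ereal (real k - 1)"
  shows "\<exists>n \<phi>. is_fm L (n + m) \<phi> \<and> alt_ge TYPE('i) L M A m p n \<phi> (2 * k)"
proof (rule ccontr)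
  assume no: "\<not> ?thesis"
  obtain \<psi> where \<psi>: "is_fm L (n + n + m) \<psi>"
    "\<And>x x' c. length x = n \<Longrightarrow> length x' = n \<Longrightarrow> length c = m \<Longrightarrow>
      holds M \<psi> ((x @ x') @ c) \<longleftrightarrow> holds M \<phi> (x @ c) \<noteq> holds M \<phi> (x' @ c)"
    using xor_formula[OF \<phi>] by metis
  have no1: "\<not> alt_ge TYPE('i) L M A m p n \<phi> (2 * k)" and no2: "\<not> alt_ge TYPE('i) L M A m p (n + n) \<psi> (2 * k)"
    using no \<phi> \<psi>(1) by blast+
  have r: "Linear_order r" and len: "\<And>i. i \<in> Field r \<Longrightarrow> length (b i) = n"
    using ind by (auto simp: indiscernible_def tuple_seq_def)
  define G where "G = 2 * k + 3"
  define K :: nat where "K = 2 * 2 ^ ((k + 1) * G)"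
  have "card (phi_types M m p \<phi> C) \<le> K * (card C + 1) ^ (k - 1)" if C: "finite C" "C \<subseteq> b ` Field r" for C
  proof -
    \<comment> \<open>\<open>b\<close> may repeat values, so one index is chosen for each element of
      \<open>C\<close>.\<close>
    obtain S where S: "S \<subseteq> Field r" "inj_on b S" "C = b ` S"
      using C(2) unfolding subset_image_inj by blast
    have finS: "finite S" using C(1) S(2,3) finite_image_iff by blast
    obtain xs where xs: "set xs = S" "increasing r xs"
      using increasing_list_of_finite[OF r finS S(1)] by blast
    define N where "N = length xs"
    have N: "card C = N"
      using distinct_card[OF increasing_distinct[OF xs(2)]]
      by (simp add: N_def S(3) card_image[OF S(2)] xs(1))
    have C_eq: "C = (\<lambda>j. b (xs ! j)) ` {..<N}"
      unfolding S(3) xs(1)[symmetric] N_def by (auto simp: set_conv_nth)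
    define W where "W q = {j. j < N \<and> (\<phi>, b (xs ! j)) \<in> q}" for q
    have sub: "increasing r (map ((!) xs) js)" if "sorted_wrt (<) js" "set js \<subseteq> {..<N}" for js
      unfolding increasing_def
    proof
      have "xs ! j \<in> Field r" if "j < N" for j
        using that xs(1) S(1) nth_mem[of j xs] unfolding N_def by blast
      then show "set (map ((!) xs) js) \<subseteq> Field r" using that(2) by auto
      have "(xs ! i, xs ! j) \<in> r \<and> xs ! i \<noteq> xs ! j" if "i \<in> set js" "j \<in> set js" "i < j" for i j
        using that \<open>set js \<subseteq> {..<N}\<close> xs(2) unfolding increasing_def N_def
        by (auto simp: sorted_wrt_iff_nth_less)
      then show "sorted_wrt (\<lambda>i j. (i, j) \<in> r \<and> i \<noteq> j) (map ((!) xs) js)"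
        unfolding sorted_wrt_map using that(1) by (auto intro: sorted_wrt_mono_rel[rotated])
    qed
    have "inj_on W (phi_types M m p \<phi> C)"
    proof (rule inj_onI)
      fix q q' assume q: "q \<in> phi_types M m p \<phi> C" "q' \<in> phi_types M m p \<phi> C" "W q = W q'"
      have pos: "(\<phi>, x) \<in> q \<longleftrightarrow> (\<phi>, x) \<in> q'" if "x \<in> C" for x
        using that q(3) unfolding C_eq W_def by blast
      have neg: "(Neg \<phi>, x) \<in> q \<longleftrightarrow> (Neg \<phi>, x) \<in> q'" if "x \<in> C" for x
        using pos[OF that] q(1,2) that unfolding phi_types_def by blast
      have "q \<subseteq> {\<phi>, Neg \<phi>} \<times> C" "q' \<subseteq> {\<phi>, Neg \<phi>} \<times> C" using q(1,2) by (auto simp: phi_types_def)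
      then show "q = q'" using pos neg by blast
    qed
    moreover have "W q \<subseteq> {..<N} \<and> (\<exists>ys. length ys = k - 1 \<and> set ys \<subseteq> {..N} \<and>
        changes N (\<lambda>i. i \<in> W q) \<subseteq> {..<G} \<union> {N - G..<N} \<union> (\<Union>y\<in>set ys. {y..<y + G}))"
      if q: "q \<in> phi_types M m p \<phi> C" for q
    proof
      show "W q \<subseteq> {..<N}" by (auto simp: W_def)
      have lenC: "length x = n" if "x \<in> C" for x
        using that C(2) len by auto
      have q': "q \<subseteq> {\<phi>, Neg \<phi>} \<times> C" "consistent M m (p \<union> q)"
        "\<And>x. x \<in> C \<Longrightarrow> ((\<phi>, x) \<in> q) \<noteq> ((Neg \<phi>, x) \<in> q)"
        using q by (auto simp: phi_types_def)
      obtain c where c: "realizes M m c p" "realizes M m c q"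
      proof (rule realizes_if_consistent[OF p q'(2)])
        show "countable (\<Union>x\<in>C. set x)" using C(1) by (intro countable_finite) auto
        show "set a \<subseteq> (\<Union>x\<in>C. set x) \<and> is_fm L (length a + m) \<chi>" if "(\<chi>, a) \<in> q" for \<chi> a
          using that q'(1) lenC \<phi> by fastforce
      qed
      have lenc: "length c = m" using c by (simp add: realizes_def)
      have W: "holds M \<phi> (b (xs ! j) @ c) \<longleftrightarrow> j \<in> W q" if "j < N" for j
      proof -
        have "b (xs ! j) \<in> C" using that C_eq by blast
        from q'(3)[OF this] show ?thesis
          using c(2) that unfolding realizes_def W_def by fastforce
      qed
      let ?w = "\<lambda>i. i \<in> W q"
      have few: "card (changes N ?w) < 2 * k"
      proof (rule ccontr)
        assume many: "\<not> ?thesis"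
        then have "N \<noteq> 0" using \<open>k \<ge> 1\<close> by (intro notI) (simp add: changes_def)
        then obtain N' where N': "N = Suc N'" by (cases N) auto
        from alternating_list[of N' ?w, folded N']
        obtain ys where ys: "sorted_wrt (<) ys" "set ys \<subseteq> {..N'}" "length ys = Suc (card (changes N ?w))"
          "\<forall>j. Suc j < length ys \<longrightarrow> ?w (ys ! j) \<noteq> ?w (ys ! Suc j)" by blast
        let ?js = "map ((!) xs) (take (Suc (2 * k)) ys)"
        have lenys: "length ys \<ge> Suc (2 * k)" using ys(3) many by simp
        have ysN: "ys ! j < N" if "j < length ys" for j
          using ys(2) nth_mem[OF that] N' by auto
        have "increasing r ?js"
          using ys(1,2) N' set_take_subset[of "Suc (2 * k)" ys] by (intro sub sorted_wrt_take) auto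
        moreover have "length ?js = Suc (2 * k)" using lenys by simp
        moreover have "holds M \<phi> (b (?js ! j) @ c) \<noteq> holds M \<phi> (b (?js ! Suc j) @ c)" if "j < 2 * k" for j
          using that lenys ys(4) W[OF ysN, of j] W[OF ysN, of "Suc j"] by simp
        ultimately have "alt_ge TYPE('i) L M A m p n \<phi> (2 * k)"
          using ind c(1) unfolding alt_ge_def by blast
        then show False using no1 by contradiction
      qed
      \<comment> \<open>The alternative to a cover by \<open>k - 1\<close> intervals is a list of
        \<open>k\<close> changes far apart, which makes \<open>\<psi>\<close> alternate too
        often.\<close>
      from greedy_cover[of "k - 1" "changes N ?w" G "N - G" G]
      show "\<exists>ys. length ys = k - 1 \<and> set ys \<subseteq> {..N} \<and>
        changes N ?w \<subseteq> {..<G} \<union> {N - G..<N} \<union> (\<Union>y\<in>set ys. {y..<y + G})"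
      proof (elim disjE exE conjE)
        fix ys assume ys: "length ys = k - 1" "set ys \<subseteq> {..N - G}"
          "{d \<in> changes N ?w. G \<le> d \<and> d < N - G} \<subseteq> (\<Union>x\<in>set ys. {x..<x + G})"
        have "changes N ?w \<subseteq> {..<N}" by (auto simp: changes_def)
        then have "changes N ?w \<subseteq> {..<G} \<union> {N - G..<N} \<union> {d \<in> changes N ?w. G \<le> d \<and> d < N - G}"
          by auto
        moreover have "set ys \<subseteq> {..N}" using ys(2) by fastforce
        ultimately show ?thesis using ys(1,3) by blast
      next
        fix ds assume ds: "length ds = Suc (k - 1)" "set ds \<subseteq> {d \<in> changes N ?w. G \<le> d \<and> d < N - G}"
          "sorted_wrt (\<lambda>x y. x + G \<le> y) ds"
        obtain a :: "nat \<Rightarrow> nat" where a: "\<And>j. j < 2 * k \<Longrightarrow> a j + 2 \<le> a (Suc j)" "Suc (a (2 * k)) < N"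
          "\<And>j. j \<le> 2 * k \<Longrightarrow> ?w (a j) \<noteq> ?w (Suc (a j)) \<longleftrightarrow> odd j"
          using alternating_pairs[OF few \<open>k \<ge> 1\<close>, of ds] ds \<open>k \<ge> 1\<close> unfolding G_def by auto
        \<comment> \<open>The values at \<open>2 * j\<close> and \<open>2 * j + 1\<close> are the
          two members of the pair at \<open>a j\<close>.\<close>
        define g where "g s = a (s div 2) + s mod 2" for s
        have gstep: "g s < g (Suc s)" if "Suc s < 2 * Suc (2 * k)" for s
        proof (cases "even s")
          case True
          then show ?thesis by (auto simp: g_def elim!: evenE)
        next
          case False
          then obtain i where i: "s = Suc (2 * i)" by (elim oddE) simp
          then have "g s = a i + 1" "g (Suc s) = a (Suc i)" by (simp_all add: g_def)
          then show ?thesis using a(1)[of i] that i by simp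
        qed
        have gmono: "g s < g t" if "s < t" "t < 2 * Suc (2 * k)" for s t
          using that
        proof (induction t)
          case (Suc t)
          then show ?case using gstep[of t] by (cases "s = t") auto
        qed simp
        define js where "js = map g [0..<2 * Suc (2 * k)]"
        have "(2 * (2 * k) + 1) div 2 = 2 * k" "(2 * (2 * k) + 1) mod 2 = (1 :: nat)" by presburger+
        then have "g (2 * (2 * k) + 1) = a (2 * k) + 1" by (simp only: g_def)
        then have gN: "g s < N" if "s < 2 * Suc (2 * k)" for s
          using gmono[of s "2 * (2 * k) + 1"] that a(2) by (cases "s = 2 * (2 * k) + 1") auto
        have "sorted_wrt (<) js"
          using gmono by (auto simp: js_def sorted_wrt_iff_nth_less simp del: upt_Suc)
        moreover have "set js \<subseteq> {..<N}" using gN by (auto simp: js_def simp del: upt_Suc)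
        ultimately have inc: "increasing r (map ((!) xs) js)" by (rule sub)
        have "alt_ge TYPE('i) L M A m p (n + n) \<psi> (2 * k)"
        proof (rule alt_ge_pairs[OF inf ind c(1) inc _ _ \<psi>(2)])
          show "length (map ((!) xs) js) = 2 * Suc (2 * k)" by (simp add: js_def del: upt_Suc)
          fix j assume j: "j \<le> 2 * k"
          then have "map ((!) xs) js ! (2 * j) = xs ! a j" "map ((!) xs) js ! (2 * j + 1) = xs ! Suc (a j)"
            by (simp_all add: js_def g_def del: upt_Suc)
          moreover have "a j < N" "Suc (a j) < N"
            using gN[of "2 * j"] gN[of "2 * j + 1"] j by (simp_all add: g_def)
          ultimately show "(holds M \<phi> (b (map ((!) xs) js ! (2 * j)) @ c) \<noteq>
              holds M \<phi> (b (map ((!) xs) js ! (2 * j + 1)) @ c)) \<longleftrightarrow> odd j"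
            using a(3)[OF j] by (simp only: W)
        qed
        then show ?thesis using no2 by contradiction
      qed
    qed
    ultimately have "card (phi_types M m p \<phi> C) \<le> card {W. W \<subseteq> {..<N} \<and> (\<exists>ys. length ys = k - 1 \<and> set ys \<subseteq> {..N} \<and>
        changes N (\<lambda>i. i \<in> W) \<subseteq> {..<G} \<union> {N - G..<N} \<union> (\<Union>y\<in>set ys. {y..<y + G}))}"
      by (intro card_inj_on_le[of W]) (auto intro: finite_subset[of _ "Pow {..<N}"])
    also have "\<dots> \<le> K * (N + 1) ^ (k - 1)"
      unfolding K_def by (rule card_few_changes[OF \<open>k \<ge> 1\<close>])
    finally show ?thesis unfolding N .
  qed
  then have "vc_density M m p \<phi> (b ` Field r) \<le> ereal (real k - 1)"
    by (rule vc_density_le[OF \<open>k \<ge> 1\<close>])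
  then show False using dens by simp
qed

end

theorem theorem5p4:
  fixes L :: "('f, 'r) lang"
    and T :: "('f, 'r) fm set"
    and \<kappa> :: "'k rel"
    and M :: "('f, 'r, 'a) struct"
    and A :: "'a set"
    and m k :: nat
    and p :: "('f, 'r, 'a) pfm set"
  assumes "complete_theory L T"
    and "monster_model L T \<kappa> M"
    and "|A| <o \<kappa>"
    and "type_over L M A m p"
    and "k \<ge> 1"
    and "infinite (UNIV :: 'i set)"
  shows
    "(dp_rank_ge TYPE('i) L M A m p k \<longleftrightarrow>
        (\<exists>n b \<phi>. randomness_pattern L M A m p k n b \<phi>))
   \<and> ((\<exists>n b \<phi>. randomness_pattern L M A m p k n b \<phi>) \<longleftrightarrow>
        (\<exists>n \<phi> (r :: 'i rel) b. is_fm L (n + m) \<phi> \<and> indiscernible L M A n r b \<and>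
           vc_density M m p \<phi> (b ` Field r) \<ge> ereal (real k)))
   \<and> ((\<exists>n \<phi> (r :: 'i rel) b. is_fm L (n + m) \<phi> \<and> indiscernible L M A n r b \<and>
           vc_density M m p \<phi> (b ` Field r) \<ge> ereal (real k)) \<longleftrightarrow>
        (\<exists>n \<phi> (r :: 'i rel) b. is_fm L (n + m) \<phi> \<and> indiscernible L M A n r b \<and>
           vc_density M m p \<phi> (b ` Field r) > ereal (real k - 1)))
   \<and> ((\<exists>n \<phi> (r :: 'i rel) b. is_fm L (n + m) \<phi> \<and> indiscernible L M A n r b \<and>
           vc_density M m p \<phi> (b ` Field r) > ereal (real k - 1)) \<longleftrightarrow>
        (\<exists>n \<phi> (r :: 'i rel) b. is_fm L (n + m) \<phi> \<and> indiscernible L M A n r b \<and>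
           (\<forall>I'. I' \<subseteq> Field r \<and> card I' = k \<longrightarrow>
              (\<exists>c. realizes M m c p \<and> {i \<in> Field r. holds M \<phi> (b i @ c)} = I'))))
   \<and> ((\<exists>n \<phi> (r :: 'i rel) b. is_fm L (n + m) \<phi> \<and> indiscernible L M A n r b \<and>
           (\<forall>I'. I' \<subseteq> Field r \<and> card I' = k \<longrightarrow>
              (\<exists>c. realizes M m c p \<and> {i \<in> Field r. holds M \<phi> (b i @ c)} = I'))) \<longleftrightarrow>
        (\<exists>n \<phi>. is_fm L (n + m) \<phi> \<and> alt_ge TYPE('i) L M A m p n \<phi> (2 * k)))"
proof -
  interpret saturated_over L \<kappa> M A
    using assms(2,3) by unfold_locales (auto simp: monster_model_def)
  note p = \<open>type_over L M A m p\<close> and k = \<open>k \<ge> 1\<close> and inf = \<open>infinite (UNIV :: 'i set)\<close>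
  let ?i = "dp_rank_ge TYPE('i) L M A m p k"
  let ?ii = "\<exists>n b \<phi>. randomness_pattern L M A m p k n b \<phi>"
  let ?iii = "\<exists>n \<phi> (r :: 'i rel) b. is_fm L (n + m) \<phi> \<and> indiscernible L M A n r b \<and>
    vc_density M m p \<phi> (b ` Field r) \<ge> ereal (real k)"
  let ?iv = "\<exists>n \<phi> (r :: 'i rel) b. is_fm L (n + m) \<phi> \<and> indiscernible L M A n r b \<and>
    vc_density M m p \<phi> (b ` Field r) > ereal (real k - 1)"
  let ?v = "\<exists>n \<phi> (r :: 'i rel) b. is_fm L (n + m) \<phi> \<and> indiscernible L M A n r b \<and>
    (\<forall>I'. I' \<subseteq> Field r \<and> card I' = k \<longrightarrow>
      (\<exists>c. realizes M m c p \<and> {i \<in> Field r. holds M \<phi> (b i @ c)} = I'))"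
  let ?vi = "\<exists>n \<phi>. is_fm L (n + m) \<phi> \<and> alt_ge TYPE('i) L M A m p n \<phi> (2 * k)"
  have i_ii: "?i \<Longrightarrow> ?ii"
    by (rule randomness_pattern_if_dp_rank[OF p])
  have ii_v: "?ii \<Longrightarrow> ?v"
    using traces_if_randomness_pattern[OF inf p k] by blast
  have v_iii: ?iii if ?v
  proof -
    from that obtain n \<phi> b and r :: "'i rel" where *: "is_fm L (n + m) \<phi>" "indiscernible L M A n r b"
      "\<forall>I'. I' \<subseteq> Field r \<and> card I' = k \<longrightarrow>
        (\<exists>c. realizes M m c p \<and> {i \<in> Field r. holds M \<phi> (b i @ c)} = I')"
      by (elim exE conjE)
    have "infinite (Field r)" using *(2) by (simp add: indiscernible_def tuple_seq_def)
    from vc_density_ge_if_traces[OF this k, of M m p \<phi> b] * show ?thesis by blast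
  qed
  have iii_iv: ?iv if ?iii
  proof -
    from that obtain n \<phi> b and r :: "'i rel" where *: "is_fm L (n + m) \<phi>" "indiscernible L M A n r b"
      "vc_density M m p \<phi> (b ` Field r) \<ge> ereal (real k)"
      by (elim exE conjE)
    have "ereal (real k - 1) < ereal (real k)" by simp
    also note *(3)
    finally show ?thesis using *(1,2) by blast
  qed
  have iv_vi: ?vi if ?iv
  proof -
    from that obtain n \<phi> b and r :: "'i rel" where "is_fm L (n + m) \<phi>" "indiscernible L M A n r b"
      "vc_density M m p \<phi> (b ` Field r) > ereal (real k - 1)"
      by (elim exE conjE)
    then show ?thesis by (rule alt_if_vc_density[OF inf p k])
  qed
  have vi_i: "?vi \<Longrightarrow> ?i"
    using dp_rank_if_alt[OF inf] by blast
  \<comment> \<open>The statement lists the conditions in another order than the cycle visits them;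
    each of the ten implications follows the cycle from its premise to its conclusion.\<close>
  show ?thesis
    by (intro conjI iffI)
      (erule i_ii, erule vi_i[OF iv_vi[OF iii_iv[OF v_iii[OF ii_v]]]],
       erule v_iii[OF ii_v], erule i_ii[OF vi_i[OF iv_vi[OF iii_iv]]],
       erule iii_iv, erule v_iii[OF ii_v[OF i_ii[OF vi_i[OF iv_vi]]]],
       erule ii_v[OF i_ii[OF vi_i[OF iv_vi]]], erule iii_iv[OF v_iii],
       erule iv_vi[OF iii_iv[OF v_iii]], erule ii_v[OF i_ii[OF vi_i]])
qed

end
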